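(* Let $\alpha$ and $\beta$ be compositions with underlying partitions $\lambda=\widetilde\alpha$ and $\mu=\widetilde\beta$, and let $\nu$ be a partition. Then $\chi(\mathcal S^*_\alpha\cdot\mathcal S^*_\beta)=s_\lambda\cdot s_\mu$, and $$c^\nu_{\lambda\mu}=\sum_{\widetilde\gamma=\nu}C^\gamma_{\alpha\beta},$$ where the sum is over all compositions $\gamma$ with $\widetilde\gamma=\nu$.
   Context: A composition is a finite (possibly empty) sequence of positive integers; $\widetilde\alpha$ is the partition obtained by sorting the parts of $\alpha$ in weakly decreasing order. $s_\lambda$ are the Schur functions in the algebra $Sym$ of symmetric functions, and $c^\nu_{\lambda\mu}$ are the Littlewood-Richardson coefficients, $s_\lambda s_\mu=\sum_\nu c^\nu_{\lambda\mu}s_\nu$. The diagram of a composition $\alpha$ has $\alpha_i$ left-justified cells in row $i$, rows numbered from the top; cells are indexed (row, column). A semistandard composition tableau (SSCT) of (straight) shape $\alpha$ is a filling $T$ of its diagram by positive integers such that: rows weakly decrease left to right; the first column strictly increases top to bottom; and if $i<j$, $(i,k)$ and $(j,k+1)$ are cells of $\alpha$ and $T(j,k+1)\le T(i,k)$, then $(i,k+1)$ is a cell of $\alpha$ and $T(j,k+1)<T(i,k+1)$. The quasisymmetric Schur functions $\mathcal S_\alpha=\sum_T\prod_{c}x_{T(c)}$ (sum over SSCT $T$ of shape $\alpha$, product over its cells) form a basis of the Hopf algebra $QSym$ of quasisymmetric functions over $\mathbb Q$, whose coproduct on the monomial basis is $\Delta M_\alpha=\sum_{\beta\gamma=\alpha}M_\beta\otimes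 M_\gamma$ (concatenation). $NSym$ is the graded Hopf dual of $QSym$, and the noncommutative Schur functions $\mathcal S^*_\alpha$ are the basis of $NSym$ dual to $\{\mathcal S_\alpha\}$. The coefficients $C^\gamma_{\alpha\beta}$ are defined by $\mathcal S^*_\alpha\cdot\mathcal S^*_\beta=\sum_\gamma C^\gamma_{\alpha\beta}\mathcal S^*_\gamma$. The forgetful map $\chi:NSym\to Sym$ is the Hopf algebra morphism dual to the inclusion $Sym\hookrightarrow QSym$ ($Sym$ being identified with its graded dual via the Hall inner product); it sends the dual monomial basis element $M^*_\alpha$ to the complete symmetric function $h_{\widetilde\alpha}$. *)

theory Defs
  imports
    Complex_Main
    "HOL-Library.Poly_Mapping"
    "HOL-Library.Function_Algebras"
begin

section \<open>Formal power series in countably many variables\<close>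

text \<open>
  A monomial is a finitely supported exponent vector. The variables of the paper are
  \<open>x\<^sub>1, x\<^sub>2, \<dots>\<close>; the exponent of \<open>x\<^sub>i\<close> is stored at index \<open>i - 1\<close>, so that every natural number
  indexes a variable.
\<close>

type_synonym monom = "nat \<Rightarrow>\<^sub>0 nat"

typedef mpser = "UNIV :: (monom \<Rightarrow> rat) set"
  morphisms coeff Mpser by simp

setup_lifting type_definition_mpser

lemma mpser_eqI: "(\<And>m. coeff f m = coeff g m) \<Longrightarrow> f = g"
  by (simp add: coeff_inject[symmetric] fun_eq_iff)

lemma finite_monom_splits: "finite {(a, b). a + b = (m :: monom)}"
proof -
  let ?K = "Poly_Mapping.keys m"
  let ?B = "Max (insert 0 (Poly_Mapping.lookup m ` ?K))"
  have bound: "Poly_Mapping.lookup m x \<le> ?B" for x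
    by (cases "x \<in> ?K") (auto simp: in_keys_iff)
  let ?F = "{g. \<forall>x. (x \<in> ?K \<longrightarrow> g x \<in> {..?B}) \<and> (x \<notin> ?K \<longrightarrow> g x = (0::nat))}"
  have "finite ?F"
    by (rule finite_set_of_finite_funs) auto
  moreover have "Poly_Mapping.lookup ` {a. \<exists>b. a + b = m} \<subseteq> ?F"
  proof clarsimp
    fix a b :: monom and x
    assume m: "m = a + b"
    have "Poly_Mapping.lookup a x \<le> Poly_Mapping.lookup m x"
      by (simp add: m lookup_add)
    moreover note bound[of x]
    ultimately show "(x \<in> Poly_Mapping.keys (a + b) \<longrightarrow>
            Poly_Mapping.lookup a x \<le> Max (insert 0 (Poly_Mapping.lookup (a + b) ` Poly_Mapping.keys (a + b)))) \<and>
        (x \<notin> Poly_Mapping.keys (a + b) \<longrightarrow> Poly_Mapping.lookup a x = 0)"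
      unfolding m by (auto simp: in_keys_iff lookup_add)
  qed
  ultimately have "finite (Poly_Mapping.lookup ` {a. \<exists>b. a + b = m})"
    by (rule finite_subset[rotated])
  then have "finite {a. \<exists>b. a + b = m}"
    by (rule finite_imageD) (simp add: inj_on_def)
  moreover have "{(a, b). a + b = m} \<subseteq> (\<lambda>a. (a, m - a)) ` {a. \<exists>b. a + b = m}"
    by auto
  ultimately show ?thesis
    by (meson finite_imageI finite_subset)
qed

instantiation mpser :: comm_ring_1
begin

lift_definition zero_mpser :: mpser is "\<lambda>_. 0" .
lift_definition one_mpser :: mpser is "\<lambda>m. if m = 0 then 1 else 0" .
lift_definition plus_mpser :: "mpser \<Rightarrow> mpser \<Rightarrow> mpser" is "\<lambda>f g m. f m + g m" .
lift_definition minus_mpser :: "mpser \<Rightarrow> mpser \<Rightarrow> mpser" is "\<lambda>f g m. f m - g m" .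
lift_definition uminus_mpser :: "mpser \<Rightarrow> mpser" is "\<lambda>f m. - f m" .
lift_definition times_mpser :: "mpser \<Rightarrow> mpser \<Rightarrow> mpser"
  is "\<lambda>f g m. \<Sum>(a, b) | a + b = m. f a * g b" .

instance
proof
  fix f g h :: mpser
  show "f + g + h = f + (g + h)" by transfer (simp add: fun_eq_iff)
  show "f + g = g + f" by transfer (simp add: fun_eq_iff)
  show "0 + f = f" by transfer simp
  show "- f + f = 0" by transfer simp
  show "f - g = f + - g" by transfer simp
  show "(0 :: mpser) \<noteq> 1" by transfer (auto simp: fun_eq_iff)
  show "(f + g) * h = f * h + g * h"
    by transfer (simp add: fun_eq_iff case_prod_unfold distrib_right sum.distrib)
  show "f * g = g * f"
  proof transfer
    fix f g :: "monom \<Rightarrow> rat"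
    show "(\<lambda>m. \<Sum>(a, b) | a + b = m. f a * g b) = (\<lambda>m. \<Sum>(a, b) | a + b = m. g a * f b)"
      by (intro ext sum.reindex_bij_witness[where i = prod.swap and j = prod.swap])
         (auto simp: add.commute mult.commute)
  qed
  show "1 * f = f"
  proof transfer
    fix f :: "monom \<Rightarrow> rat"
    have "(\<Sum>(a, b) | a + b = m. (if a = 0 then 1 else 0) * f b) = f m" for m
    proof -
      have "(\<Sum>(a, b) | a + b = m. (if a = 0 then 1 else 0) * f b)
          = (\<Sum>(a, b) \<in> {(0 :: monom, m)}. (if a = 0 then 1 else 0) * f b)"
        by (rule sum.mono_neutral_right) (auto simp: finite_monom_splits split: if_splits)
      then show ?thesis by simp
    qed
    then show "(\<lambda>m. \<Sum>(a, b) | a + b = m. (if a = 0 then 1 else 0) * f b) = f" by auto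
  qed
  show "f * g * h = f * (g * h)"
  proof transfer
    fix f g h :: "monom \<Rightarrow> rat"
    have "(\<Sum>(p, c) | p + c = m. (\<Sum>(a, b) | a + b = p. f a * g b) * h c)
        = (\<Sum>(a, q) | a + q = m. f a * (\<Sum>(b, c) | b + c = q. g b * h c))" for m
    proof -
      have "(\<Sum>(p, c) | p + c = m. (\<Sum>(a, b) | a + b = p. f a * g b) * h c)
          = (\<Sum>x \<in> {(p, c). p + c = m}. \<Sum>y \<in> {(a, b). a + b = fst x}. f (fst y) * g (snd y) * h (snd x))"
        by (simp add: case_prod_unfold sum_distrib_right)
      also have "\<dots> = (\<Sum>(x, y) \<in> (SIGMA x:{(p, c). p + c = m}. {(a, b). a + b = fst x}).
                       f (fst y) * g (snd y) * h (snd x))"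
        by (rule sum.Sigma) (auto simp: finite_monom_splits)
      also have "\<dots> = (\<Sum>(x, y) \<in> (SIGMA x:{(a, q). a + q = m}. {(b, c). b + c = snd x}).
                       f (fst x) * (g (fst y) * h (snd y)))"
        by (rule sum.reindex_bij_witness[
              where i = "\<lambda>((a, q), (b, c)). ((a + b, c), (a, b))"
                and j = "\<lambda>((p, c), (a, b)). ((a, b + c), (b, c))"])
           (auto simp: ac_simps)
      also have "\<dots> = (\<Sum>x \<in> {(a, q). a + q = m}. \<Sum>y \<in> {(b, c). b + c = snd x}.
                       f (fst x) * (g (fst y) * h (snd y)))"
        by (rule sum.Sigma[symmetric]) (auto simp: finite_monom_splits)
      also have "\<dots> = (\<Sum>(a, q) | a + q = m. f a * (\<Sum>(b, c) | b + c = q. g b * h c))"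
        by (simp add: case_prod_unfold sum_distrib_left)
      finally show ?thesis .
    qed
    then show "(\<lambda>m. \<Sum>(p, c) | p + c = m. (\<Sum>(a, b) | a + b = p. f a * g b) * h c)
        = (\<lambda>m. \<Sum>(a, q) | a + q = m. f a * (\<Sum>(b, c) | b + c = q. g b * h c))"
      by auto
  qed
qed

end

lift_definition mscale :: "rat \<Rightarrow> mpser \<Rightarrow> mpser" is "\<lambda>c f m. c * f m" .

interpretation ser: vector_space mscale
  by unfold_locales (transfer; simp add: fun_eq_iff algebra_simps)+

definition mdeg :: "monom \<Rightarrow> nat" where
  "mdeg m = (\<Sum>i\<in>Poly_Mapping.keys m. Poly_Mapping.lookup m i)"

definition bounded_degree :: "mpser \<Rightarrow> bool" where
  "bounded_degree f \<longleftrightarrow> (\<exists>n. \<forall>m. coeff f m \<noteq> 0 \<longrightarrow> mdeg m \<le> n)"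

text \<open>The nonzero exponents of a monomial, in the order of the variables.\<close>

definition exponents :: "monom \<Rightarrow> nat list" where
  "exponents m = map (Poly_Mapping.lookup m) (sorted_list_of_set (Poly_Mapping.keys m))"


section \<open>Compositions and partitions\<close>

definition is_composition :: "nat list \<Rightarrow> bool" where
  "is_composition \<alpha> \<longleftrightarrow> (\<forall>a\<in>set \<alpha>. 0 < a)"

definition is_partition :: "nat list \<Rightarrow> bool" where
  "is_partition lam \<longleftrightarrow> is_composition lam \<and> sorted_wrt (\<ge>) lam"

definition underlying :: "nat list \<Rightarrow> nat list" where
  "underlying \<alpha> = rev (sort \<alpha>)"

text \<open>Cells are (row, column) with both coordinates counted from 0; row 0 is the top row.\<close>

definition diagram :: "nat list \<Rightarrow> (nat \<times> nat) set" where
  "diagram \<alpha> = {(i, k). i < length \<alpha> \<and> k < \<alpha> ! i}"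

text \<open>
  Tableaux are functions on all of \<open>nat \<times> nat\<close> which are 0 off the diagram, so that distinct
  functions are distinct fillings.
\<close>

definition filling :: "nat list \<Rightarrow> (nat \<times> nat \<Rightarrow> nat) \<Rightarrow> bool" where
  "filling \<alpha> T \<longleftrightarrow> (\<forall>c\<in>diagram \<alpha>. 0 < T c) \<and> (\<forall>c. c \<notin> diagram \<alpha> \<longrightarrow> T c = 0)"

definition weight :: "nat list \<Rightarrow> (nat \<times> nat \<Rightarrow> nat) \<Rightarrow> monom" where
  "weight \<alpha> T = (\<Sum>c\<in>diagram \<alpha>. Poly_Mapping.single (T c - 1) 1)"


section \<open>Symmetric functions\<close>

definition Sym :: "mpser set" where
  "Sym = {f. bounded_degree f \<and>
     (\<forall>\<pi> m. bij \<pi> \<longrightarrow> coeff f (Poly_Mapping.map_key \<pi> m) = coeff f m)}"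

definition msym :: "nat list \<Rightarrow> mpser" where
  "msym lam = Mpser (\<lambda>m. if underlying (exponents m) = lam then 1 else 0)"

definition hcomplete :: "nat \<Rightarrow> mpser" where
  "hcomplete n = Mpser (\<lambda>m. if mdeg m = n then 1 else 0)"

definition hsym :: "nat list \<Rightarrow> mpser" where
  "hsym lam = prod_list (map hcomplete lam)"

definition ssyt :: "nat list \<Rightarrow> (nat \<times> nat \<Rightarrow> nat) \<Rightarrow> bool" where
  "ssyt lam T \<longleftrightarrow> filling lam T \<and>
     (\<forall>i k. (i, k + 1) \<in> diagram lam \<longrightarrow> T (i, k) \<le> T (i, k + 1)) \<and>
     (\<forall>i k. (i + 1, k) \<in> diagram lam \<longrightarrow> T (i, k) < T (i + 1, k))"

text \<open>
  The coefficient of a monomial in a tableau generating function is the number of tableaux of that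
  weight; there are finitely many of them, since their entries are determined by the monomial up
  to arrangement.
\<close>

definition schur :: "nat list \<Rightarrow> mpser" where
  "schur lam = Mpser (\<lambda>m. of_nat (card {T. ssyt lam T \<and> weight lam T = m}))"

definition lr_coeff :: "nat list \<Rightarrow> nat list \<Rightarrow> nat list \<Rightarrow> rat" where
  "lr_coeff lam \<mu> \<nu> =
     ser.representation (schur ` Collect is_partition) (schur lam * schur \<mu>) (schur \<nu>)"

text \<open>The Hall inner product: the bilinear form for which the bases \<open>h\<close> and \<open>m\<close> are dual.\<close>

definition hall :: "mpser \<Rightarrow> mpser \<Rightarrow> rat" where
  "hall f g =
     (let hc = (\<lambda>l. ser.representation (hsym ` Collect is_partition) f (hsym l));
          mc = (\<lambda>l. ser.representation (msym ` Collect is_partition) g (msym l))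
      in \<Sum>l | is_partition l \<and> hc l * mc l \<noteq> 0. hc l * mc l)"


section \<open>Quasisymmetric functions\<close>

definition QSym :: "mpser set" where
  "QSym = {f. bounded_degree f \<and> (\<forall>m m'. exponents m = exponents m' \<longrightarrow> coeff f m = coeff f m')}"

definition mqsym :: "nat list \<Rightarrow> mpser" where
  "mqsym \<alpha> = Mpser (\<lambda>m. if exponents m = \<alpha> then 1 else 0)"

definition ssct :: "nat list \<Rightarrow> (nat \<times> nat \<Rightarrow> nat) \<Rightarrow> bool" where
  "ssct \<alpha> T \<longleftrightarrow> filling \<alpha> T \<and>
     (\<forall>i k. (i, k + 1) \<in> diagram \<alpha> \<longrightarrow> T (i, k + 1) \<le> T (i, k)) \<and>
     (\<forall>i j. i < j \<and> (i, 0) \<in> diagram \<alpha> \<and> (j, 0) \<in> diagram \<alpha> \<longrightarrow> T (i, 0) < T (j, 0)) \<and>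
     (\<forall>i j k. i < j \<and> (i, k) \<in> diagram \<alpha> \<and> (j, k + 1) \<in> diagram \<alpha> \<and> T (j, k + 1) \<le> T (i, k) \<longrightarrow>
        (i, k + 1) \<in> diagram \<alpha> \<and> T (j, k + 1) < T (i, k + 1))"

definition qschur :: "nat list \<Rightarrow> mpser" where
  "qschur \<alpha> = Mpser (\<lambda>m. of_nat (card {T. ssct \<alpha> T \<and> weight \<alpha> T = m}))"

text \<open>
  Elements of \<open>QSym \<otimes> QSym\<close> are given by their coordinates: the pair \<open>(\<beta>, \<gamma>)\<close> stands for the basis
  element \<open>M\<^sub>\<beta> \<otimes> M\<^sub>\<gamma>\<close>.
\<close>

type_synonym qsym_tensor = "(nat list \<times> nat list) \<Rightarrow>\<^sub>0 rat"

definition coproduct :: "mpser \<Rightarrow> qsym_tensor" where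
  "coproduct q =
     (let c = (\<lambda>\<alpha>. ser.representation (mqsym ` Collect is_composition) q (mqsym \<alpha>))
      in \<Sum>\<alpha> | is_composition \<alpha> \<and> c \<alpha> \<noteq> 0.
           \<Sum>(\<beta>, \<gamma>) | \<beta> @ \<gamma> = \<alpha>. Poly_Mapping.single (\<beta>, \<gamma>) (c \<alpha>))"

definition tensor_apply :: "(mpser \<Rightarrow> rat) \<Rightarrow> (mpser \<Rightarrow> rat) \<Rightarrow> qsym_tensor \<Rightarrow> rat" where
  "tensor_apply f g t =
     (\<Sum>(\<beta>, \<gamma>)\<in>Poly_Mapping.keys t. Poly_Mapping.lookup t (\<beta>, \<gamma>) * (f (mqsym \<beta>) * g (mqsym \<gamma>)))"


section \<open>Noncommutative symmetric functions\<close>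

text \<open>
  The graded dual of \<open>QSym\<close>: linear functionals vanishing in all sufficiently large degrees. As HOL
  functions they are normalised to be 0 off \<open>QSym\<close>, so that equality of functions is equality
  in \<open>NSym\<close>.
\<close>

definition NSym :: "(mpser \<Rightarrow> rat) set" where
  "NSym = {f.
     (\<forall>p\<in>QSym. \<forall>q\<in>QSym. f (p + q) = f p + f q) \<and>
     (\<forall>c. \<forall>q\<in>QSym. f (mscale c q) = c * f q) \<and>
     (\<exists>n. \<forall>q\<in>QSym. (\<forall>m. coeff q m \<noteq> 0 \<longrightarrow> n < mdeg m) \<longrightarrow> f q = 0) \<and>
     (\<forall>q. q \<notin> QSym \<longrightarrow> f q = 0)}"

definition fscale :: "rat \<Rightarrow> (mpser \<Rightarrow> rat) \<Rightarrow> mpser \<Rightarrow> rat" where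
  "fscale c f = (\<lambda>q. c * f q)"

interpretation fnl: vector_space fscale
  by unfold_locales (simp_all add: fscale_def fun_eq_iff algebra_simps)

text \<open>
  The product of \<open>NSym\<close> is dual to the coproduct of \<open>QSym\<close>. It is not the pointwise product
  \<open>f * g\<close> of functions.
\<close>

definition nsym_mult :: "(mpser \<Rightarrow> rat) \<Rightarrow> (mpser \<Rightarrow> rat) \<Rightarrow> mpser \<Rightarrow> rat" (infixl \<open>*\<^sub>N\<close> 70) where
  "f *\<^sub>N g = (\<lambda>q. if q \<in> QSym then tensor_apply f g (coproduct q) else 0)"

definition ncschur :: "nat list \<Rightarrow> mpser \<Rightarrow> rat" where
  "ncschur \<alpha> = (THE f. f \<in> NSym \<and>
     (\<forall>\<beta>. is_composition \<beta> \<longrightarrow> f (qschur \<beta>) = (if \<alpha> = \<beta> then 1 else 0)))"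

definition nc_lr_coeff :: "nat list \<Rightarrow> nat list \<Rightarrow> nat list \<Rightarrow> rat" where
  "nc_lr_coeff \<alpha> \<beta> \<gamma> =
     fnl.representation (ncschur ` Collect is_composition) (ncschur \<alpha> *\<^sub>N ncschur \<beta>) (ncschur \<gamma>)"

text \<open>
  The forgetful map: \<open>forget f\<close> is the symmetric function representing, via the Hall inner product,
  the restriction of the functional \<open>f\<close> to \<open>Sym \<subseteq> QSym\<close>.
\<close>

definition forget :: "(mpser \<Rightarrow> rat) \<Rightarrow> mpser" where
  "forget f = (THE g. g \<in> Sym \<and> (\<forall>p\<in>Sym. hall g p = f p))"

end

theory Submission
  imports Defs "HOL-Combinatorics.Permutations"
begin

text \<open>
  Here \<open>M\<^sub>\<alpha>\<close> and \<open>S\<^sub>\<alpha>\<close> denote the monomial and the quasisymmetric Schur functions, \<open>S\<^sup>*\<^sub>\<alpha>\<close> the noncommutative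
  Schur functions, and \<open>K\<close> the matrix of Kostka numbers.

  On a functional \<open>f\<close>, the forgetful map takes the value \<open>\<Sum>\<alpha>. (f M\<^sub>\<alpha>) h\<^sub>\<alpha>\<close>, because the bases \<open>h\<close> and \<open>m\<close> are dual
  for the Hall inner product. It is multiplicative (\<open>hseries_mult\<close>): the product of functionals is dual to
  deconcatenation, and \<open>h\<close> turns concatenation into multiplication. Since \<open>h = K\<^sup>T s\<close> and \<open>s = K m\<close>, the same
  value can be written \<open>\<Sum>\<rho>. (f s\<^sub>\<rho>) s\<^sub>\<rho>\<close> (\<open>hseries_eq_sum_schur\<close>). Each \<open>s\<^sub>\<rho>\<close> is the sum of the \<open>S\<^sub>\<gamma>\<close> over the
  rearrangements \<open>\<gamma>\<close> of \<open>\<rho>\<close> (\<open>schur_eq_sum_qschur\<close>), so \<open>S\<^sup>*\<^sub>\<alpha>\<close> is sent to the Schur function of the partition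
  underlying \<open>\<alpha>\<close>; this gives the first claim. For \<open>F = S\<^sup>*\<^sub>\<alpha> S\<^sup>*\<^sub>\<beta>\<close> the coefficient of \<open>s\<^sub>\<nu>\<close> in the image is \<open>F s\<^sub>\<nu>\<close>,
  the sum of \<open>F S\<^sub>\<gamma>\<close> over the rearrangements \<open>\<gamma>\<close> of \<open>\<nu>\<close>, and \<open>F S\<^sub>\<gamma>\<close> is the coefficient of \<open>S\<^sup>*\<^sub>\<gamma>\<close> in \<open>F\<close>; this gives
  the second.

  The combinatorics behind these expansions is that of Kostka numbers, taken here as numbers of chains of
  horizontal strips with prescribed sizes. They do not depend on the order of the sizes (\<open>kostka_swap\<close>), and
  commuting the addition of a strip with the removal of strips (\<open>kostka_pieri\<close>) yields \<open>h = K\<^sup>T s\<close>. Removing the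
  largest entries of a semistandard tableau step by step produces such a chain (\<open>schur_eq_kostka_series\<close>). A
  composition tableau is determined by the sets of entries of its columns, which again amount to such a
  chain when the smallest entries are removed step by step (\<open>sum_card_ssct\<close>). Finally, a horizontal strip
  takes at most one cell from each column, so \<open>K\<close> is unitriangular for the statistic \<open>\<Sum>i. i \<lambda>\<^sub>i\<close>
  (\<open>kostka_triangular\<close>), and then so is the matrix from \<open>S\<close> to \<open>M\<close> (\<open>comp_kostka_triangular\<close>); this supplies
  all bases and dual bases.
\<close>

section \<open>Horizontal strips and Kostka numbers\<close>

definition cells :: "(nat \<Rightarrow> nat) \<Rightarrow> (nat \<times> nat) set" where
  "cells p = {(i, k). k < p i}"

definition psize :: "(nat \<Rightarrow> nat) \<Rightarrow> nat" where
  "psize p = card (cells p)"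

text \<open>
  Partitions are handled as row-length functions, so that shapes with different numbers of rows can be
  compared row by row without padding.
\<close>

definition partfun :: "(nat \<Rightarrow> nat) \<Rightarrow> bool" where
  "partfun p \<longleftrightarrow> decseq p \<and> (\<exists>L. \<forall>i\<ge>L. p i = 0)"

definition hstrip :: "(nat \<Rightarrow> nat) \<Rightarrow> (nat \<Rightarrow> nat) \<Rightarrow> bool" where
  "hstrip p q \<longleftrightarrow> (\<forall>i. q i \<le> p i \<and> p (Suc i) \<le> q i)"

abbreviation strips_above :: "(nat \<Rightarrow> nat) \<Rightarrow> nat \<Rightarrow> (nat \<Rightarrow> nat) set" where
  "strips_above p n \<equiv> {q. hstrip q p \<and> psize q = psize p + n}"

abbreviation strips_below :: "(nat \<Rightarrow> nat) \<Rightarrow> nat \<Rightarrow> (nat \<Rightarrow> nat) set" where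
  "strips_below p n \<equiv> {q. hstrip p q \<and> psize p = psize q + n}"

text \<open>
  The entries of the list are the sizes of the strips from the outermost to the innermost.
\<close>

primrec kostka :: "(nat \<Rightarrow> nat) \<Rightarrow> nat list \<Rightarrow> nat" where
  "kostka p [] = (if p = (\<lambda>_. 0) then 1 else 0)"
| "kostka p (a # as) = (\<Sum>q\<in>strips_below p a. kostka q as)"

declare kostka.simps(2) [simp del]

lemma psize_eq_sum:
  assumes "\<And>i. i \<ge> L \<Longrightarrow> p i = 0"
  shows "psize p = (\<Sum>i<L. p i)"
proof -
  have "cells p = Sigma {..<L} (\<lambda>i. {..<p i})"
    using assms by (fastforce simp: cells_def not_less[symmetric])
  then show ?thesis by (simp add: psize_def)
qed

lemma finite_cells:
  assumes "partfun p"
  shows "finite (cells p)"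
proof -
  obtain L where L: "\<And>i. i \<ge> L \<Longrightarrow> p i = 0" using assms by (auto simp: partfun_def)
  have "cells p \<subseteq> Sigma {..<L} (\<lambda>i. {..<p i})"
    using L by (fastforce simp: cells_def not_less[symmetric])
  then show ?thesis by (rule finite_subset) simp
qed

lemma cells_mono: "(\<And>i. q i \<le> p i) \<Longrightarrow> cells q \<subseteq> cells p"
  using less_le_trans by (fastforce simp: cells_def)

lemma psize_mono: "partfun p \<Longrightarrow> (\<And>i. q i \<le> p i) \<Longrightarrow> psize q \<le> psize p"
  unfolding psize_def by (intro card_mono finite_cells cells_mono)

lemma cells_inject: "cells p = cells q \<longleftrightarrow> p = q"
proof
  assume "cells p = cells q"
  then have "k < p i \<longleftrightarrow> k < q i" for i k by (auto simp: cells_def set_eq_iff)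
  then show "p = q" by (intro ext) (metis linorder_neqE_nat less_irrefl)
qed simp

lemma psize_eq_imp_eq:
  assumes "partfun p" "\<And>i. q i \<le> p i" "psize p = psize q"
  shows "q = p"
  using card_subset_eq[OF finite_cells[OF assms(1)] cells_mono[of q p, OF assms(2)]] assms(3)
  by (simp add: psize_def cells_inject)

lemma hstrip_le: "hstrip p q \<Longrightarrow> q i \<le> p i"
  and hstrip_Suc_le: "hstrip p q \<Longrightarrow> p (Suc i) \<le> q i"
  by (simp_all add: hstrip_def)

lemma hstrip_partfun_lower: "hstrip p q \<Longrightarrow> partfun p \<Longrightarrow> partfun q"
  unfolding hstrip_def partfun_def decseq_Suc_iff
  by (metis le_zero_eq order_trans)

lemma hstrip_partfun_upper: "hstrip p q \<Longrightarrow> partfun q \<Longrightarrow> partfun p"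
  unfolding hstrip_def partfun_def decseq_Suc_iff
  by (metis Suc_le_D Suc_le_mono le_zero_eq order_trans)

lemma partfun_obtain_bound:
  assumes "partfun p"
  obtains L where "\<And>i. i \<ge> L \<Longrightarrow> p i = 0"
  using assms by (auto simp: partfun_def)

lemma finite_funs_below:
  fixes p :: "nat \<Rightarrow> nat"
  assumes "\<And>i. i \<ge> L \<Longrightarrow> p i = 0"
  shows "finite {q. \<forall>i. q i \<le> p i}"
proof -
  have "{q. \<forall>i. q i \<le> p i} \<subseteq> {q. \<forall>i. (i \<in> {..<L} \<longrightarrow> q i \<in> {..Max (p ` {..<L})}) \<and> (i \<notin> {..<L} \<longrightarrow> q i = 0)}"
  proof (clarsimp, intro conjI impI)
    fix q i assume le: "\<forall>i. q i \<le> p i" and "i < L"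
    then have "p i \<le> Max (p ` {..<L})" by (intro Max_ge) auto
    then show "q i \<le> Max (p ` {..<L})" using le order_trans by blast
  next
    fix q i assume le: "\<forall>i. q i \<le> p i" and "\<not> i < L"
    then have "p i = 0" using assms by simp
    then show "q i = 0" using le[rule_format, of i] by simp
  qed
  then show ?thesis
    by (rule finite_subset) (intro finite_set_of_finite_funs; simp)
qed

lemma finite_hstrip_lower: "partfun p \<Longrightarrow> finite {q. hstrip p q}"
  by (erule partfun_obtain_bound, rule finite_subset[of _ "{q. \<forall>i. q i \<le> p i}", OF _ finite_funs_below])
     (auto simp: hstrip_def)

text \<open>
  If \<open>p\<close>, \<open>q\<close>, \<open>r\<close> form a chain of horizontal strips with \<open>p\<close> and \<open>r\<close> fixed, then the rows of \<open>q\<close> range independently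
  over intervals (\<open>hstrip_pair_iff\<close>). Reflecting every row in its interval is the Bender-Knuth involution.
\<close>

definition toggle :: "(nat \<Rightarrow> nat) \<Rightarrow> (nat \<Rightarrow> nat) \<Rightarrow> (nat \<Rightarrow> nat) \<Rightarrow> nat \<Rightarrow> nat" where
  "toggle p r q i = max (r i) (p (Suc i))
     + (case i of 0 \<Rightarrow> p 0 | Suc j \<Rightarrow> min (p (Suc j)) (r j)) - q i"

lemma toggle_bounds:
  assumes "hstrip p q" "hstrip q r"
  shows "max (r i) (p (Suc i)) \<le> q i" "q i \<le> (case i of 0 \<Rightarrow> p 0 | Suc j \<Rightarrow> min (p (Suc j)) (r j))"
  using assms by (auto simp: hstrip_def split: nat.split)

lemma hstrip_pair_iff:
  "hstrip p q \<and> hstrip q r \<longleftrightarrow>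
     (\<forall>i. max (r i) (p (Suc i)) \<le> q i \<and> q i \<le> (case i of 0 \<Rightarrow> p 0 | Suc j \<Rightarrow> min (p (Suc j)) (r j)))"
proof
  assume R: "\<forall>i. max (r i) (p (Suc i)) \<le> q i \<and> q i \<le> (case i of 0 \<Rightarrow> p 0 | Suc j \<Rightarrow> min (p (Suc j)) (r j))"
  have "q i \<le> p i" for i using R[rule_format, of i] by (cases i) auto
  moreover have "q (Suc i) \<le> r i" for i using R[rule_format, of "Suc i"] by auto
  ultimately show "hstrip p q \<and> hstrip q r" using R by (auto simp: hstrip_def)
qed (auto simp: hstrip_def split: nat.split)

lemma toggle_hstrip:
  assumes "hstrip p q" "hstrip q r"
  shows "hstrip p (toggle p r q)" "hstrip (toggle p r q) r"
proof -
  have "hstrip p (toggle p r q) \<and> hstrip (toggle p r q) r"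
    unfolding hstrip_pair_iff toggle_def using toggle_bounds[OF assms]
    by (intro allI) (smt (verit, best) add_diff_cancel_right' add_le_cancel_left diff_le_mono2 le_add_diff_inverse Nat.add_diff_assoc add.commute diff_le_mono)
  then show "hstrip p (toggle p r q)" "hstrip (toggle p r q) r" by auto
qed

lemma toggle_toggle:
  assumes "hstrip p q" "hstrip q r"
  shows "toggle p r (toggle p r q) = q"
proof
  fix i show "toggle p r (toggle p r q) i = q i"
    unfolding toggle_def using toggle_bounds[OF assms, of i] by linarith
qed

text \<open>
  Row \<open>Suc i\<close> of \<open>p\<close> and row \<open>i\<close> of \<open>r\<close> contribute their maximum to a lower end and their minimum to an upper
  end, so the ends of all intervals add up to the two sizes. Hence reflection exchanges the sizes of the
  strips \<open>p/q\<close> and \<open>q/r\<close>.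
\<close>

lemma psize_toggle:
  assumes "hstrip p q" "hstrip q r" "partfun p"
  shows "psize (toggle p r q) + psize q = psize p + psize r"
proof -
  obtain M where M: "\<And>i. i \<ge> M \<Longrightarrow> p i = 0" using assms(3) partfun_obtain_bound by blast
  have Mq: "q i = 0" if "i \<ge> M" for i using M[OF that] hstrip_le[OF assms(1), of i] by simp
  have Mr: "r i = 0" if "i \<ge> M" for i using Mq[OF that] hstrip_le[OF assms(2), of i] by simp
  have Mt: "toggle p r q i = 0" if "i \<ge> M" for i
    using M[OF that] hstrip_le[OF toggle_hstrip(1)[OF assms(1,2)], of i] by simp
  have S: "psize f = (\<Sum>i<Suc M. f i)" if "\<And>i. i \<ge> M \<Longrightarrow> f i = 0" for f
    using that by (intro psize_eq_sum) simp
  have "psize (toggle p r q) + psize q = (\<Sum>i<Suc M. toggle p r q i + q i)"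
    by (simp only: S[OF Mq] S[OF Mt] sum.distrib)
  also have "\<dots> = (\<Sum>i<Suc M. max (r i) (p (Suc i)) + (case i of 0 \<Rightarrow> p 0 | Suc j \<Rightarrow> min (p (Suc j)) (r j)))"
    unfolding toggle_def using toggle_bounds[OF assms(1,2)]
    by (intro sum.cong refl) (meson le_add_diff_inverse2 trans_le_add2)
  also have "\<dots> = (\<Sum>i<M. max (r i) (p (Suc i))) + (p 0 + (\<Sum>i<M. min (p (Suc i)) (r i)))"
  proof -
    have "(\<Sum>i<Suc M. max (r i) (p (Suc i))) = (\<Sum>i<M. max (r i) (p (Suc i)))"
      using M[of "Suc M"] Mr[of M] by simp
    moreover have "(\<Sum>i<Suc M. case i of 0 \<Rightarrow> p 0 | Suc j \<Rightarrow> min (p (Suc j)) (r j))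
        = p 0 + (\<Sum>i<M. min (p (Suc i)) (r i))"
      unfolding sum.lessThan_Suc_shift by simp
    ultimately show ?thesis by (simp only: sum.distrib)
  qed
  also have "\<dots> = p 0 + (\<Sum>i<M. max (r i) (p (Suc i)) + min (p (Suc i)) (r i))"
    by (simp add: sum.distrib)
  also have "\<dots> = p 0 + (\<Sum>i<M. p (Suc i) + r i)"
    by (rule arg_cong, rule sum.cong) (auto simp: max_def min_def)
  also have "\<dots> = (p 0 + (\<Sum>i<M. p (Suc i))) + (\<Sum>i<M. r i)" by (simp add: sum.distrib)
  also have "\<dots> = psize p + psize r"
    using psize_eq_sum[of M r] Mr S[of p] M sum.lessThan_Suc_shift[of p M] by simp
  finally show ?thesis .
qed

lemma kostka_swap:
  assumes "partfun p"
  shows "kostka p (a # b # as) = kostka p (b # a # as)"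
proof -
  define S where "S a b = (SIGMA q:strips_below p a. strips_below q b)" for a b
  have expand: "kostka p (a # b # as) = (\<Sum>(q, r) \<in> S a b. kostka r as)" for a b
    unfolding S_def kostka.simps(2)
    by (subst sum.Sigma)
       (auto intro: finite_subset[OF _ finite_hstrip_lower] hstrip_partfun_lower assms)
  have size: "psize (toggle p r q) = psize p + psize r - psize q" if "hstrip p q" "hstrip q r" for q r
    using psize_toggle[OF that assms] by simp
  show ?thesis
    unfolding expand
    by (rule sum.reindex_bij_witness[where i = "\<lambda>(q, r). (toggle p r q, r)" and j = "\<lambda>(q, r). (toggle p r q, r)"])
       (auto simp: S_def toggle_toggle toggle_hstrip size)
qed

lemma kostka_move_to_front:
  "partfun p \<Longrightarrow> kostka p (xs @ a # ys) = kostka p (a # xs @ ys)"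
proof (induction xs arbitrary: p)
  case (Cons x xs)
  have "kostka p ((x # xs) @ a # ys) = kostka p (x # a # xs @ ys)"
    unfolding append_Cons kostka.simps(2)[of p x]
    by (intro sum.cong refl) (use Cons hstrip_partfun_lower in auto)
  also have "\<dots> = kostka p (a # x # xs @ ys)" by (rule kostka_swap[OF Cons.prems])
  finally show ?case by simp
qed simp

lemma kostka_mset_cong:
  "partfun p \<Longrightarrow> mset xs = mset ys \<Longrightarrow> kostka p xs = kostka p ys"
proof (induction xs arbitrary: p ys)
  case (Cons a xs)
  then have "a \<in> set ys" by (metis list.set_intros(1) set_mset_mset)
  then obtain ys1 ys2 where ys: "ys = ys1 @ a # ys2" by (meson split_list)
  have "mset xs = mset (ys1 @ ys2)" using Cons.prems(2) by (simp add: ys)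
  have "kostka q xs = kostka q (ys1 @ ys2)" if "hstrip p q" for q
    by (rule Cons.IH[OF hstrip_partfun_lower[OF that Cons.prems(1)] \<open>mset xs = _\<close>])
  then have "kostka p (a # xs) = kostka p (a # ys1 @ ys2)"
    unfolding kostka.simps(2) by (intro sum.cong) auto
  also have "\<dots> = kostka p ys" unfolding ys by (rule kostka_move_to_front[OF Cons.prems(1), symmetric])
  finally show ?case .
qed simp

lemma hstrip_refl: "partfun p \<Longrightarrow> hstrip p p"
  unfolding hstrip_def partfun_def decseq_Suc_iff by blast

lemma kostka_zero: "partfun p \<Longrightarrow> kostka p (0 # as) = kostka p as"
proof -
  assume p: "partfun p"
  then have "strips_below p 0 = {p}"
    using hstrip_refl[OF p] psize_eq_imp_eq[OF p] hstrip_le by fastforce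
  then show ?thesis by (simp add: kostka.simps(2))
qed

lemma kostka_filter:
  "partfun p \<Longrightarrow> kostka p (filter (\<lambda>x. x \<noteq> 0) as) = kostka p as"
proof (induction as arbitrary: p)
  case (Cons a as)
  let ?f = "filter (\<lambda>x. x \<noteq> 0)"
  have IH: "kostka q (?f as) = kostka q as" if "hstrip p q" for q
    by (rule Cons.IH[OF hstrip_partfun_lower[OF that Cons.prems]])
  have step: "kostka p (a # ?f as) = kostka p (a # as)"
    unfolding kostka.simps(2) by (rule sum.cong[OF refl], rule IH) blast
  show ?case
  proof (cases "a = 0")
    case True
    then have "kostka p (?f (a # as)) = kostka p (?f as)" by simp
    also have "\<dots> = kostka p (a # ?f as)" unfolding True by (rule kostka_zero[OF Cons.prems, symmetric])
    finally show ?thesis unfolding step .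
  next
    case False
    then have "?f (a # as) = a # ?f as" by simp
    then show ?thesis unfolding step[symmetric] by metis
  qed
qed simp

lemma psize_0 [simp]: "psize (\<lambda>_. 0) = 0"
  by (simp add: psize_def cells_def)

lemma kostka_nonzero_size: "kostka p as \<noteq> 0 \<Longrightarrow> psize p = sum_list as"
proof (induction as arbitrary: p)
  case (Cons a as)
  obtain q where "q \<in> strips_below p a" "kostka q as \<noteq> 0"
    using Cons.prems unfolding kostka.simps(2) by (rule sum.not_neutral_contains_not_neutral)
  with Cons.IH show ?case by simp
qed (auto split: if_splits)

section \<open>Adding a strip before removing strips\<close>

lemma partfun_le_psize:
  assumes p: "partfun p"
  shows "p i \<le> (if i < psize p then psize p else 0)"
proof -
  have "{..i} \<times> {..<p i} \<subseteq> cells p"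
  proof -
    have "k < p j" if "j \<le> i" "k < p i" for j k
      using that p by (meson decseq_def less_le_trans partfun_def)
    then show ?thesis by (auto simp: cells_def)
  qed
  then have "card ({..i} \<times> {..<p i}) \<le> psize p"
    unfolding psize_def by (rule card_mono[OF finite_cells[OF p]])
  then have le: "Suc i * p i \<le> psize p" by simp
  show ?thesis
  proof (cases "p i = 0")
    case False
    then have "Suc i * 1 \<le> Suc i * p i" by (intro mult_le_mono) auto
    moreover have "p i \<le> Suc i * p i" by simp
    ultimately have "Suc i \<le> Suc i * p i" "p i \<le> Suc i * p i" by simp_all
    then show ?thesis using le by auto
  qed simp
qed

lemma finite_partfun_size: "finite {p. partfun p \<and> psize p = n}"
proof (rule finite_subset)
  show "{p. partfun p \<and> psize p = n} \<subseteq> {p. \<forall>i. p i \<le> (if i < n then n else 0)}"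
    using partfun_le_psize by blast
  show "finite {p. \<forall>i. p i \<le> (if i < n then n else 0)}"
    by (rule finite_funs_below[of n]) simp
qed

lemma hstrip_psize_le: "hstrip p q \<Longrightarrow> partfun p \<Longrightarrow> psize q \<le> psize p"
  using psize_mono[of p q] hstrip_le[of p q] by blast

lemma finite_hstrip_upper: "partfun p \<Longrightarrow> finite {q. hstrip q p \<and> psize q = n}"
  by (rule finite_subset[OF _ finite_partfun_size[of n]]) (auto intro: hstrip_partfun_upper)

lemma hstrip_upper_pair_iff:
  "hstrip \<mu> p \<and> hstrip \<mu> r \<longleftrightarrow>
     max (p 0) (r 0) \<le> \<mu> 0 \<and>
     (\<forall>j. max (p (Suc j)) (r (Suc j)) \<le> \<mu> (Suc j) \<and> \<mu> (Suc j) \<le> min (p j) (r j))"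
proof
  assume R: "max (p 0) (r 0) \<le> \<mu> 0 \<and>
     (\<forall>j. max (p (Suc j)) (r (Suc j)) \<le> \<mu> (Suc j) \<and> \<mu> (Suc j) \<le> min (p j) (r j))"
  then have "p i \<le> \<mu> i \<and> r i \<le> \<mu> i" for i by (cases i) auto
  then show "hstrip \<mu> p \<and> hstrip \<mu> r" using R by (auto simp: hstrip_def)
qed (auto simp: hstrip_def)

lemma hstrip_lower_pair_iff:
  "hstrip p \<kappa> \<and> hstrip r \<kappa> \<longleftrightarrow>
     (\<forall>j. max (p (Suc j)) (r (Suc j)) \<le> \<kappa> j \<and> \<kappa> j \<le> min (p j) (r j))"
  by (auto simp: hstrip_def)

text \<open>
  The local rule of growth diagrams. For a shape \<open>\<mu>\<close> above both \<open>p\<close> and \<open>r\<close> and a shape \<open>\<kappa>\<close> below both, row \<open>Suc j\<close>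
  of \<open>\<mu>\<close> and row \<open>j\<close> of \<open>\<kappa>\<close> range over the same interval, whose ends add up to \<open>ends_sum p r j\<close>. Reflection in
  this interval matches them. Row 0 of \<open>\<mu>\<close> is bounded only from below, and its excess over the bound is a
  further parameter \<open>i\<close>.
\<close>

definition ends_sum :: "(nat \<Rightarrow> nat) \<Rightarrow> (nat \<Rightarrow> nat) \<Rightarrow> nat \<Rightarrow> nat" where
  "ends_sum p r j = max (p (Suc j)) (r (Suc j)) + min (p j) (r j)"

definition local_down :: "(nat \<Rightarrow> nat) \<Rightarrow> (nat \<Rightarrow> nat) \<Rightarrow> (nat \<Rightarrow> nat) \<Rightarrow> nat \<Rightarrow> nat" where
  "local_down p r \<mu> j = ends_sum p r j - \<mu> (Suc j)"

definition local_up :: "(nat \<Rightarrow> nat) \<Rightarrow> (nat \<Rightarrow> nat) \<Rightarrow> nat \<Rightarrow> (nat \<Rightarrow> nat) \<Rightarrow> nat \<Rightarrow> nat" where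
  "local_up p r i \<kappa> j = (case j of 0 \<Rightarrow> max (p 0) (r 0) + i | Suc j \<Rightarrow> ends_sum p r j - \<kappa> j)"

lemma local_rule_size:
  assumes "partfun p" "partfun r"
    and rel: "\<And>j. \<kappa> j + \<mu> (Suc j) = ends_sum p r j" and \<mu>0: "\<mu> 0 = max (p 0) (r 0) + i"
  shows "psize \<kappa> + psize \<mu> = psize p + psize r + i"
proof -
  obtain L1 L2 where L1: "\<And>i. i \<ge> L1 \<Longrightarrow> p i = 0" and L2: "\<And>i. i \<ge> L2 \<Longrightarrow> r i = 0"
    using assms(1,2) partfun_obtain_bound by metis
  define M where "M = max L1 L2"
  have Mp: "p i = 0" and Mr: "r i = 0" if "i \<ge> M" for i
    using L1[of i] L2[of i] that by (auto simp: M_def)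
  have M0: "\<kappa> i = 0 \<and> \<mu> (Suc i) = 0" if "i \<ge> M" for i
    using rel[of i] Mp[of i] Mp[of "Suc i"] Mr[of i] Mr[of "Suc i"] that by (simp add: ends_sum_def)
  have "psize \<mu> = (\<Sum>j<Suc M. \<mu> j)"
    by (rule psize_eq_sum) (metis M0 Suc_le_D Suc_le_mono)
  also have "\<dots> = max (p 0) (r 0) + i + (\<Sum>j<M. \<mu> (Suc j))"
    unfolding sum.lessThan_Suc_shift \<mu>0 by simp
  finally have s\<mu>: "psize \<mu> = max (p 0) (r 0) + i + (\<Sum>j<M. \<mu> (Suc j))" .
  have s\<kappa>: "psize \<kappa> = (\<Sum>j<M. \<kappa> j)"
    by (rule psize_eq_sum) (metis M0)
  have sp: "psize p = (\<Sum>j<M. p j)" and sr: "psize r = (\<Sum>j<M. r j)"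
    by (rule psize_eq_sum; use Mp Mr in blast)+
  have "(\<Sum>j<M. \<kappa> j) + (\<Sum>j<M. \<mu> (Suc j)) = (\<Sum>j<M. ends_sum p r j)"
    by (simp add: sum.distrib[symmetric] rel)
  also have "\<dots> = (\<Sum>j<M. max (p (Suc j)) (r (Suc j))) + (\<Sum>j<M. min (p j) (r j))"
    by (simp add: sum.distrib ends_sum_def)
  finally have "psize \<kappa> + psize \<mu> = i + (max (p 0) (r 0) + (\<Sum>j<M. max (p (Suc j)) (r (Suc j)))) + (\<Sum>j<M. min (p j) (r j))"
    using s\<mu> s\<kappa> by simp
  also have "max (p 0) (r 0) + (\<Sum>j<M. max (p (Suc j)) (r (Suc j))) = (\<Sum>j<Suc M. max (p j) (r j))"
    by (rule sum.lessThan_Suc_shift[symmetric])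
  also have "\<dots> = (\<Sum>j<M. max (p j) (r j))" using Mp[of M] Mr[of M] by simp
  also have "i + \<dots> + (\<Sum>j<M. min (p j) (r j)) = i + (\<Sum>j<M. max (p j) (r j) + min (p j) (r j))"
    by (simp add: sum.distrib)
  also have "(\<Sum>j<M. max (p j) (r j) + min (p j) (r j)) = (\<Sum>j<M. p j + r j)"
    by (rule sum.cong) (auto simp: max_def min_def)
  finally show ?thesis unfolding sp sr by (simp add: sum.distrib)
qed

definition upper_pairs where
  "upper_pairs p n a = {(\<mu>, \<nu>). hstrip \<mu> p \<and> psize \<mu> = psize p + n \<and> hstrip \<mu> \<nu> \<and> psize \<mu> = psize \<nu> + a}"

definition lower_pairs where
  "lower_pairs p n a = {(i, \<kappa>, \<nu>). i \<le> min a n \<and> hstrip p \<kappa> \<and> psize p = psize \<kappa> + (a - i) \<and>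
      hstrip \<nu> \<kappa> \<and> psize \<nu> = psize \<kappa> + (n - i)}"

lemma local_down_rel:
  assumes "hstrip \<mu> p" "hstrip \<mu> r"
  shows "local_down p r \<mu> j + \<mu> (Suc j) = ends_sum p r j"
proof -
  have "\<mu> (Suc j) \<le> min (p j) (r j)" using assms by (simp add: hstrip_def)
  then show ?thesis unfolding local_down_def ends_sum_def by linarith
qed

lemma local_up_rel:
  assumes "hstrip p \<kappa>" "hstrip r \<kappa>"
  shows "\<kappa> j + local_up p r i \<kappa> (Suc j) = ends_sum p r j"
proof -
  have "\<kappa> j \<le> min (p j) (r j)" using assms by (simp add: hstrip_def)
  then show ?thesis unfolding local_up_def ends_sum_def nat.case by linarith
qed

lemma local_down_hstrip:
  assumes "hstrip \<mu> p" "hstrip \<mu> r"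
  shows "hstrip p (local_down p r \<mu>) \<and> hstrip r (local_down p r \<mu>)"
  unfolding hstrip_lower_pair_iff
proof
  fix j
  have "max (p (Suc j)) (r (Suc j)) \<le> \<mu> (Suc j)" "\<mu> (Suc j) \<le> min (p j) (r j)"
    using assms by (auto simp: hstrip_def)
  then show "max (p (Suc j)) (r (Suc j)) \<le> local_down p r \<mu> j \<and> local_down p r \<mu> j \<le> min (p j) (r j)"
    unfolding local_down_def ends_sum_def by linarith
qed

lemma local_up_hstrip:
  assumes "hstrip p \<kappa>" "hstrip r \<kappa>"
  shows "hstrip (local_up p r i \<kappa>) p \<and> hstrip (local_up p r i \<kappa>) r"
  unfolding hstrip_upper_pair_iff
proof (intro conjI allI)
  fix j
  have *: "max (p (Suc j)) (r (Suc j)) \<le> \<kappa> j" "\<kappa> j \<le> min (p j) (r j)"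
    using assms by (auto simp: hstrip_def)
  show "max (p (Suc j)) (r (Suc j)) \<le> local_up p r i \<kappa> (Suc j)"
    using * unfolding local_up_def ends_sum_def nat.case by linarith
  show "local_up p r i \<kappa> (Suc j) \<le> min (p j) (r j)"
    using * unfolding local_up_def ends_sum_def nat.case by linarith
qed (simp add: local_up_def)

text \<open>
  This is the relation \<open>D\<^sub>a U\<^sub>n = \<Sum>i. U\<^sub>n\<^sub>-\<^sub>i D\<^sub>a\<^sub>-\<^sub>i\<close> between the operators that add a horizontal strip and remove
  one, the combinatorial core of the Robinson-Schensted-Knuth correspondence.
\<close>

lemma sum_upper_pairs:
  assumes p: "partfun p"
  shows "(\<Sum>(\<mu>, \<nu>) \<in> upper_pairs p n a. f \<nu>) = (\<Sum>(i, \<kappa>, \<nu>) \<in> lower_pairs p n a. f \<nu>)"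
proof (rule sum.reindex_bij_witness[where
      j = "\<lambda>(\<mu>, \<nu>). (\<mu> 0 - max (p 0) (\<nu> 0), local_down p \<nu> \<mu>, \<nu>)" and
      i = "\<lambda>(i, \<kappa>, \<nu>). (local_up p \<nu> i \<kappa>, \<nu>)"])
  fix x assume x: "x \<in> upper_pairs p n a"
  obtain \<mu> \<nu> where xe: "x = (\<mu>, \<nu>)" by (cases x)
  from x have h: "hstrip \<mu> p" "hstrip \<mu> \<nu>" and s: "psize \<mu> = psize p + n" "psize \<mu> = psize \<nu> + a"
    by (auto simp: upper_pairs_def xe)
  have \<nu>: "partfun \<nu>" using h p hstrip_partfun_lower hstrip_partfun_upper by blast
  define i where "i = \<mu> 0 - max (p 0) (\<nu> 0)"
  have i: "\<mu> 0 = max (p 0) (\<nu> 0) + i"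
    using h by (auto simp: i_def hstrip_def)
  note hd = local_down_hstrip[OF h]
  have sz: "psize (local_down p \<nu> \<mu>) + psize \<mu> = psize p + psize \<nu> + i"
    by (rule local_rule_size[OF p \<nu> local_down_rel[OF h] i])
  have "psize (local_down p \<nu> \<mu>) \<le> psize p" "psize (local_down p \<nu> \<mu>) \<le> psize \<nu>"
    using hd p \<nu> hstrip_psize_le by blast+
  then show "(case x of (\<mu>, \<nu>) \<Rightarrow> (\<mu> 0 - max (p 0) (\<nu> 0), local_down p \<nu> \<mu>, \<nu>)) \<in> lower_pairs p n a"
    unfolding lower_pairs_def using hd s sz by (simp add: xe flip: i_def)
  have "local_up p \<nu> (\<mu> 0 - max (p 0) (\<nu> 0)) (local_down p \<nu> \<mu>) = \<mu>"
  proof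
    fix j show "local_up p \<nu> (\<mu> 0 - max (p 0) (\<nu> 0)) (local_down p \<nu> \<mu>) j = \<mu> j"
    proof (cases j)
      case 0 then show ?thesis using i by (simp add: local_up_def i_def)
    next
      case (Suc l)
      then show ?thesis using local_down_rel[OF h, of l] by (simp add: local_up_def)
    qed
  qed
  then show "(case case x of (\<mu>, \<nu>) \<Rightarrow> (\<mu> 0 - max (p 0) (\<nu> 0), local_down p \<nu> \<mu>, \<nu>) of
      (i, \<kappa>, \<nu>) \<Rightarrow> (local_up p \<nu> i \<kappa>, \<nu>)) = x"
    by (simp add: xe)
  show "(case case x of (\<mu>, \<nu>) \<Rightarrow> (\<mu> 0 - max (p 0) (\<nu> 0), local_down p \<nu> \<mu>, \<nu>) of
      (i, \<kappa>, \<nu>) \<Rightarrow> f \<nu>) = (case x of (\<mu>, \<nu>) \<Rightarrow> f \<nu>)"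
    by (simp add: xe)
next
  fix y assume y: "y \<in> lower_pairs p n a"
  obtain i \<kappa> \<nu> where ye: "y = (i, \<kappa>, \<nu>)" by (cases y)
  from y have h: "hstrip p \<kappa>" "hstrip \<nu> \<kappa>" and s: "i \<le> min a n" "psize p = psize \<kappa> + (a - i)" "psize \<nu> = psize \<kappa> + (n - i)"
    by (auto simp: lower_pairs_def ye)
  have \<nu>: "partfun \<nu>" using h p hstrip_partfun_lower hstrip_partfun_upper by blast
  have sz: "psize \<kappa> + psize (local_up p \<nu> i \<kappa>) = psize p + psize \<nu> + i"
    by (rule local_rule_size[OF p \<nu> local_up_rel[OF h]]) (simp add: local_up_def)
  then show "(case y of (i, \<kappa>, \<nu>) \<Rightarrow> (local_up p \<nu> i \<kappa>, \<nu>)) \<in> upper_pairs p n a"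
    unfolding upper_pairs_def using local_up_hstrip[OF h] s by (auto simp: ye)
  have "local_down p \<nu> (local_up p \<nu> i \<kappa>) = \<kappa>"
  proof
    fix j show "local_down p \<nu> (local_up p \<nu> i \<kappa>) j = \<kappa> j"
      unfolding local_down_def using local_up_rel[OF h, of j i] by linarith
  qed
  moreover have "local_up p \<nu> i \<kappa> 0 - max (p 0) (\<nu> 0) = i"
    by (simp add: local_up_def)
  ultimately show "(case case y of (i, \<kappa>, \<nu>) \<Rightarrow> (local_up p \<nu> i \<kappa>, \<nu>) of
      (\<mu>, \<nu>) \<Rightarrow> (\<mu> 0 - max (p 0) (\<nu> 0), local_down p \<nu> \<mu>, \<nu>)) = y"
    by (simp add: ye)
qed

text \<open>
  Read as exponents, these are the cofactors left when a monomial of degree \<open>n\<close> is split off.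
\<close>

definition lists_below :: "nat list \<Rightarrow> nat \<Rightarrow> nat list set" where
  "lists_below as n = {bs. list_all2 (\<le>) bs as \<and> sum_list as = sum_list bs + n}"

lemma lists_below_Nil: "lists_below [] n = (if n = 0 then {[]} else {})"
  by (auto simp: lists_below_def)

lemma list_all2_le_sum_list: "list_all2 (\<le>) bs as \<Longrightarrow> sum_list bs \<le> sum_list (as :: nat list)"
  by (induction rule: list_all2_induct) auto

lemma finite_lists_below: "finite (lists_below as n)"
proof (induction as arbitrary: n)
  case (Cons a as)
  have "lists_below (a # as) n \<subseteq> (\<Union>b\<le>a. \<Union>m\<le>n. (#) b ` lists_below as m)"
  proof
    fix bs assume "bs \<in> lists_below (a # as) n"
    then obtain b cs where bs: "bs = b # cs" "b \<le> a" "list_all2 (\<le>) cs as" "a + sum_list as = b + sum_list cs + n"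
      by (auto simp: lists_below_def list_all2_Cons2)
    then have "cs \<in> lists_below as (n - (a - b))" using list_all2_le_sum_list[OF bs(3)]
      by (auto simp: lists_below_def)
    moreover have "n - (a - b) \<le> n" by simp
    ultimately show "bs \<in> (\<Union>b\<le>a. \<Union>m\<le>n. (#) b ` lists_below as m)"
      using bs(1,2) by (intro UN_I[of b] UN_I[of "n - (a - b)"]) auto
  qed
  then show ?case by (rule finite_subset) (use Cons in auto)
qed (simp add: lists_below_Nil)

lemma sum_lists_below_Cons:
  "(\<Sum>bs\<in>lists_below (a # as) n. f bs) = (\<Sum>i\<le>min a n. \<Sum>bs\<in>lists_below as (n - i). f ((a - i) # bs))"
proof -
  have "(\<Sum>bs\<in>lists_below (a # as) n. f bs)
      = (\<Sum>(i, bs)\<in>(SIGMA i:{..min a n}. lists_below as (n - i)). f ((a - i) # bs))"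
  proof (rule sum.reindex_bij_witness[where j = "\<lambda>bs. (a - hd bs, tl bs)" and i = "\<lambda>(i, bs). (a - i) # bs"])
    fix bs assume "bs \<in> lists_below (a # as) n"
    then obtain b cs where bs: "bs = b # cs" "b \<le> a" "list_all2 (\<le>) cs as" "a + sum_list as = b + sum_list cs + n"
      by (auto simp: lists_below_def list_all2_Cons2)
    then show "(a - hd bs, tl bs) \<in> (SIGMA i:{..min a n}. lists_below as (n - i))"
      using list_all2_le_sum_list[OF bs(3)] by (auto simp: lists_below_def)
    show "(case (a - hd bs, tl bs) of (i, bs) \<Rightarrow> (a - i) # bs) = bs" using bs by simp
    show "(case (a - hd bs, tl bs) of (i, bs) \<Rightarrow> f ((a - i) # bs)) = f bs" using bs by simp
  qed (auto simp: lists_below_def)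
  then show ?thesis by (simp add: sum.Sigma finite_lists_below)
qed

text \<open>
  A strip of size \<open>n\<close> is added to \<open>p\<close> and then strips of sizes \<open>as\<close> are removed until nothing is left. Moving
  the addition past the removal of a strip of size \<open>a\<close> cancels some amount \<open>i\<close> from both. At the end the
  addition produces the empty shape, so it must have been cancelled completely.
\<close>

lemma kostka_pieri:
  "partfun p \<Longrightarrow>
     (\<Sum>\<mu>\<in>strips_above p n. kostka \<mu> as) = (\<Sum>bs\<in>lists_below as n. kostka p bs)"
proof (induction as arbitrary: p n)
  case Nil
  have "hstrip (\<lambda>_. 0) p \<and> psize (\<lambda>_. 0) = psize p + n \<longleftrightarrow> p = (\<lambda>_. 0) \<and> n = 0"
  proof -
    have "hstrip (\<lambda>_. 0) p \<longleftrightarrow> p = (\<lambda>_. 0)" by (auto simp: hstrip_def)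
    then show ?thesis by auto
  qed
  moreover have "(\<Sum>\<mu>\<in>strips_above p n. kostka \<mu> [])
      = (if hstrip (\<lambda>_. 0) p \<and> psize (\<lambda>_. 0) = psize p + n then 1 else 0)"
    using sum.delta[OF finite_hstrip_upper[OF Nil, of "psize p + n"], of "\<lambda>_. 0" "\<lambda>_. 1::nat"] by simp
  ultimately show ?case by (auto simp: lists_below_Nil)
next
  case (Cons a as)
  have pf: "partfun \<mu>" if "hstrip \<mu> p" for \<mu> using hstrip_partfun_upper[OF that Cons.prems] .
  have pf2: "partfun \<mu>" if "hstrip p \<mu>" for \<mu> using hstrip_partfun_lower[OF that Cons.prems] .
  have "(\<Sum>\<mu>\<in>strips_above p n. kostka \<mu> (a # as))
      = (\<Sum>(\<mu>, \<nu>) \<in> (SIGMA \<mu>:strips_above p n. strips_below \<mu> a). kostka \<nu> as)"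
    unfolding kostka.simps(2)
    by (rule sum.Sigma) (auto intro: finite_hstrip_upper[OF Cons.prems] finite_subset[OF _ finite_hstrip_lower] pf)
  also have "\<dots> = (\<Sum>(\<mu>, \<nu>) \<in> upper_pairs p n a. kostka \<nu> as)"
    by (rule sum.cong) (auto simp: upper_pairs_def)
  also have "\<dots> = (\<Sum>(i, \<kappa>, \<nu>) \<in> lower_pairs p n a. kostka \<nu> as)"
    by (rule sum_upper_pairs[OF Cons.prems])
  also have "\<dots> = (\<Sum>(i, \<kappa>, \<nu>) \<in> (SIGMA i:{..min a n}. SIGMA \<kappa>:strips_below p (a - i).
       strips_above \<kappa> (n - i)). kostka \<nu> as)"
    by (rule sum.cong) (auto simp: lower_pairs_def)
  also have "\<dots> = (\<Sum>i\<le>min a n. \<Sum>\<kappa> | hstrip p \<kappa> \<and> psize p = psize \<kappa> + (a - i).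
       \<Sum>\<nu>\<in>strips_above \<kappa> (n - i). kostka \<nu> as)"
  proof -
    have fin: "finite (strips_below p (a - i))" for i
      by (rule finite_subset[OF _ finite_hstrip_lower[OF Cons.prems]]) auto
    have fin2: "finite (strips_above \<kappa> (n - i))" if "hstrip p \<kappa>" for \<kappa> i
      by (rule finite_hstrip_upper[OF pf2[OF that]])
    have "(\<Sum>\<kappa>\<in>strips_below p (a - i). \<Sum>\<nu>\<in>strips_above \<kappa> (n - i). kostka \<nu> as)
      = (\<Sum>(\<kappa>, \<nu>) \<in> (SIGMA \<kappa>:strips_below p (a - i). strips_above \<kappa> (n - i)). kostka \<nu> as)" for i
      by (rule sum.Sigma) (use fin fin2 in blast)+
    note inner = this
    have fin3: "finite (SIGMA \<kappa>:strips_below p (a - i). strips_above \<kappa> (n - i))" for i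
      by (rule finite_SigmaI) (use fin fin2 in blast)+
    show ?thesis unfolding inner by (rule sum.Sigma[symmetric]) (use fin3 in blast)+
  qed
  also have "\<dots> = (\<Sum>i\<le>min a n. \<Sum>\<kappa> | hstrip p \<kappa> \<and> psize p = psize \<kappa> + (a - i).
       \<Sum>bs\<in>lists_below as (n - i). kostka \<kappa> bs)"
    by (intro sum.cong refl Cons.IH pf2) auto
  also have "\<dots> = (\<Sum>i\<le>min a n. \<Sum>bs\<in>lists_below as (n - i). kostka p ((a - i) # bs))"
    unfolding kostka.simps(2) by (intro sum.cong refl sum.swap)
  also have "\<dots> = (\<Sum>bs\<in>lists_below (a # as) n. kostka p bs)"
    by (rule sum_lists_below_Cons[symmetric])
  finally show ?case .
qed

section \<open>Partitions as lists of row lengths\<close>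

abbreviation rows :: "nat list \<Rightarrow> nat \<Rightarrow> nat" where
  "rows l \<equiv> nth_default 0 l"

lemma rows_tail: "(\<lambda>i. rows (a # as) (Suc i)) = rows as"
  by (simp add: fun_eq_iff nth_default_def)

lemma partfun_rows: "is_partition l \<Longrightarrow> partfun (rows l)"
  unfolding partfun_def decseq_Suc_iff
proof
  assume "is_partition l"
  then have s: "sorted_wrt (\<ge>) l" by (simp add: is_partition_def)
  show "\<forall>n. rows l (Suc n) \<le> rows l n"
    using sorted_wrt_nth_less[OF s] by (auto simp: nth_default_def)
  show "\<exists>L. \<forall>i\<ge>L. rows l i = 0"
    by (rule exI[of _ "length l"]) (auto simp: nth_default_def)
qed

lemma cells_rows: "cells (rows l) = diagram l"
  by (auto simp: cells_def diagram_def nth_default_def split: if_splits)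

lemma cells_shift:
  "cells p = Pair 0 ` {..<p 0} \<union> (\<lambda>(i, k). (Suc i, k)) ` cells (\<lambda>i. p (Suc i))"
proof (intro set_eqI)
  fix c :: "nat \<times> nat"
  obtain i k where c: "c = (i, k)" by (cases c)
  show "c \<in> cells p \<longleftrightarrow> c \<in> Pair 0 ` {..<p 0} \<union> (\<lambda>(i, k). (Suc i, k)) ` cells (\<lambda>i. p (Suc i))"
    unfolding c cells_def by (cases i) auto
qed

lemma psize_shift:
  assumes "partfun p"
  shows "psize p = p 0 + psize (\<lambda>i. p (Suc i))"
proof -
  have eq: "cells p = Pair 0 ` {..<p 0} \<union> (\<lambda>(i, k). (Suc i, k)) ` cells (\<lambda>i. p (Suc i))"
    by (rule cells_shift)
  have fin: "finite (cells p)" by (rule finite_cells[OF assms])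
  have "psize p = card (Pair (0::nat) ` {..<p 0}) + card ((\<lambda>(i, k). (Suc i, k)) ` cells (\<lambda>i. p (Suc i)))"
    unfolding psize_def eq by (rule card_Un_disjoint) (use fin eq in auto)
  moreover have "inj_on (\<lambda>(i::nat, k::nat). (Suc i, k)) (cells (\<lambda>i. p (Suc i)))"
    by (auto simp: inj_on_def)
  ultimately show ?thesis by (simp add: psize_def card_image inj_on_def)
qed

lemma psize_rows: "psize (rows l) = sum_list l"
proof -
  have "psize (rows l) = (\<Sum>i<length l. rows l i)"
    by (rule psize_eq_sum) (simp add: nth_default_def)
  then show ?thesis by (simp add: sum_list_sum_nth nth_default_def lessThan_atLeast0)
qed

lemma rows_inject:
  "is_composition l \<Longrightarrow> is_composition l' \<Longrightarrow> rows l = rows l' \<longleftrightarrow> l = l'"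
proof (induction l arbitrary: l')
  case Nil
  then show ?case
    by (cases l') (auto simp: is_composition_def dest!: fun_cong[of _ _ 0])
next
  case (Cons a l)
  show ?case
  proof (cases l')
    case Nil
    then show ?thesis using Cons.prems
      by (auto simp: is_composition_def dest!: fun_cong[of _ _ 0])
  next
    case l': (Cons b m)
    have "rows (a # l) = rows (b # m) \<Longrightarrow> a = b \<and> rows l = rows m"
      using rows_tail[of a l] rows_tail[of b m] by (metis nth_default_Cons_0)
    then show ?thesis using Cons.IH[of m] Cons.prems l' by (auto simp: is_composition_def)
  qed
qed

lemma partfun_eq_rows:
  assumes "partfun p"
  obtains l where "is_partition l" "p = rows l"
proof -
  obtain L where L: "\<And>i. i \<ge> L \<Longrightarrow> p i = 0" using assms partfun_def by auto
  define n where "n = (LEAST n. p n = 0)"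
  have n0: "p n = 0" unfolding n_def by (rule LeastI[of _ L]) (rule L[OF order_refl])
  have pos: "p i > 0" if "i < n" for i using not_less_Least[of i "\<lambda>n. p n = 0"] that by (auto simp: n_def)
  have dec: "p j \<le> p i" if "i \<le> j" for i j using assms that by (auto simp: partfun_def decseq_def)
  have zero: "p i = 0" if "n \<le> i" for i using dec[OF that] n0 by simp
  let ?l = "map p [0..<n]"
  have "is_partition ?l"
    unfolding is_partition_def is_composition_def
    by (auto simp: pos sorted_wrt_iff_nth_less intro!: dec)
  moreover have "p = rows ?l"
    by (auto simp: fun_eq_iff nth_default_def zero)
  ultimately show ?thesis using that by blast
qed

definition parts :: "nat \<Rightarrow> nat list set" where
  "parts n = {l. is_partition l \<and> sum_list l = n}"

lemma bij_betw_rows: "bij_betw rows (parts n) {p. partfun p \<and> psize p = n}"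
  unfolding bij_betw_def
proof
  show "inj_on rows (parts n)"
    by (auto simp: inj_on_def parts_def is_partition_def rows_inject)
  show "rows ` parts n = {p. partfun p \<and> psize p = n}"
    by (auto simp: parts_def partfun_rows psize_rows elim!: partfun_eq_rows)
qed

lemma finite_parts [simp]: "finite (parts n)"
  using bij_betw_finite[OF bij_betw_rows] finite_partfun_size by blast

section \<open>Triangularity of the Kostka numbers\<close>

text \<open>
  This is the statistic \<open>\<Sum>i. i \<lambda>\<^sub>i\<close>, rows being numbered from 0. It reverses the dominance order, which makes it
  a rank function for triangularity. On lists, \<open>rank l\<close> is \<open>\<Sum>i<length l. i * l ! i\<close>.
\<close>

definition cell_rank :: "(nat \<Rightarrow> nat) \<Rightarrow> nat" where
  "cell_rank p = (\<Sum>c\<in>cells p. fst c)"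

primrec rank :: "nat list \<Rightarrow> nat" where
  "rank [] = 0"
| "rank (b # bs) = rank bs + sum_list bs"

lemma cell_rank_shift:
  assumes "partfun p"
  shows "cell_rank p = cell_rank (\<lambda>i. p (Suc i)) + psize (\<lambda>i. p (Suc i))"
proof -
  let ?s = "\<lambda>(i::nat, k::nat). (Suc i, k)"
  have eq: "cells p = Pair 0 ` {..<p 0} \<union> ?s ` cells (\<lambda>i. p (Suc i))"
    by (rule cells_shift)
  have fin: "finite (cells p)" by (rule finite_cells[OF assms])
  have "cell_rank p = (\<Sum>c\<in>Pair 0 ` {..<p 0}. fst c) + (\<Sum>c\<in>?s ` cells (\<lambda>i. p (Suc i)). fst c)"
    unfolding cell_rank_def eq by (rule sum.union_disjoint) (use fin eq in auto)
  also have "(\<Sum>c\<in>Pair 0 ` {..<p 0}. fst c) = 0" by (rule sum.neutral) auto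
  also have "(\<Sum>c\<in>?s ` cells (\<lambda>i. p (Suc i)). fst c) = (\<Sum>c\<in>cells (\<lambda>i. p (Suc i)). fst c + 1)"
    by (subst sum.reindex) (auto simp: inj_on_def intro!: sum.cong)
  also have "\<dots> = cell_rank (\<lambda>i. p (Suc i)) + psize (\<lambda>i. p (Suc i))"
    by (simp only: sum.distrib cell_rank_def psize_def card_eq_sum)
  finally show ?thesis by simp
qed

lemma cell_rank_mono: "partfun p \<Longrightarrow> (\<And>i. q i \<le> p i) \<Longrightarrow> cell_rank q \<le> cell_rank p"
  unfolding cell_rank_def by (intro sum_mono2 finite_cells cells_mono) auto

text \<open>
  Removing a horizontal strip from \<open>p\<close> leaves at least the rows of \<open>p\<close> after the first, each moved up by one.
  The statistic of the strip sizes is therefore at least that of \<open>p\<close>, and equality forces each strip to leave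
  exactly the rows after the first, so that its size is the length of the first row.
\<close>

lemma kostka_rank:
  "partfun p \<Longrightarrow> kostka p bs \<noteq> 0 \<Longrightarrow>
     cell_rank p \<le> rank bs \<and> (cell_rank p = rank bs \<longrightarrow> p = rows bs)"
proof (induction bs arbitrary: p)
  case Nil
  then show ?case by (auto simp: cell_rank_def cells_def fun_eq_iff split: if_splits)
next
  case (Cons b bs)
  obtain q where "q \<in> strips_below p b" and K: "kostka q bs \<noteq> 0"
    using Cons.prems(2) unfolding kostka.simps(2) by (rule sum.not_neutral_contains_not_neutral)
  then have q: "hstrip p q" "psize p = psize q + b" by auto
  have pq: "partfun q" by (rule hstrip_partfun_lower[OF q(1) Cons.prems(1)])
  let ?t = "\<lambda>i. p (Suc i)"
  have le: "?t i \<le> q i" for i by (rule hstrip_Suc_le[OF q(1)])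
  have szq: "psize q = sum_list bs" by (rule kostka_nonzero_size[OF K])
  have IH: "cell_rank q \<le> rank bs" "cell_rank q = rank bs \<Longrightarrow> q = rows bs" using Cons.IH[OF pq K] by auto
  have l1: "cell_rank ?t \<le> cell_rank q" by (rule cell_rank_mono[OF pq le])
  have l2: "psize ?t \<le> psize q" by (rule psize_mono[OF pq le])
  have sh: "cell_rank p = cell_rank ?t + psize ?t" by (rule cell_rank_shift[OF Cons.prems(1)])
  show ?case
  proof (intro conjI impI)
    show "cell_rank p \<le> rank (b # bs)" using sh l1 l2 IH(1) szq by simp
    assume "cell_rank p = rank (b # bs)"
    then have e: "cell_rank ?t = cell_rank q" "psize q = psize ?t" "cell_rank q = rank bs"
      using sh l1 l2 IH(1) szq by simp_all
    have t: "?t = rows bs" using psize_eq_imp_eq[OF pq le e(2)] IH(2)[OF e(3)] by simp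
    have "p 0 = b" using psize_shift[OF Cons.prems(1)] q(2) e(2) by simp
    then have "p i = rows (b # bs) i" for i
      using fun_cong[OF t] by (cases i) auto
    then show "p = rows (b # bs)" by (rule ext)
  qed
qed

lemma is_partition_Cons_tail: "is_partition (a # l) \<Longrightarrow> is_partition l"
  by (simp add: is_partition_def is_composition_def)

lemma cell_rank_rows: "is_partition l \<Longrightarrow> cell_rank (rows l) = rank l"
proof (induction l)
  case Nil then show ?case by (simp add: cell_rank_def cells_def)
next
  case (Cons a l)
  then show ?case
    using cell_rank_shift[OF partfun_rows[OF Cons.prems]] is_partition_Cons_tail[OF Cons.prems]
    by (simp add: rows_tail psize_rows)
qed

lemma kostka_diag: "is_partition l \<Longrightarrow> kostka (rows l) l = 1"
proof (induction l)
  case Nil then show ?case by (simp add: fun_eq_iff)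
next
  case (Cons a l)
  have pf: "partfun (rows (a # l))" by (rule partfun_rows[OF Cons.prems])
  have pt: "is_partition l" by (rule is_partition_Cons_tail[OF Cons.prems])
  have "strips_below (rows (a # l)) a = {rows l}"
  proof (intro equalityI subsetI)
    fix q assume "q \<in> strips_below (rows (a # l)) a"
    then have q: "hstrip (rows (a # l)) q" "psize (rows (a # l)) = psize q + a" by auto
    have "rows l i \<le> q i" for i
      using hstrip_Suc_le[OF q(1), of i] by simp
    moreover have "psize q = psize (rows l)" using q(2) by (simp add: psize_rows)
    ultimately have "rows l = q"
      by (intro psize_eq_imp_eq hstrip_partfun_lower[OF q(1) pf])
    then show "q \<in> {rows l}" by simp
  next
    fix q assume "q \<in> {rows l}"
    moreover have "rows l i \<le> rows (a # l) i" for i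
      using pf unfolding partfun_def decseq_Suc_iff by (metis fun_cong[OF rows_tail])
    ultimately show "q \<in> strips_below (rows (a # l)) a"
      by (simp add: hstrip_def psize_rows)
  qed
  then show ?case using Cons.IH[OF pt] by (simp add: kostka.simps(2))
qed

lemma kostka_triangular:
  assumes "is_partition l" "is_composition bs" "kostka (rows l) bs \<noteq> 0" "l \<noteq> bs"
  shows "rank l < rank bs"
  using kostka_rank[OF partfun_rows[OF assms(1)] assms(3)] assms
  by (auto simp: cell_rank_rows rows_inject is_partition_def le_less)

section \<open>Exponents of monomials\<close>

abbreviation lookup :: "('a \<Rightarrow>\<^sub>0 'b::zero) \<Rightarrow> 'a \<Rightarrow> 'b" where
  "lookup \<equiv> Poly_Mapping.lookup"

abbreviation keys :: "('a \<Rightarrow>\<^sub>0 'b::zero) \<Rightarrow> 'a set" where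
  "keys \<equiv> Poly_Mapping.keys"

abbreviation monomial :: "nat list \<Rightarrow> monom" where
  "monomial \<equiv> Poly_Mapping.nth"

text \<open>
  In contrast to \<open>exponents\<close>, zeros are kept, so that multiplication of monomials adds these lists entrywise.
\<close>

abbreviation expvec :: "monom \<Rightarrow> nat \<Rightarrow> nat list" where
  "expvec m N \<equiv> map (lookup m) [0..<N]"

lemma keys_bounded: "\<exists>N. keys (m :: monom) \<subseteq> {..<N}"
  using finite_nat_set_iff_bounded[of "keys m"] by auto

lemma exponents_eq_filter:
  assumes "keys m \<subseteq> {..<N}"
  shows "exponents m = filter (\<lambda>x. x \<noteq> 0) (expvec m N)"
proof -
  have "sorted_list_of_set (keys m) = filter (\<lambda>i. i \<in> keys m) [0..<N]"
  proof (rule sorted_distinct_set_unique)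
    show "set (sorted_list_of_set (keys m)) = set (filter (\<lambda>i. i \<in> keys m) [0..<N])"
      using assms by auto
  qed (auto simp: sorted_wrt_filter)
  then show ?thesis
    by (simp add: exponents_def filter_map o_def in_keys_iff)
qed

lemma is_composition_exponents: "is_composition (exponents m)"
  using keys_bounded[of m] by (auto simp: exponents_eq_filter is_composition_def)

lemma mdeg_eq_sum_list:
  assumes "keys m \<subseteq> {..<N}"
  shows "mdeg m = sum_list (expvec m N)"
proof -
  have "mdeg m = (\<Sum>i<N. lookup m i)"
    unfolding mdeg_def by (rule sum.mono_neutral_left) (use assms in \<open>auto simp: in_keys_iff\<close>)
  then show ?thesis by (simp add: interv_sum_list_conv_sum_set_nat lessThan_atLeast0)
qed

lemma sum_list_filter_nonzero: "sum_list (filter (\<lambda>x. x \<noteq> 0) l) = sum_list (l :: nat list)"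
  by (induction l) auto

lemma mdeg_eq_exponents: "mdeg m = sum_list (exponents m)"
proof -
  obtain N where N: "keys m \<subseteq> {..<N}" using keys_bounded by blast
  show ?thesis
    unfolding exponents_eq_filter[OF N] mdeg_eq_sum_list[OF N] sum_list_filter_nonzero ..
qed

lemma kostka_exponents:
  assumes "partfun p" "keys m \<subseteq> {..<N}"
  shows "kostka p (expvec m N) = kostka p (exponents m)"
  by (simp only: exponents_eq_filter[OF assms(2)] kostka_filter[OF assms(1)])

lemma keys_nth: "keys (monomial l :: monom) \<subseteq> {..<length l}"
  by (rule subsetI, simp only: in_keys_iff nth.rep_eq) (auto simp: nth_default_def split: if_splits)

lemma expvec_nth: "expvec (monomial l) (length l) = l"
  by (rule nth_equalityI) (auto simp: nth.rep_eq nth_default_def)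

lemma exponents_nth: "is_composition l \<Longrightarrow> exponents (monomial l) = l"
  unfolding exponents_eq_filter[OF keys_nth] expvec_nth
  by (auto simp: is_composition_def filter_id_conv)

section \<open>Complete symmetric functions and Kostka numbers\<close>

text \<open>
  This series is the Schur function of shape \<open>p\<close> (\<open>schur_eq_kostka_series\<close>). With this definition the Pieri rule
  is a statement about chains of strips alone.
\<close>

definition kostka_series :: "(nat \<Rightarrow> nat) \<Rightarrow> mpser" where
  "kostka_series p = Mpser (\<lambda>m. of_nat (kostka p (exponents m)))"

lemma coeff_Mpser [simp]: "coeff (Mpser f) = f"
  by (simp add: Mpser_inverse)

lemma coeff_kostka_series: "coeff (kostka_series p) m = of_nat (kostka p (exponents m))"
  by (simp add: kostka_series_def)

lemma coeff_sum: "coeff (sum f A) m = (\<Sum>x\<in>A. coeff (f x) m)"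
  by (induction A rule: infinite_finite_induct) (auto simp: zero_mpser.rep_eq plus_mpser.rep_eq)

lemma mscale_mult: "mscale c f * g = mscale c (f * g)" "f * mscale c g = mscale c (f * g)"
proof -
  show *: "mscale c f * g = mscale c (f * g)" for f g
    by (rule mpser_eqI) (simp add: times_mpser.rep_eq mscale.rep_eq sum_distrib_left case_prod_unfold mult.assoc)
  show "f * mscale c g = mscale c (f * g)" using *[of g f] by (simp add: mult.commute)
qed

lemma sum_list_expvec_add:
  "sum_list (expvec (a + b) N) = sum_list (expvec a N) + sum_list (expvec b N)"
  by (induction N) (simp_all add: lookup_add)

lemma sum_splits_lists_below:
  assumes N: "keys m \<subseteq> {..<N}"
  shows "(\<Sum>(a, b) | a + b = m \<and> mdeg a = n. f (expvec b N)) = (\<Sum>bs\<in>lists_below (expvec m N) n. f bs)"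
proof (rule sum.reindex_bij_witness[where
      j = "\<lambda>(a, b). expvec b N" and i = "\<lambda>bs. (m - monomial bs, monomial bs)"])
  have keys: "keys a \<subseteq> {..<N} \<and> keys b \<subseteq> {..<N}" if "a + b = m" for a b
    using N that by (auto simp: in_keys_iff lookup_add subset_iff)
  fix x assume "x \<in> {(a, b). a + b = m \<and> mdeg a = n}"
  then obtain a b where x: "x = (a, b)" and m: "a + b = m" and n: "mdeg a = n" by auto
  have b: "monomial (expvec b N) = b"
    using keys[OF m] by (intro poly_mapping_eqI) (auto simp: nth.rep_eq nth_default_def in_keys_iff subset_iff)
  then show "(case case x of (a, b) \<Rightarrow> expvec b N of bs \<Rightarrow> (m - monomial bs, monomial bs)) = x"
    using m by (auto simp: x)
  have "sum_list (expvec m N) = sum_list (expvec b N) + n"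
    unfolding n[symmetric] mdeg_eq_sum_list[OF conjunct1[OF keys[OF m]]] m[symmetric]
    by (simp only: sum_list_expvec_add add.commute)
  moreover have "list_all2 (\<le>) (expvec b N) (expvec m N)"
    by (auto simp: list_all2_conv_all_nth m[symmetric] lookup_add)
  ultimately show "(case x of (a, b) \<Rightarrow> expvec b N) \<in> lists_below (expvec m N) n"
    by (simp add: x lists_below_def)
  show "f (case x of (a, b) \<Rightarrow> expvec b N) = (case x of (a, b) \<Rightarrow> f (expvec b N))" by (simp add: x)
next
  fix bs assume "bs \<in> lists_below (expvec m N) n"
  then have le: "list_all2 (\<le>) bs (expvec m N)" and s: "sum_list (expvec m N) = sum_list bs + n"
    by (auto simp: lists_below_def)
  have len: "length bs = N" using list_all2_lengthD[OF le] by simp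
  have "lookup (monomial bs) i \<le> lookup m i" for i
    using le by (auto simp: nth.rep_eq nth_default_def list_all2_conv_all_nth)
  then have add: "m - monomial bs + monomial bs = m"
    by (intro poly_mapping_eqI) (simp add: lookup_add lookup_minus)
  have e: "expvec (monomial bs) N = bs" using expvec_nth[of bs] len by simp
  show "(case (m - monomial bs, monomial bs) of (a, b) \<Rightarrow> expvec b N) = bs"
    using e by (simp only: prod.case)
  have k: "keys (m - monomial bs) \<subseteq> {..<N}"
    using N by (auto simp: in_keys_iff lookup_minus subset_iff)
  have "mdeg (m - monomial bs) + sum_list bs = sum_list (expvec m N)"
    unfolding mdeg_eq_sum_list[OF k]
    using sum_list_expvec_add[of "m - monomial bs" "monomial bs" N] unfolding add e by metis
  then show "(m - monomial bs, monomial bs) \<in> {(a, b). a + b = m \<and> mdeg a = n}"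
    using add s by simp
qed

lemma kostka_series_pieri:
  assumes p: "partfun p"
  shows "hcomplete n * kostka_series p = (\<Sum>\<mu>\<in>strips_above p n. kostka_series \<mu>)"
proof (rule mpser_eqI)
  fix m :: monom
  obtain N where N: "keys m \<subseteq> {..<N}" using keys_bounded by blast
  have keys: "keys b \<subseteq> {..<N}" if "a + b = m" for a b
    using N that by (auto simp: in_keys_iff lookup_add subset_iff)
  have fin: "finite {(a, b). a + b = m}" by (rule finite_monom_splits)
  have "coeff (hcomplete n * kostka_series p) m
      = (\<Sum>(a, b) | a + b = m. (if mdeg a = n then 1 else 0) * of_nat (kostka p (exponents b)))"
    by (simp add: times_mpser.rep_eq hcomplete_def coeff_kostka_series)
  also have "\<dots> = (\<Sum>(a, b) | a + b = m \<and> mdeg a = n. of_nat (kostka p (expvec b N)))"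
  proof (rule sum.mono_neutral_cong_right[OF fin])
    show "\<forall>i\<in>{(a, b). a + b = m} - {(a, b). a + b = m \<and> mdeg a = n}.
       (case i of (a, b) \<Rightarrow> (if mdeg a = n then 1 else 0) * of_nat (kostka p (exponents b))) = (0::rat)"
      by (auto split: if_splits)
  qed (auto simp: kostka_exponents[OF p keys])
  also have "\<dots> = of_nat (\<Sum>bs\<in>lists_below (expvec m N) n. kostka p bs)"
    by (simp add: sum_splits_lists_below[OF N, where f = "\<lambda>b. of_nat (kostka p b)"])
  also have "\<dots> = of_nat (\<Sum>\<mu>\<in>strips_above p n. kostka \<mu> (expvec m N))"
    by (simp only: kostka_pieri[OF p])
  also have "(\<Sum>\<mu>\<in>strips_above p n. kostka \<mu> (expvec m N))
      = (\<Sum>\<mu>\<in>strips_above p n. kostka \<mu> (exponents m))"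
    by (intro sum.cong refl kostka_exponents[OF _ N]) (auto intro: hstrip_partfun_upper p)
  also have "of_nat \<dots> = coeff (\<Sum>\<mu>\<in>strips_above p n. kostka_series \<mu>) m"
    by (simp add: coeff_sum coeff_kostka_series)
  finally show "coeff (hcomplete n * kostka_series p) m = coeff (\<Sum>\<mu>\<in>strips_above p n. kostka_series \<mu>) m" .
qed

lemma kostka_series_zero: "kostka_series (\<lambda>_. 0) = 1"
proof (rule mpser_eqI)
  fix m :: monom
  have "exponents m = [] \<longleftrightarrow> m = 0" by (simp add: exponents_def)
  moreover have "kostka (\<lambda>_. 0) (exponents m) \<noteq> 0 \<Longrightarrow> exponents m = []"
    using kostka_nonzero_size[of "\<lambda>_. 0" "exponents m"] is_composition_exponents[of m]
    by (cases "exponents m") (auto simp: is_composition_def)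
  ultimately show "coeff (kostka_series (\<lambda>_. 0)) m = coeff 1 m"
    by (cases "m = 0") (auto simp: coeff_kostka_series one_mpser.rep_eq)
qed

text \<open>
  Multiplication by \<open>h\<^sub>a\<close> adds a strip of size \<open>a\<close>, which becomes the outermost strip of the chain.
\<close>

lemma hsym_eq_sum_kostka_series:
  "hsym as = (\<Sum>p | partfun p \<and> psize p = sum_list as. mscale (of_nat (kostka p as)) (kostka_series p))"
proof (induction as)
  case Nil
  have "{p. partfun p \<and> psize p = 0} = {\<lambda>_. 0}"
  proof (intro equalityI subsetI; clarsimp)
    fix p assume "partfun p" "psize p = 0"
    then show "p = (\<lambda>_. 0)" using psize_eq_imp_eq[of p "\<lambda>_. 0"] by simp
  next
    show "partfun (\<lambda>_. 0)" by (simp add: partfun_def decseq_def)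
  qed
  then show ?case by (simp add: hsym_def kostka_series_zero)
next
  case (Cons a as)
  let ?A = "{q. partfun q \<and> psize q = sum_list as}"
  let ?B = "{p. partfun p \<and> psize p = sum_list (a # as)}"
  have "hsym (a # as) = hcomplete a * hsym as" by (simp add: hsym_def)
  also have "\<dots> = (\<Sum>q\<in>?A. mscale (of_nat (kostka q as)) (hcomplete a * kostka_series q))"
    by (simp add: Cons.IH sum_distrib_left mscale_mult)
  also have "\<dots> = (\<Sum>q\<in>?A. \<Sum>p\<in>strips_above q a. mscale (of_nat (kostka q as)) (kostka_series p))"
    by (intro sum.cong refl) (simp add: kostka_series_pieri ser.scale_sum_right)
  also have "\<dots> = (\<Sum>(q, p)\<in>(SIGMA q:?A. strips_above q a). mscale (of_nat (kostka q as)) (kostka_series p))"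
    by (rule sum.Sigma) (use finite_partfun_size finite_hstrip_upper in auto)
  also have "\<dots> = (\<Sum>(p, q)\<in>(SIGMA p:?B. strips_below p a). mscale (of_nat (kostka q as)) (kostka_series p))"
    by (rule sum.reindex_bij_witness[where i = prod.swap and j = prod.swap])
       (auto intro: hstrip_partfun_lower hstrip_partfun_upper)
  also have "\<dots> = (\<Sum>p\<in>?B. \<Sum>q\<in>strips_below p a. mscale (of_nat (kostka q as)) (kostka_series p))"
    by (rule sum.Sigma[symmetric])
       (auto intro: finite_partfun_size finite_subset[OF _ finite_hstrip_lower])
  also have "\<dots> = (\<Sum>p\<in>?B. mscale (of_nat (kostka p (a # as))) (kostka_series p))"
    by (simp add: kostka.simps(2) ser.scale_sum_left)
  finally show ?case .
qed

section \<open>Semistandard tableaux and Kostka numbers\<close>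

lemma finite_diagram [simp]: "finite (diagram \<alpha>)"
proof -
  have "diagram \<alpha> = Sigma {..<length \<alpha>} (\<lambda>i. {..<\<alpha> ! i})" by (auto simp: diagram_def)
  then show ?thesis by simp
qed

lemma filling_pos_iff: "filling \<alpha> T \<Longrightarrow> T c \<noteq> 0 \<longleftrightarrow> c \<in> diagram \<alpha>"
  unfolding filling_def by (metis less_irrefl)

lemma filling_iff: "filling \<alpha> T \<longleftrightarrow> (\<forall>c. T c \<noteq> 0 \<longleftrightarrow> c \<in> diagram \<alpha>)"
proof
  show "filling \<alpha> T \<Longrightarrow> \<forall>c. T c \<noteq> 0 \<longleftrightarrow> c \<in> diagram \<alpha>" using filling_pos_iff by blast
  assume *: "\<forall>c. T c \<noteq> 0 \<longleftrightarrow> c \<in> diagram \<alpha>"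
  show "filling \<alpha> T" unfolding filling_def
  proof (intro conjI ballI allI impI)
    show "0 < T c" if "c \<in> diagram \<alpha>" for c using * that neq0_conv by blast
    show "T c = 0" if "c \<notin> diagram \<alpha>" for c using * that by blast
  qed
qed

abbreviation ssct_of :: "nat list \<Rightarrow> monom \<Rightarrow> (nat \<times> nat \<Rightarrow> nat) set" where
  "ssct_of \<alpha> m \<equiv> {T. ssct \<alpha> T \<and> weight \<alpha> T = m}"

lemma lookup_weight:
  assumes "filling \<alpha> T"
  shows "lookup (weight \<alpha> T) t = card {c. T c = Suc t}"
proof -
  have "lookup (weight \<alpha> T) t = (\<Sum>c\<in>diagram \<alpha>. if T c = Suc t then 1 else 0)"
    unfolding weight_def lookup_sum
    by (intro sum.cong refl)
       (use filling_pos_iff[OF assms] in \<open>auto simp: lookup_single when_def\<close>)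
  also have "\<dots> = card {c\<in>diagram \<alpha>. T c = Suc t}" by (simp add: sum.If_cases Int_def)
  also have "{c\<in>diagram \<alpha>. T c = Suc t} = {c. T c = Suc t}"
    using filling_pos_iff[OF assms] by fastforce
  finally show ?thesis .
qed

lemma weight_eq_iff:
  "filling \<alpha> T \<Longrightarrow> weight \<alpha> T = m \<longleftrightarrow> (\<forall>t. card {c. T c = Suc t} = lookup m t)"
  by (auto simp: poly_mapping_eq_iff fun_eq_iff lookup_weight)

lemma weight_eq_iff_bounded:
  assumes T: "filling \<alpha> T" and N: "keys m \<subseteq> {..<N}"
  shows "weight \<alpha> T = m \<longleftrightarrow>
    (\<forall>c. T c \<le> N) \<and> (\<forall>t<N. card {c. T c = Suc t} = lookup m t)"
proof -
  have fin: "finite {c. T c = Suc t}" for t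
    by (rule finite_subset[of _ "diagram \<alpha>"]) (use filling_pos_iff[OF T] in fastforce)+
  have zero: "lookup m t = 0" if "t \<ge> N" for t
    using N that by (auto simp: in_keys_iff subset_iff)
  have "(\<forall>c. T c \<le> N) \<longleftrightarrow> (\<forall>t\<ge>N. card {c. T c = Suc t} = 0)"
  proof
    assume "\<forall>c. T c \<le> N"
    then have "{c. T c = Suc t} = {}" if "t \<ge> N" for t
      using that by (metis (mono_tags, lifting) Collect_empty_eq Suc_n_not_le_n order_trans)
    then show "\<forall>t\<ge>N. card {c. T c = Suc t} = 0" by (metis card.empty)
  next
    assume *: "\<forall>t\<ge>N. card {c. T c = Suc t} = 0"
    show "\<forall>c. T c \<le> N"
    proof (rule ccontr)
      assume "\<not> (\<forall>c. T c \<le> N)"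
      then obtain c where "N < T c" using not_le by blast
      then obtain t where t: "T c = Suc t" "t \<ge> N" by (cases "T c") auto
      then have "{c. T c = Suc t} = {}" using * fin[of t] by (metis card_0_eq)
      then show False using t(1) by blast
    qed
  qed
  then show ?thesis
    unfolding weight_eq_iff[OF T] using zero by (metis not_le)
qed

lemma initial_segment_iff:
  assumes down: "\<And>k. P (Suc k) \<Longrightarrow> P k" and fin: "finite {k. P k}"
  shows "P k \<longleftrightarrow> k < card {k. P k}"
proof -
  define n where "n = (LEAST n. \<not> P n)"
  obtain b where "\<not> P b" using fin
    by (metis (mono_tags, lifting) mem_Collect_eq infinite_UNIV_nat UNIV_eq_I)
  then have n: "\<not> P n" unfolding n_def by (rule LeastI)
  have "P k" if "k < n" for k using not_less_Least[of k "\<lambda>n. \<not> P n"] that by (simp add: n_def)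
  moreover have "\<not> P k" if "n \<le> k" for k
    using that n by (induction k rule: dec_induct) (use down in blast)+
  ultimately have "P k \<longleftrightarrow> k < n" for k by (metis not_le)
  then show ?thesis by simp
qed

text \<open>
  Entries are bounded by \<open>N\<close> so that the largest ones can be removed by induction on \<open>N\<close>.
\<close>

definition tableaux :: "(nat \<Rightarrow> nat) \<Rightarrow> nat \<Rightarrow> (nat \<Rightarrow> nat) \<Rightarrow> (nat \<times> nat \<Rightarrow> nat) set" where
  "tableaux p N m = {T. (\<forall>i k. k < p i \<longleftrightarrow> T (i, k) \<noteq> 0) \<and>
     (\<forall>i k. Suc k < p i \<longrightarrow> T (i, k) \<le> T (i, Suc k)) \<and>
     (\<forall>i k. k < p (Suc i) \<longrightarrow> T (i, k) < T (Suc i, k)) \<and>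
     (\<forall>c. T c \<le> N) \<and> (\<forall>t<N. card {c. T c = Suc t} = m t)}"

definition fill_strip :: "nat \<Rightarrow> (nat \<Rightarrow> nat) \<Rightarrow> (nat \<Rightarrow> nat) \<Rightarrow> (nat \<times> nat \<Rightarrow> nat) \<Rightarrow> nat \<times> nat \<Rightarrow> nat" where
  "fill_strip x p q T = (\<lambda>(i, k). if q i \<le> k \<and> k < p i then x else T (i, k))"

definition erase_entry :: "nat \<Rightarrow> (nat \<times> nat \<Rightarrow> nat) \<Rightarrow> nat \<times> nat \<Rightarrow> nat" where
  "erase_entry x T = (\<lambda>c. if T c = x then 0 else T c)"

lemma card_cells_diff:
  "partfun p \<Longrightarrow> (\<And>i. q i \<le> p i) \<Longrightarrow> card (cells p - cells q) = psize p - psize q"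
  unfolding psize_def
  by (intro card_Diff_subset cells_mono) (auto intro: finite_subset[OF cells_mono finite_cells])

lemma tableaux_extend:
  assumes p: "partfun p" and q: "hstrip p q" "psize p = psize q + m N" and T: "T \<in> tableaux q N m"
  shows "fill_strip (Suc N) p q T \<in> tableaux p (Suc N) m"
    and "erase_entry (Suc N) (fill_strip (Suc N) p q T) = T"
proof -
  let ?E = "fill_strip (Suc N) p q T"
  have sup: "k < q i \<longleftrightarrow> T (i, k) \<noteq> 0" for i k using T by (auto simp: tableaux_def)
  have row: "Suc k < q i \<Longrightarrow> T (i, k) \<le> T (i, Suc k)" for i k using T by (auto simp: tableaux_def)
  have col: "k < q (Suc i) \<Longrightarrow> T (i, k) < T (Suc i, k)" for i k using T by (auto simp: tableaux_def)
  have bd: "T c \<le> N" for c using T by (cases c) (auto simp: tableaux_def)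
  have ct: "t < N \<Longrightarrow> card {c. T c = Suc t} = m t" for t using T by (auto simp: tableaux_def)
  have qp: "q i \<le> p i" and pq: "p (Suc i) \<le> q i" for i using q(1) by (auto simp: hstrip_def)
  have old: "?E (i, k) = T (i, k)" if "k < q i" for i k using that by (simp add: fill_strip_def)
  have new: "?E (i, k) = Suc N" if "q i \<le> k" "k < p i" for i k using that by (simp add: fill_strip_def)
  have bdE: "?E c \<le> Suc N" for c using bd[of c] by (cases c) (simp add: fill_strip_def)
  have cnt: "card {c. ?E c = Suc t} = m t" if "t < Suc N" for t
  proof (cases "t = N")
    case True
    have "{c. ?E c = Suc N} = cells p - cells q"
    proof (intro set_eqI)
      fix c :: "nat \<times> nat"
      obtain i k where c: "c = (i, k)" by (cases c)
      have "T c \<noteq> Suc N" using bd[of c] by simp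
      then show "c \<in> {c. ?E c = Suc N} \<longleftrightarrow> c \<in> cells p - cells q"
        by (auto simp: c fill_strip_def cells_def)
    qed
    then show ?thesis using card_cells_diff[OF p qp] q(2) True by simp
  next
    case False
    have "{c. ?E c = Suc t} = {c. T c = Suc t}"
    proof (intro set_eqI)
      fix c :: "nat \<times> nat"
      obtain i k where c: "c = (i, k)" by (cases c)
      show "c \<in> {c. ?E c = Suc t} \<longleftrightarrow> c \<in> {c. T c = Suc t}"
        using False sup[of k i] by (auto simp: c fill_strip_def)
    qed
    then show ?thesis using ct that False by simp
  qed
  show "?E \<in> tableaux p (Suc N) m"
    unfolding tableaux_def mem_Collect_eq
  proof (intro conjI allI impI)
    fix i k
    show "k < p i \<longleftrightarrow> ?E (i, k) \<noteq> 0"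
      using sup[of k i] qp[of i] by (auto simp: fill_strip_def)
  next
    fix i k assume "Suc k < p i"
    then show "?E (i, k) \<le> ?E (i, Suc k)"
      using bdE[of "(i, k)"] new[of i "Suc k"] old row[of k i] by (cases "Suc k < q i") auto
  next
    fix i k assume k: "k < p (Suc i)"
    then have "k < q i" using pq[of i] by simp
    then have "?E (i, k) = T (i, k)" by (rule old)
    then show "?E (i, k) < ?E (Suc i, k)"
      using bd[of "(i, k)"] new[of "Suc i" k] old[of k "Suc i"] col[of k i] k by (cases "k < q (Suc i)") auto
  qed (use bdE cnt in auto)
  show "erase_entry (Suc N) ?E = T"
  proof
    fix c :: "nat \<times> nat"
    obtain i k where c: "c = (i, k)" by (cases c)
    show "erase_entry (Suc N) ?E c = T c"
      using bd[of c] sup[of k i] by (auto simp: c erase_entry_def fill_strip_def)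
  qed
qed

text \<open>
  The entries \<open>Suc N\<close> stand at the ends of their rows, and by strictness at most one stands in each column.
  The cells that they occupy therefore form a horizontal strip.
\<close>

lemma tableaux_restrict:
  assumes p: "partfun p" and T: "T \<in> tableaux p (Suc N) m"
  obtains q where "hstrip p q" "psize p = psize q + m N" "erase_entry (Suc N) T \<in> tableaux q N m"
    "T = fill_strip (Suc N) p q (erase_entry (Suc N) T)"
proof -
  have sup: "k < p i \<longleftrightarrow> T (i, k) \<noteq> 0" for i k using T by (auto simp: tableaux_def)
  have row: "Suc k < p i \<Longrightarrow> T (i, k) \<le> T (i, Suc k)" for i k using T by (auto simp: tableaux_def)
  have col: "k < p (Suc i) \<Longrightarrow> T (i, k) < T (Suc i, k)" for i k using T by (auto simp: tableaux_def)
  have bd: "T c \<le> Suc N" for c using T by (cases c) (auto simp: tableaux_def)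
  have ct: "t < Suc N \<Longrightarrow> card {c. T c = Suc t} = m t" for t using T by (auto simp: tableaux_def)
  have dec: "p (Suc i) \<le> p i" for i using p by (simp add: partfun_def decseq_Suc_iff)
  define q where "q i = card {k. k < p i \<and> T (i, k) \<le> N}" for i
  have q: "k < q i \<longleftrightarrow> k < p i \<and> T (i, k) \<le> N" for i k
  proof -
    have "(k < p i \<and> T (i, k) \<le> N) = (k < card {k. k < p i \<and> T (i, k) \<le> N})"
      by (rule initial_segment_iff) (use row[of _ i] order_trans Suc_lessD in \<open>blast, simp\<close>)
    then show ?thesis by (simp add: q_def)
  qed
  have qp: "q i \<le> p i" for i using q[of "p i" i] by (simp add: not_less)
  have hs: "hstrip p q"
    unfolding hstrip_def
  proof (intro allI conjI qp)
    fix i show "p (Suc i) \<le> q i"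
    proof (rule ccontr)
      assume "\<not> p (Suc i) \<le> q i"
      then have k: "q i < p (Suc i)" by simp
      then have "T (i, q i) < T (Suc i, q i)" by (rule col)
      then have "T (i, q i) \<le> N" using bd[of "(Suc i, q i)"] by simp
      then show False using q[of "q i" i] k dec[of i] by simp
    qed
  qed
  have diff: "cells p - cells q = {c. T c = Suc N}"
  proof (intro set_eqI)
    fix c :: "nat \<times> nat"
    obtain i k where c: "c = (i, k)" by (cases c)
    show "c \<in> cells p - cells q \<longleftrightarrow> c \<in> {c. T c = Suc N}"
      using bd[of c] q[of k i] sup[of k i] by (auto simp: c cells_def)
  qed
  have "psize q \<le> psize p" by (rule psize_mono[OF p qp])
  then have size: "psize p = psize q + m N"
    using card_cells_diff[OF p qp] ct[of N] by (simp add: diff)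
  have er: "erase_entry (Suc N) T (i, k) = (if k < q i then T (i, k) else 0)" for i k
    using bd[of "(i, k)"] q[of k i] sup[of k i] by (auto simp: erase_entry_def)
  have "erase_entry (Suc N) T \<in> tableaux q N m"
    unfolding tableaux_def mem_Collect_eq
  proof (intro conjI allI impI)
    fix i k show "k < q i \<longleftrightarrow> erase_entry (Suc N) T (i, k) \<noteq> 0"
      using q[of k i] sup[of k i] by (auto simp: er)
  next
    fix i k assume "Suc k < q i"
    then show "erase_entry (Suc N) T (i, k) \<le> erase_entry (Suc N) T (i, Suc k)"
      using q[of "Suc k" i] row[of k i] by (simp add: er)
  next
    fix i k assume k: "k < q (Suc i)"
    then have "k < q i" using hs qp[of "Suc i"] hstrip_Suc_le[OF hs, of i] by simp
    then show "erase_entry (Suc N) T (i, k) < erase_entry (Suc N) T (Suc i, k)"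
      using k q[of k "Suc i"] col[of k i] by (simp add: er)
  next
    fix c show "erase_entry (Suc N) T c \<le> N" using bd[of c] by (auto simp: erase_entry_def)
  next
    fix t assume "t < N"
    then have "{c. erase_entry (Suc N) T c = Suc t} = {c. T c = Suc t}" by (auto simp: erase_entry_def split: if_splits)
    then show "card {c. erase_entry (Suc N) T c = Suc t} = m t" using ct \<open>t < N\<close> by simp
  qed
  moreover have "T = fill_strip (Suc N) p q (erase_entry (Suc N) T)"
  proof
    fix c :: "nat \<times> nat"
    obtain i k where c: "c = (i, k)" by (cases c)
    show "T c = fill_strip (Suc N) p q (erase_entry (Suc N) T) c"
      using bd[of c] q[of k i] sup[of k i] by (auto simp: c fill_strip_def er)
  qed
  ultimately show ?thesis using that hs size by blast
qed

lemma card_tableaux: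
  "partfun p \<Longrightarrow> finite (tableaux p N m) \<and> card (tableaux p N m) = kostka p (map m (rev [0..<N]))"
proof (induction N arbitrary: p)
  case 0
  have "tableaux p 0 m = (if p = (\<lambda>_. 0) then {\<lambda>_. 0} else {})"
    by (auto simp: tableaux_def fun_eq_iff)
  then show ?case by simp
next
  case (Suc N)
  let ?Q = "strips_below p (m N)"
  let ?f = "\<lambda>(q, T). fill_strip (Suc N) p q T"
  have finQ: "finite ?Q" by (rule finite_subset[OF _ finite_hstrip_lower[OF Suc.prems]]) auto
  have IH: "finite (tableaux q N m) \<and> card (tableaux q N m) = kostka q (map m (rev [0..<N]))"
    if "q \<in> ?Q" for q using that by (intro Suc.IH) (auto intro: hstrip_partfun_lower[OF _ Suc.prems])
  have img: "tableaux p (Suc N) m = ?f ` (SIGMA q:?Q. tableaux q N m)"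
  proof (intro equalityI subsetI)
    fix T assume "T \<in> tableaux p (Suc N) m"
    then obtain q where q: "q \<in> ?Q" "erase_entry (Suc N) T \<in> tableaux q N m"
      "T = fill_strip (Suc N) p q (erase_entry (Suc N) T)"
      using tableaux_restrict[OF Suc.prems] by blast
    then show "T \<in> ?f ` (SIGMA q:?Q. tableaux q N m)"
      by (intro image_eqI[of _ _ "(q, erase_entry (Suc N) T)"]) auto
  qed (use tableaux_extend(1)[OF Suc.prems] in auto)
  have inj: "inj_on ?f (SIGMA q:?Q. tableaux q N m)"
  proof (rule inj_onI; clarify)
    fix q1 T1 q2 T2
    assume 1: "hstrip p q1" "psize p = psize q1 + m N" "T1 \<in> tableaux q1 N m"
      and 2: "hstrip p q2" "psize p = psize q2 + m N" "T2 \<in> tableaux q2 N m"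
      and eq: "fill_strip (Suc N) p q1 T1 = fill_strip (Suc N) p q2 T2"
    have T: "T1 = T2"
      using tableaux_extend(2)[OF Suc.prems 1] tableaux_extend(2)[OF Suc.prems 2] eq by simp
    have "k < q1 i \<longleftrightarrow> k < q2 i" for i k using 1(3) 2(3) T by (auto simp: tableaux_def)
    then have "cells q1 = cells q2" by (auto simp: cells_def)
    then show "q1 = q2 \<and> T1 = T2" using T by (simp add: cells_inject)
  qed
  have "finite (SIGMA q:?Q. tableaux q N m)" using finQ IH by (intro finite_SigmaI) auto
  moreover have "card (SIGMA q:?Q. tableaux q N m) = kostka p (map m (rev [0..<Suc N]))"
    using finQ IH by (simp add: kostka.simps(2))
  ultimately show ?case unfolding img using card_image[OF inj] by simp
qed

text \<open>
  Removing the largest entries first lists the content from the last variable to the first; by symmetry the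
  Kostka number does not notice the reversal.
\<close>

lemma schur_eq_kostka_series:
  assumes "is_partition lam"
  shows "schur lam = kostka_series (rows lam)"
proof (rule mpser_eqI)
  fix m :: monom
  obtain N where N: "keys m \<subseteq> {..<N}" using keys_bounded by blast
  have pf: "partfun (rows lam)" by (rule partfun_rows[OF assms])
  have d: "(i, k) \<in> diagram lam \<longleftrightarrow> k < rows lam i" for i k
    using cells_rows[of lam] by (auto simp: cells_def)
  have "{T. ssyt lam T \<and> weight lam T = m} = tableaux (rows lam) N (lookup m)"
  proof (intro set_eqI)
    fix T
    have "filling lam T \<longleftrightarrow> (\<forall>i k. k < rows lam i \<longleftrightarrow> T (i, k) \<noteq> 0)"
      unfolding filling_iff split_paired_All d by metis
    then show "T \<in> {T. ssyt lam T \<and> weight lam T = m} \<longleftrightarrow> T \<in> tableaux (rows lam) N (lookup m)"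
      using weight_eq_iff_bounded[OF _ N, of lam T]
      by (auto simp: ssyt_def tableaux_def d)
  qed
  then have "card {T. ssyt lam T \<and> weight lam T = m} = kostka (rows lam) (map (lookup m) (rev [0..<N]))"
    using card_tableaux[OF pf] by simp
  also have "\<dots> = kostka (rows lam) (expvec m N)"
    by (rule kostka_mset_cong[OF pf]) (simp flip: rev_map)
  also have "\<dots> = kostka (rows lam) (exponents m)" by (rule kostka_exponents[OF pf N])
  finally show "coeff (schur lam) m = coeff (kostka_series (rows lam)) m"
    by (simp add: schur_def coeff_kostka_series)
qed

section \<open>Consecutive columns of a composition tableau\<close>

text \<open>
  These are the conditions on a column \<open>d\<close> and the column \<open>c\<close> to its left. As empty cells have the value 0, the
  inequality \<open>d j < d i\<close> includes that row \<open>i\<close> reaches the column of \<open>d\<close>.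
\<close>

definition col_step :: "(nat \<Rightarrow> nat) \<Rightarrow> (nat \<Rightarrow> nat) \<Rightarrow> bool" where
  "col_step c d \<longleftrightarrow> (\<forall>i. d i \<le> c i) \<and> (\<forall>i j. i < j \<and> d j \<noteq> 0 \<and> d j \<le> c i \<longrightarrow> d j < d i)"

definition support :: "(nat \<Rightarrow> nat) \<Rightarrow> nat set" where
  "support d = {i. d i \<noteq> 0}"

definition vals :: "(nat \<Rightarrow> nat) \<Rightarrow> nat set" where
  "vals d = d ` support d"

lemma vals_iff: "x \<in> vals d \<longleftrightarrow> x \<noteq> 0 \<and> (\<exists>i. d i = x)"
  by (auto simp: vals_def support_def)

lemma support_mono: "col_step c d \<Longrightarrow> support d \<subseteq> support c"
  unfolding col_step_def support_def by (metis (mono_tags, lifting) Collect_mono le_zero_eq)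

text \<open>
  An equality \<open>d i = d j\<close> with \<open>i < j\<close> would give \<open>d j \<le> c i\<close>, and then the triple condition \<open>d j < d i\<close>.
\<close>

lemma col_step_inj: "col_step c d \<Longrightarrow> inj_on d (support d)"
proof (rule linorder_inj_onI)
  fix i j assume "col_step c d" "i < j" "i \<in> support d" "j \<in> support d"
  then show "d i \<noteq> d j" unfolding col_step_def support_def
    by (metis (mono_tags, lifting) less_irrefl mem_Collect_eq)
qed auto

lemma card_ge_eq:
  assumes "inj_on d (support d)" "0 < t"
  shows "card (vals d \<inter> {t..}) = card {i. t \<le> d i}"
proof -
  have sub: "{i. t \<le> d i} \<subseteq> support d" using assms(2) by (auto simp: support_def)
  have "d ` {i. t \<le> d i} = vals d \<inter> {t..}"
    using assms(2) by (auto simp: vals_iff)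
  then show ?thesis using card_image[OF inj_on_subset[OF assms(1) sub]] by simp
qed

text \<open>
  Let \<open>x\<close> be the largest value placed differently, say in row \<open>j\<close> by one column and in a lower row by the
  other. Since \<open>x\<close> fits in row \<open>j\<close>, the triple condition for the second column demands a value larger than \<open>x\<close> in
  row \<open>j\<close>. But larger values are placed alike in both columns.
\<close>

lemma col_step_unique:
  assumes d: "col_step c d" and e: "col_step c e" and eq: "vals d = vals e" and fin: "finite (support c)"
  shows "d = e"
proof (rule ccontr)
  assume "d \<noteq> e"
  define W where "W = {x \<in> vals d. \<exists>i. (d i = x) \<noteq> (e i = x)}"
  have "finite (vals d)" unfolding vals_def using finite_subset[OF support_mono[OF d] fin] by simp
  then have finW: "finite W" by (simp add: W_def)
  obtain i where i: "d i \<noteq> e i" using \<open>d \<noteq> e\<close> by blast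
  have "d i \<in> W \<or> e i \<in> W"
  proof (cases "d i = 0")
    case True
    then have "e i \<in> vals d" unfolding eq vals_iff using i by auto
    then show ?thesis using i unfolding W_def by blast
  next
    case False
    then have "d i \<in> vals d" unfolding vals_iff by auto
    moreover have "(d i = d i) \<noteq> (e i = d i)" using i by simp
    ultimately have "d i \<in> W" unfolding W_def mem_Collect_eq by (intro conjI exI)
    then show ?thesis ..
  qed
  then have "W \<noteq> {}" by blast
  define x where "x = Max W"
  have xW: "x \<in> W" unfolding x_def by (rule Max_in[OF finW \<open>W \<noteq> {}\<close>])
  have larger: "d j = y \<longleftrightarrow> e j = y" if "y > x" "y \<in> vals d" for y j
    using Max_ge[OF finW, of y] that unfolding x_def[symmetric] by (auto simp: W_def)
  have x0: "x \<noteq> 0" using xW by (auto simp: W_def vals_iff)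
  have xd: "x \<in> vals d" using xW by (simp add: W_def)
  obtain j where j: "d j = x" using xd by (auto simp: vals_iff)
  obtain j' where j': "e j' = x" using xd unfolding eq by (auto simp: vals_iff)
  have contra: False
    if f: "col_step c f" and g: "col_step c g" and vg: "vals g = vals d"
      and lt: "l < l'" and fl: "f l = x" and gl': "g l' = x"
      and same: "\<And>y j. y > x \<Longrightarrow> y \<in> vals d \<Longrightarrow> f j = y \<longleftrightarrow> g j = y" for f g l l'
  proof -
    have "x \<le> c l" using f fl unfolding col_step_def by metis
    then have "x < g l" using g gl' lt x0 unfolding col_step_def by metis
    then have "g l \<in> vals d" unfolding vg[symmetric] vals_iff by auto
    then have "f l = g l" using same[of "g l" l] \<open>x < g l\<close> by simp
    then show False using fl \<open>x < g l\<close> by simp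
  qed
  have "j \<noteq> j'"
  proof
    assume jj: "j = j'"
    have "d i = x \<longleftrightarrow> e i = x" for i
    proof -
      have "d i = x \<Longrightarrow> i = j" using inj_onD[OF col_step_inj[OF d], of i j] j x0 by (auto simp: support_def)
      moreover have "e i = x \<Longrightarrow> i = j" using inj_onD[OF col_step_inj[OF e], of i j] j' jj x0 by (auto simp: support_def)
      ultimately show ?thesis using j j' jj by metis
    qed
    then show False using xW unfolding W_def by blast
  qed
  then consider "j < j'" | "j' < j" by linarith
  then show False
  proof cases
    case 1
    show False by (rule contra[OF d e eq[symmetric] 1 j j']) (use larger in blast)
  next
    case 2
    show False by (rule contra[OF e d refl 2 j' j]) (use larger in blast)
  qed
qed

text \<open>
  Values are placed in decreasing order, each in the topmost free row whose left neighbour is large enough.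
  The counting hypothesis guarantees that such a row exists.
\<close>

lemma col_step_exists:
  assumes fin: "finite (support c)"
  shows "finite D \<Longrightarrow> 0 \<notin> D \<Longrightarrow> (\<And>t. 0 < t \<Longrightarrow> card (D \<inter> {t..}) \<le> card {i. t \<le> c i}) \<Longrightarrow>
    \<exists>d. col_step c d \<and> vals d = D"
proof (induction D rule: finite_linorder_min_induct)
  case empty
  show ?case by (rule exI[of _ "\<lambda>_. 0"]) (auto simp: col_step_def vals_iff)
next
  case (insert b D)
  have b0: "b \<noteq> 0" using insert.prems(1) by auto
  have "card (D \<inter> {t..}) \<le> card {i. t \<le> c i}" if "0 < t" for t
  proof -
    have "card (D \<inter> {t..}) \<le> card (insert b D \<inter> {t..})"
      by (rule card_mono) (use insert.hyps(1) in auto)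
    then show ?thesis using insert.prems(2)[OF that] by simp
  qed
  then obtain d where d: "col_step c d" and vd: "vals d = D"
    using insert.IH insert.prems(1) by blast
  have gt: "b < d i" if "d i \<noteq> 0" for i
  proof -
    have "d i \<in> D" unfolding vd[symmetric] vals_iff using that by blast
    then show ?thesis using insert.hyps(2) by blast
  qed
  have dc: "d i \<le> c i" for i using d unfolding col_step_def by blast
  have "b \<notin> D" using insert.hyps(2) by blast
  have "insert b D \<inter> {b..} = insert b D" using insert.hyps(2) by (auto intro: less_imp_le)
  then have "card D + 1 \<le> card {i. b \<le> c i}"
    using insert.prems(2)[of b] b0 \<open>b \<notin> D\<close> insert.hyps(1) by simp
  moreover have "card (support d) = card D"
    using card_image[OF col_step_inj[OF d]] vd by (simp add: vals_def)
  ultimately have "card (support d) < card {i. b \<le> c i}" by simp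
  then have "\<not> {i. b \<le> c i} \<subseteq> support d"
    using card_mono[OF finite_subset[OF support_mono[OF d] fin], of "{i. b \<le> c i}"] by linarith
  then have ex: "\<exists>i. b \<le> c i \<and> d i = 0" by (auto simp: support_def)
  define l where "l = (LEAST i. b \<le> c i \<and> d i = 0)"
  have l: "b \<le> c l" "d l = 0" using LeastI_ex[OF ex] by (simp_all add: l_def)
  have before: "d i \<noteq> 0" if "i < l" "b \<le> c i" for i
    using not_less_Least[of i "\<lambda>i. b \<le> c i \<and> d i = 0"] that by (simp add: l_def)
  let ?d = "d(l := b)"
  have "col_step c ?d"
    unfolding col_step_def
  proof (intro conjI allI impI)
    fix i show "?d i \<le> c i" using l dc[of i] by simp
  next
    fix i j assume a: "i < j \<and> ?d j \<noteq> 0 \<and> ?d j \<le> c i"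
    show "?d j < ?d i"
    proof (cases "j = l")
      case True
      then have "b < d i" using a before gt by auto
      then show ?thesis using True a by auto
    next
      case False
      then have "d j < d i" using a d unfolding col_step_def by auto
      then show ?thesis using False l by (cases "i = l") auto
    qed
  qed
  moreover have "vals ?d = insert b D"
  proof (intro set_eqI)
    fix x
    have "x \<in> D \<longleftrightarrow> x \<noteq> 0 \<and> (\<exists>i. d i = x)" unfolding vd[symmetric] vals_iff ..
    then show "x \<in> vals ?d \<longleftrightarrow> x \<in> insert b D"
      unfolding vals_iff using b0 l(2) by (metis fun_upd_apply insert_iff)
  qed
  ultimately show ?case by blast
qed

section \<open>Conjugate shapes\<close>

definition conjugate :: "(nat \<Rightarrow> nat) \<Rightarrow> nat \<Rightarrow> nat" where
  "conjugate p k = card {i. k < p i}"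

lemma less_conjugate_iff:
  assumes "partfun p"
  shows "i < conjugate p k \<longleftrightarrow> k < p i"
proof -
  obtain L where L: "\<forall>i\<ge>L. p i = 0" using assms by (auto simp: partfun_def)
  have "{i. k < p i} \<subseteq> {..<L}"
    using L by (metis (mono_tags, lifting) lessThan_iff mem_Collect_eq not_le not_less_zero subsetI)
  then have "finite {i. k < p i}" by (rule finite_subset) simp
  moreover have "k < p i" if "k < p (Suc i)" for i
    using assms that less_le_trans unfolding partfun_def decseq_Suc_iff by blast
  ultimately show ?thesis unfolding conjugate_def using initial_segment_iff[of "\<lambda>i. k < p i" i] by blast
qed

lemma eq_by_less: "(\<And>k. k < (a::nat) \<longleftrightarrow> k < b) \<Longrightarrow> a = b"
  by (meson linorder_neqE_nat less_irrefl)

lemma le_by_less: "(\<And>k. k < (a::nat) \<Longrightarrow> k < b) \<Longrightarrow> a \<le> b"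
  by (meson not_le less_irrefl)

lemma partfun_conjugate:
  assumes "partfun p"
  shows "partfun (conjugate p)"
  unfolding partfun_def decseq_Suc_iff
proof (intro conjI allI)
  fix k show "conjugate p (Suc k) \<le> conjugate p k"
    by (rule le_by_less) (simp add: less_conjugate_iff[OF assms])
next
  have "conjugate p k = 0" if "k \<ge> p 0" for k
    using less_conjugate_iff[OF assms, of 0 k] that by simp
  then show "\<exists>L. \<forall>k\<ge>L. conjugate p k = 0" by blast
qed

lemma conjugate_conjugate: "partfun p \<Longrightarrow> conjugate (conjugate p) = p"
  by (intro ext eq_by_less) (simp add: less_conjugate_iff partfun_conjugate)

lemma conjugate_inject: "partfun p \<Longrightarrow> partfun q \<Longrightarrow> conjugate p = conjugate q \<longleftrightarrow> p = q"
  by (metis conjugate_conjugate)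

lemma psize_conjugate:
  assumes "partfun p"
  shows "psize (conjugate p) = psize p"
proof -
  have "cells (conjugate p) = prod.swap ` cells p"
    by (auto simp: cells_def less_conjugate_iff[OF assms] image_iff)
  then show ?thesis by (simp add: psize_def card_image)
qed

lemma hstrip_iff_conjugate:
  assumes p: "partfun p" and q: "partfun q"
  shows "hstrip p q \<longleftrightarrow> (\<forall>k. conjugate q k \<le> conjugate p k \<and> conjugate p k \<le> Suc (conjugate q k))"
proof
  assume h: "hstrip p q"
  show "\<forall>k. conjugate q k \<le> conjugate p k \<and> conjugate p k \<le> Suc (conjugate q k)"
  proof (intro allI conjI)
    fix k
    show "conjugate q k \<le> conjugate p k"
      by (rule le_by_less) (use h in \<open>auto simp: less_conjugate_iff p q hstrip_def intro: less_le_trans\<close>)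
    show "conjugate p k \<le> Suc (conjugate q k)"
    proof (rule ccontr)
      assume "\<not> conjugate p k \<le> Suc (conjugate q k)"
      then have "k < p (Suc (conjugate q k))" by (simp add: less_conjugate_iff[OF p, symmetric])
      also have "\<dots> \<le> q (conjugate q k)" by (rule hstrip_Suc_le[OF h])
      finally have "conjugate q k < conjugate q k" by (rule iffD2[OF less_conjugate_iff[OF q]])
      then show False by simp
    qed
  qed
next
  assume R: "\<forall>k. conjugate q k \<le> conjugate p k \<and> conjugate p k \<le> Suc (conjugate q k)"
  show "hstrip p q"
    unfolding hstrip_def
  proof (intro allI conjI)
    fix i
    show "q i \<le> p i"
    proof (rule le_by_less)
      fix k assume "k < q i"
      then have "i < conjugate q k" by (simp add: less_conjugate_iff[OF q])
      also have "\<dots> \<le> conjugate p k" using R by blast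
      finally show "k < p i" by (simp add: less_conjugate_iff[OF p])
    qed
    show "p (Suc i) \<le> q i"
    proof (rule le_by_less)
      fix k assume "k < p (Suc i)"
      then have "Suc i < conjugate p k" by (simp add: less_conjugate_iff[OF p])
      also have "\<dots> \<le> Suc (conjugate q k)" using R by blast
      finally show "k < q i" by (simp add: less_conjugate_iff[OF q])
    qed
  qed
qed

lemma psize_hstrip_eq:
  assumes p: "partfun p" and h: "hstrip p q"
  shows "psize p = psize q + card {k. conjugate q k < conjugate p k}"
proof -
  have q: "partfun q" by (rule hstrip_partfun_lower[OF h p])
  have R: "conjugate q k \<le> conjugate p k" "conjugate p k \<le> Suc (conjugate q k)" for k
    using h hstrip_iff_conjugate[OF p q] by auto
  have "cells (conjugate p) - cells (conjugate q) = (\<lambda>k. (k, conjugate q k)) ` {k. conjugate q k < conjugate p k}"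
  proof (intro set_eqI)
    fix c :: "nat \<times> nat"
    obtain k j where c: "c = (k, j)" by (cases c)
    show "c \<in> cells (conjugate p) - cells (conjugate q) \<longleftrightarrow> c \<in> (\<lambda>k. (k, conjugate q k)) ` {k. conjugate q k < conjugate p k}"
      using R[of k] by (auto simp: c cells_def)
  qed
  then have "card (cells (conjugate p) - cells (conjugate q)) = card {k. conjugate q k < conjugate p k}"
    by (simp add: card_image inj_on_def)
  moreover have "card (cells (conjugate p) - cells (conjugate q)) = psize p - psize q"
    using card_cells_diff[OF partfun_conjugate[OF p] R(1)] by (simp add: psize_conjugate p q)
  moreover have "psize q \<le> psize p" by (rule hstrip_psize_le[OF h p])
  ultimately show ?thesis by simp
qed

section \<open>Sets of column entries\<close>

text \<open>
  The comparison of adjacent sets says that the right one, listed in decreasing order, is entrywise at most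
  the left one. It thus describes the columns of tableaux with weakly decreasing rows.
\<close>

definition column_sets :: "(nat \<Rightarrow> nat) \<Rightarrow> nat \<Rightarrow> nat \<Rightarrow> (nat \<Rightarrow> nat) \<Rightarrow> (nat \<Rightarrow> nat set) set" where
  "column_sets p a N m = {C. (\<forall>k. C k \<subseteq> {a<..N}) \<and> (\<forall>k. card (C k) = conjugate p k) \<and>
     (\<forall>k t. card (C (Suc k) \<inter> {t..}) \<le> card (C k \<inter> {t..})) \<and>
     (\<forall>t. a \<le> t \<and> t < N \<longrightarrow> card {k. Suc t \<in> C k} = m t)}"

definition insert_min :: "nat \<Rightarrow> (nat \<Rightarrow> nat) \<Rightarrow> (nat \<Rightarrow> nat) \<Rightarrow> (nat \<Rightarrow> nat set) \<Rightarrow> nat \<Rightarrow> nat set" where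
  "insert_min x p q C k = (if conjugate q k < conjugate p k then insert x (C k) else C k)"

lemma column_sets_extend:
  assumes p: "partfun p" and q: "hstrip p q" "psize p = psize q + m a" and a: "a < N"
    and C: "C \<in> column_sets q (Suc a) N m"
  shows "insert_min (Suc a) p q C \<in> column_sets p a N m"
    and "insert_min (Suc a) p q C k - {Suc a} = C k"
proof -
  let ?E = "insert_min (Suc a) p q C"
  have pq: "partfun q" by (rule hstrip_partfun_lower[OF q(1) p])
  have R: "conjugate q k \<le> conjugate p k" "conjugate p k \<le> Suc (conjugate q k)" for k
    using q(1) hstrip_iff_conjugate[OF p pq] by auto
  have sub: "C k \<subseteq> {Suc a<..N}" for k using C by (auto simp: column_sets_def)
  have fin: "finite (C k)" for k using finite_subset[OF sub] by simp
  have card: "card (C k) = conjugate q k" for k using C by (auto simp: column_sets_def)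
  have dom: "card (C (Suc k) \<inter> {t..}) \<le> card (C k \<inter> {t..})" for k t using C by (auto simp: column_sets_def)
  have cnt: "Suc a \<le> t \<Longrightarrow> t < N \<Longrightarrow> card {k. Suc t \<in> C k} = m t" for t using C by (auto simp: column_sets_def)
  have notin: "Suc a \<notin> C k" for k using sub[of k] by auto
  have cardE: "card (?E k) = conjugate p k" for k
    using notin[of k] fin[of k] card[of k] R[of k] by (auto simp: insert_min_def)
  have subE: "?E k \<subseteq> {a<..N}" for k using sub[of k] a by (auto simp: insert_min_def)
  show "?E \<in> column_sets p a N m"
    unfolding column_sets_def mem_Collect_eq
  proof (intro conjI allI impI subE cardE)
    fix k t
    show "card (?E (Suc k) \<inter> {t..}) \<le> card (?E k \<inter> {t..})"
    \<comment> \<open>Up to \<open>Suc a\<close> whole columns are compared, and their sizes decrease because \<open>p\<close> is a partition.\<close>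
    proof (cases "t \<le> Suc a")
      case True
      then have "?E k \<inter> {t..} = ?E k" for k using subE[of k] by auto
      then show ?thesis using partfun_conjugate[OF p] by (simp add: cardE partfun_def decseq_Suc_iff)
    next
      case False
      then have "?E k \<inter> {t..} = C k \<inter> {t..}" for k by (auto simp: insert_min_def)
      then show ?thesis using dom by simp
    qed
  next
    fix t assume t: "a \<le> t \<and> t < N"
    show "card {k. Suc t \<in> ?E k} = m t"
    proof (cases "t = a")
      case True
      then have "{k. Suc t \<in> ?E k} = {k. conjugate q k < conjugate p k}"
        using notin by (auto simp: insert_min_def)
      then show ?thesis using psize_hstrip_eq[OF p q(1)] q(2) True by simp
    next
      case False
      then have "{k. Suc t \<in> ?E k} = {k. Suc t \<in> C k}" by (auto simp: insert_min_def)
      then show ?thesis using cnt t False by simp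
    qed
  qed
  show "?E k - {Suc a} = C k" using notin[of k] by (auto simp: insert_min_def)
qed

text \<open>
  Removing \<open>Suc a\<close> shortens every column by at most one cell, which for the conjugate shape is the removal of a
  horizontal strip. The columns remain weakly decreasing in size because the comparison of adjacent sets
  holds above \<open>Suc a\<close>.
\<close>

lemma column_sets_restrict:
  assumes p: "partfun p" and a: "a < N" and C: "C \<in> column_sets p a N m"
  obtains q where "hstrip p q" "psize p = psize q + m a" "(\<lambda>k. C k - {Suc a}) \<in> column_sets q (Suc a) N m"
    "C = insert_min (Suc a) p q (\<lambda>k. C k - {Suc a})"
proof -
  let ?C = "\<lambda>k. C k - {Suc a}"
  have sub: "C k \<subseteq> {a<..N}" for k using C by (auto simp: column_sets_def)
  have fin: "finite (C k)" for k using finite_subset[OF sub] by simp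
  have card: "card (C k) = conjugate p k" for k using C by (auto simp: column_sets_def)
  have dom: "card (C (Suc k) \<inter> {t..}) \<le> card (C k \<inter> {t..})" for k t using C by (auto simp: column_sets_def)
  have cnt: "a \<le> t \<Longrightarrow> t < N \<Longrightarrow> card {k. Suc t \<in> C k} = m t" for t using C by (auto simp: column_sets_def)
  define g where "g k = card (?C k)" for k
  have Cut: "?C k = C k \<inter> {Suc (Suc a)..}" for k using sub[of k] by auto
  have g: "conjugate p k = (if Suc a \<in> C k then Suc (g k) else g k)" for k
    using card_Suc_Diff1[OF fin[of k], of "Suc a"] by (auto simp: g_def card)
  have pg: "partfun g"
    unfolding partfun_def decseq_Suc_iff
  proof
    show "\<forall>k. g (Suc k) \<le> g k" using dom by (simp add: g_def Cut)
    have "g k \<le> conjugate p k" for k using g[of k] by auto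
    then show "\<exists>L. \<forall>k\<ge>L. g k = 0" using partfun_conjugate[OF p] unfolding partfun_def by (metis le_zero_eq)
  qed
  define q where "q = conjugate g"
  have pq: "partfun q" unfolding q_def by (rule partfun_conjugate[OF pg])
  have cq: "conjugate q = g" unfolding q_def by (rule conjugate_conjugate[OF pg])
  have h: "hstrip p q" unfolding hstrip_iff_conjugate[OF p pq] cq using g by auto
  have strip: "conjugate q k < conjugate p k \<longleftrightarrow> Suc a \<in> C k" for k unfolding cq using g[of k] by auto
  have size: "psize p = psize q + m a"
    using psize_hstrip_eq[OF p h] cnt[of a] a by (simp add: strip)
  have "?C \<in> column_sets q (Suc a) N m"
    unfolding column_sets_def mem_Collect_eq
  proof (intro conjI allI impI)
    fix k show "?C k \<subseteq> {Suc a<..N}" using sub[of k] by auto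
    show "card (?C k) = conjugate q k" by (simp add: cq g_def)
  next
    fix k t
    have "?C k \<inter> {t..} = C k \<inter> {max t (Suc (Suc a))..}" for k unfolding Cut by auto
    then show "card (?C (Suc k) \<inter> {t..}) \<le> card (?C k \<inter> {t..})" using dom by simp
  next
    fix t assume t: "Suc a \<le> t \<and> t < N"
    then have "{k. Suc t \<in> ?C k} = {k. Suc t \<in> C k}" by auto
    then show "card {k. Suc t \<in> ?C k} = m t" using cnt t by simp
  qed
  moreover have "C = insert_min (Suc a) p q ?C"
    by (auto simp: fun_eq_iff insert_min_def strip)
  ultimately show ?thesis using that h size by blast
qed

lemma card_column_sets:
  "a \<le> N \<Longrightarrow> partfun p \<Longrightarrow> finite (column_sets p a N m) \<and> card (column_sets p a N m) = kostka p (map m [a..<N])"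
proof (induction a arbitrary: p rule: inc_induct)
  case base
  have "column_sets p N N m = (if p = (\<lambda>_. 0) then {\<lambda>_. {}} else {})"
  proof -
    have "conjugate p = (\<lambda>_. 0) \<longleftrightarrow> p = (\<lambda>_. 0)"
    proof
      assume "conjugate p = (\<lambda>_. 0)"
      then have "p i \<le> 0" for i
        using less_conjugate_iff[OF base, of i 0] by (simp add: fun_eq_iff)
      then show "p = (\<lambda>_. 0)" by (simp add: fun_eq_iff)
    qed (simp add: conjugate_def fun_eq_iff)
    moreover have "C \<in> column_sets p N N m \<longleftrightarrow> C = (\<lambda>_. {}) \<and> conjugate p = (\<lambda>_. 0)" for C
      by (auto simp: column_sets_def fun_eq_iff)
    ultimately show ?thesis by auto
  qed
  then show ?case by simp
next
  case (step a)
  let ?Q = "strips_below p (m a)"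
  let ?f = "\<lambda>(q, C). insert_min (Suc a) p q C"
  note p = step.prems
  have finQ: "finite ?Q" by (rule finite_subset[OF _ finite_hstrip_lower[OF p]]) auto
  have IH: "finite (column_sets q (Suc a) N m) \<and> card (column_sets q (Suc a) N m) = kostka q (map m [Suc a..<N])"
    if "q \<in> ?Q" for q using that by (intro step.IH) (auto intro: hstrip_partfun_lower[OF _ p])
  have img: "column_sets p a N m = ?f ` (SIGMA q:?Q. column_sets q (Suc a) N m)"
  proof (intro equalityI subsetI)
    fix C assume "C \<in> column_sets p a N m"
    then obtain q where q: "q \<in> ?Q" "(\<lambda>k. C k - {Suc a}) \<in> column_sets q (Suc a) N m"
      "C = insert_min (Suc a) p q (\<lambda>k. C k - {Suc a})"
      using column_sets_restrict[OF p step.hyps(2)] by blast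
    then show "C \<in> ?f ` (SIGMA q:?Q. column_sets q (Suc a) N m)"
      by (intro image_eqI[of _ _ "(q, \<lambda>k. C k - {Suc a})"]) auto
  qed (use column_sets_extend(1)[OF p _ _ step.hyps(2)] in auto)
  have inj: "inj_on ?f (SIGMA q:?Q. column_sets q (Suc a) N m)"
  proof (rule inj_onI; clarify)
    fix q1 C1 q2 C2
    assume 1: "hstrip p q1" "psize p = psize q1 + m a" "C1 \<in> column_sets q1 (Suc a) N m"
      and 2: "hstrip p q2" "psize p = psize q2 + m a" "C2 \<in> column_sets q2 (Suc a) N m"
      and eq: "insert_min (Suc a) p q1 C1 = insert_min (Suc a) p q2 C2"
    have "C1 k = C2 k" for k
      using column_sets_extend(2)[OF p 1(1,2) step.hyps(2) 1(3), of k]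
        column_sets_extend(2)[OF p 2(1,2) step.hyps(2) 2(3), of k] eq by simp
    then have C: "C1 = C2" by (rule ext)
    have "conjugate q1 k = conjugate q2 k" for k using 1(3) 2(3) C by (auto simp: column_sets_def)
    then have "conjugate q1 = conjugate q2" by (rule ext)
    then show "q1 = q2 \<and> C1 = C2"
      using C conjugate_inject hstrip_partfun_lower[OF 1(1) p] hstrip_partfun_lower[OF 2(1) p] by blast
  qed
  have "finite (SIGMA q:?Q. column_sets q (Suc a) N m)" using finQ IH by (intro finite_SigmaI) auto
  moreover have "card (SIGMA q:?Q. column_sets q (Suc a) N m) = kostka p (map m [a..<N])"
    using finQ IH step.hyps(2) by (simp add: kostka.simps(2) upt_conv_Cons)
  ultimately show ?case unfolding img using card_image[OF inj] by simp
qed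

section \<open>Composition tableaux and their column sets\<close>

text \<open>
  The composition tableaux of all shapes that rearrange \<open>p\<close>. The numbers of cells in the columns determine the
  row lengths up to order, which is why the shape itself need not be mentioned.
\<close>

definition comp_fillings :: "(nat \<Rightarrow> nat) \<Rightarrow> nat \<Rightarrow> (nat \<Rightarrow> nat) \<Rightarrow> (nat \<times> nat \<Rightarrow> nat) set" where
  "comp_fillings p N m = {T.
     (\<exists>l. (\<forall>i. T (i, 0) \<noteq> 0 \<longleftrightarrow> i < l) \<and> (\<forall>i j. i < j \<and> j < l \<longrightarrow> T (i, 0) < T (j, 0))) \<and>
     (\<forall>k. col_step (\<lambda>i. T (i, k)) (\<lambda>i. T (i, Suc k))) \<and>
     (\<forall>k. card (support (\<lambda>i. T (i, k))) = conjugate p k) \<and>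
     (\<forall>c. T c \<le> N) \<and> (\<forall>t<N. card {c. T c = Suc t} = m t)}"

definition columns :: "(nat \<times> nat \<Rightarrow> nat) \<Rightarrow> nat \<Rightarrow> nat set" where
  "columns T k = vals (\<lambda>i. T (i, k))"

definition first_column :: "(nat \<Rightarrow> nat) \<Rightarrow> bool" where
  "first_column c \<longleftrightarrow> (\<exists>l. (\<forall>i. c i \<noteq> 0 \<longleftrightarrow> i < l) \<and> (\<forall>i j. i < j \<and> j < l \<longrightarrow> c i < c j))"

lemma first_column_inj: "first_column c \<Longrightarrow> inj_on c (support c)"
  unfolding first_column_def support_def
  by (rule linorder_inj_onI) (auto, metis less_irrefl)

lemma first_column_finite:
  assumes "first_column c"
  shows "finite (support c)"
proof -
  obtain l where "\<forall>i. c i \<noteq> 0 \<longleftrightarrow> i < l" using assms by (auto simp: first_column_def)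
  then have "support c = {..<l}" by (auto simp: support_def)
  then show ?thesis by simp
qed

lemma first_column_eq:
  assumes "first_column c"
  shows "c = rows (sorted_list_of_set (vals c))"
proof -
  from assms obtain l where l: "\<forall>i. c i \<noteq> 0 \<longleftrightarrow> i < l"
    and mono: "\<forall>i j. i < j \<and> j < l \<longrightarrow> c i < c j"
    unfolding first_column_def by (elim exE conjE) (rule that)
  have sup: "support c = {..<l}" using l by (auto simp: support_def)
  have "sorted_list_of_set (vals c) = map c [0..<l]"
  proof (rule sorted_distinct_set_unique)
    show "sorted (map c [0..<l])"
      using mono by (auto simp: sorted_iff_nth_mono_less intro: less_imp_le)
    show "distinct (map c [0..<l])"
      using first_column_inj[OF assms] by (simp add: distinct_map sup lessThan_atLeast0)
    show "set (sorted_list_of_set (vals c)) = set (map c [0..<l])"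
      by (simp add: vals_def sup lessThan_atLeast0)
  qed auto
  then show ?thesis using l by (auto simp: fun_eq_iff nth_default_def)
qed

lemma first_column_rows:
  assumes "finite D" "0 \<notin> D"
  shows "first_column (rows (sorted_list_of_set D))" "vals (rows (sorted_list_of_set D)) = D"
proof -
  let ?l = "sorted_list_of_set D"
  have set: "set ?l = D" using assms(1) by simp
  have nz: "?l ! i \<noteq> 0" if "i < length ?l" for i
    using nth_mem[OF that] set assms(2) by metis
  have "sorted_wrt (<) ?l" by (rule strict_sorted_list_of_set)
  then have "?l ! i < ?l ! j" if "i < j" "j < length ?l" for i j
    using that sorted_wrt_nth_less by blast
  then show "first_column (rows ?l)"
    unfolding first_column_def
    by (intro exI[of _ "length ?l"]) (use nz in \<open>auto simp: nth_default_def simp del: length_sorted_list_of_set\<close>)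
  show "vals (rows ?l) = D"
  proof (intro set_eqI)
    fix x
    have "x \<in> D \<longleftrightarrow> (\<exists>i<length ?l. ?l ! i = x)" using set by (metis in_set_conv_nth)
    then show "x \<in> vals (rows ?l) \<longleftrightarrow> x \<in> D"
      using nz unfolding vals_iff nth_default_def by metis
  qed
qed

lemma card_entries:
  assumes "\<And>k. inj_on (\<lambda>i. T (i, k)) (support (\<lambda>i. T (i, k)))" "x \<noteq> 0"
  shows "card {c. T c = x} = card {k. x \<in> columns T k}"
proof -
  have "snd ` {c. T c = x} = {k. x \<in> columns T k}"
    using assms(2) by (force simp: columns_def vals_iff)
  moreover have "inj_on snd {c. T c = x}"
  proof (rule inj_onI)
    fix c d assume "c \<in> {c. T c = x}" "d \<in> {c. T c = x}" "snd c = snd d"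
    moreover obtain i j k where "c = (i, k)" "d = (j, k)" using \<open>snd c = snd d\<close> by (metis prod.collapse)
    ultimately show "c = d"
      using inj_onD[OF assms(1)[of k], of i j] assms(2) by (auto simp: support_def)
  qed
  ultimately show ?thesis using card_image by metis
qed

lemma comp_fillings_columns_props:
  assumes T: "T \<in> comp_fillings p N m"
  shows "first_column (\<lambda>i. T (i, 0))" "col_step (\<lambda>i. T (i, k)) (\<lambda>i. T (i, Suc k))"
    "inj_on (\<lambda>i. T (i, k)) (support (\<lambda>i. T (i, k)))" "finite (support (\<lambda>i. T (i, k)))"
    "card (columns T k) = conjugate p k" "T c \<le> N" "t < N \<Longrightarrow> card {c. T c = Suc t} = m t"
proof -
  show fc: "first_column (\<lambda>i. T (i, 0))" using T by (simp add: comp_fillings_def first_column_def)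
  show cs: "col_step (\<lambda>i. T (i, k)) (\<lambda>i. T (i, Suc k))" for k using T by (simp add: comp_fillings_def)
  show inj: "inj_on (\<lambda>i. T (i, k)) (support (\<lambda>i. T (i, k)))" for k
    by (cases k) (use first_column_inj[OF fc] col_step_inj[OF cs] in auto)
  show "finite (support (\<lambda>i. T (i, k)))" for k
  proof (induction k)
    case 0 show ?case by (rule first_column_finite[OF fc])
  next
    case (Suc k) show ?case by (rule finite_subset[OF support_mono[OF cs] Suc])
  qed
  have "card (support (\<lambda>i. T (i, k))) = conjugate p k" using T by (simp add: comp_fillings_def)
  then show "card (columns T k) = conjugate p k"
    unfolding columns_def vals_def using card_image[OF inj[of k]] by simp
  show "T c \<le> N" using T unfolding comp_fillings_def by blast
  show "t < N \<Longrightarrow> card {c. T c = Suc t} = m t" using T by (simp add: comp_fillings_def)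
qed

lemma columns_in_column_sets:
  assumes T: "T \<in> comp_fillings p N m"
  shows "columns T \<in> column_sets p 0 N m"
proof -
  note props = comp_fillings_columns_props[OF T]
  show ?thesis
    unfolding column_sets_def mem_Collect_eq
  proof (intro conjI allI impI props(5))
    fix k show "columns T k \<subseteq> {0<..N}"
      using props(6) by (auto simp: columns_def vals_iff)
  next
    fix k t
    have pos: "card (columns T (Suc k) \<inter> {t..}) \<le> card (columns T k \<inter> {t..})" if "0 < t" for t
    proof -
      have "card {i. t \<le> T (i, Suc k)} \<le> card {i. t \<le> T (i, k)}"
      proof (rule card_mono)
        show "finite {i. t \<le> T (i, k)}"
          by (rule finite_subset[OF _ props(4)[of k]]) (use that in \<open>auto simp: support_def\<close>)
        show "{i. t \<le> T (i, Suc k)} \<subseteq> {i. t \<le> T (i, k)}"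
          using props(2)[of k] order_trans unfolding col_step_def by blast
      qed
      then show ?thesis
        unfolding columns_def by (simp add: card_ge_eq[OF props(3) that])
    qed
    \<comment> \<open>Empty cells have the value 0, so they would be counted at the threshold 0.\<close>
    show "card (columns T (Suc k) \<inter> {t..}) \<le> card (columns T k \<inter> {t..})"
    proof (cases "t = 0")
      case True
      have "columns T k \<inter> {0..} = columns T k \<inter> {1..}" for k by (auto simp: columns_def vals_iff)
      then show ?thesis using pos[of 1] True by simp
    qed (use pos in simp)
  next
    fix t assume "0 \<le> t \<and> t < N"
    then show "card {k. Suc t \<in> columns T k} = m t"
      using card_entries[of T "Suc t"] props(3,7) by simp
  qed
qed

text \<open>
  The first column lists its set in increasing order, and every further column is determined by its set and
  by its left neighbour.
\<close>

lemma columns_inj: "inj_on columns (comp_fillings p N m)"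
proof (rule inj_onI)
  fix S T assume S: "S \<in> comp_fillings p N m" and T: "T \<in> comp_fillings p N m" and eq: "columns S = columns T"
  note pS = comp_fillings_columns_props[OF S] and pT = comp_fillings_columns_props[OF T]
  have v: "vals (\<lambda>i. S (i, k)) = vals (\<lambda>i. T (i, k))" for k
    using fun_cong[OF eq, of k] by (simp add: columns_def)
  have col: "(\<lambda>i. S (i, k)) = (\<lambda>i. T (i, k))" for k
  proof (induction k)
    case 0
    show ?case using first_column_eq[OF pS(1)] first_column_eq[OF pT(1)] v[of 0] by metis
  next
    case (Suc k)
    show ?case
      by (rule col_step_unique[OF pS(2)[of k] _ v pS(4)]) (use pT(2)[of k] Suc in simp)
  qed
  show "S = T"
  proof
    fix c :: "nat \<times> nat"
    obtain i k where "c = (i, k)" by (cases c)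
    then show "S c = T c" using fun_cong[OF col[of k], of i] by simp
  qed
qed

lemma columns_surj:
  assumes C: "C \<in> column_sets p 0 N m"
  shows "C \<in> columns ` comp_fillings p N m"
proof -
  have sub: "C k \<subseteq> {0<..N}" for k using C by (auto simp: column_sets_def)
  have fin: "finite (C k)" for k using finite_subset[OF sub] by simp
  have nz: "0 \<notin> C k" for k using sub[of k] by auto
  have card: "card (C k) = conjugate p k" for k using C by (auto simp: column_sets_def)
  have dom: "card (C (Suc k) \<inter> {t..}) \<le> card (C k \<inter> {t..})" for k t using C by (auto simp: column_sets_def)
  have cnt: "t < N \<Longrightarrow> card {k. Suc t \<in> C k} = m t" for t using C by (auto simp: column_sets_def)
  define col where "col = rec_nat (rows (sorted_list_of_set (C 0))) (\<lambda>k c. SOME d. col_step c d \<and> vals d = C (Suc k))"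
  have col0: "col 0 = rows (sorted_list_of_set (C 0))" by (simp add: col_def)
  have colS: "col (Suc k) = (SOME d. col_step (col k) d \<and> vals d = C (Suc k))" for k by (simp add: col_def)
  have step: "col_step (col k) (col (Suc k)) \<and> vals (col (Suc k)) = C (Suc k)"
    if "vals (col k) = C k" "inj_on (col k) (support (col k))" "finite (support (col k))" for k
  proof -
    have "card (C (Suc k) \<inter> {t..}) \<le> card {i. t \<le> col k i}" if "0 < t" for t
      using dom[of k t] card_ge_eq[OF \<open>inj_on _ _\<close> that] \<open>vals (col k) = C k\<close> by simp
    from someI_ex[OF col_step_exists[OF that(3) fin nz this]] show ?thesis unfolding colS .
  qed
  have inv: "vals (col k) = C k \<and> inj_on (col k) (support (col k)) \<and> finite (support (col k))" for k
  proof (induction k)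
    case 0
    show ?case unfolding col0
      using first_column_rows[OF fin nz] first_column_inj first_column_finite by blast
  next
    case (Suc k)
    then have s: "col_step (col k) (col (Suc k))" "vals (col (Suc k)) = C (Suc k)" using step[of k] by auto
    show ?case
      using s(2) col_step_inj[OF s(1)] finite_subset[OF support_mono[OF s(1)]] Suc by blast
  qed
  define T where "T = (\<lambda>(i, k). col k i)"
  have Tcol: "(\<lambda>i. T (i, k)) = col k" for k by (simp add: T_def)
  have cols: "columns T = C" by (rule ext) (simp add: columns_def Tcol inv)
  have "T \<in> comp_fillings p N m"
    unfolding comp_fillings_def mem_Collect_eq
  proof (intro conjI allI impI)
    have "first_column (\<lambda>i. T (i, 0))" unfolding Tcol col0 by (rule first_column_rows(1)[OF fin nz])
    then show "\<exists>l. (\<forall>i. T (i, 0) \<noteq> 0 \<longleftrightarrow> i < l) \<and> (\<forall>i j. i < j \<and> j < l \<longrightarrow> T (i, 0) < T (j, 0))"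
      by (simp add: first_column_def)
  next
    fix k show "col_step (\<lambda>i. T (i, k)) (\<lambda>i. T (i, Suc k))" unfolding Tcol using step inv by blast
    have "card (support (col k)) = card (vals (col k))"
      unfolding vals_def using inv[of k] by (simp add: card_image)
    then show "card (support (\<lambda>i. T (i, k))) = conjugate p k" unfolding Tcol using inv card by metis
  next
    fix c :: "nat \<times> nat"
    obtain i k where c: "c = (i, k)" by (cases c)
    show "T c \<le> N"
    proof (cases "T c = 0")
      case False
      then have "T c \<in> C k" unfolding cols[symmetric] columns_def vals_iff c by blast
      then show ?thesis using sub[of k] by auto
    qed simp
  next
    fix t assume "t < N"
    have "card {c. T c = Suc t} = card {k. Suc t \<in> columns T k}"
      by (rule card_entries) (use inv Tcol in auto)
    then show "card {c. T c = Suc t} = m t" using cnt[OF \<open>t < N\<close>] by (simp add: cols)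
  qed
  then show ?thesis using cols by blast
qed

lemma card_comp_fillings:
  assumes "partfun p"
  shows "finite (comp_fillings p N m) \<and> card (comp_fillings p N m) = kostka p (map m [0..<N])"
proof -
  have "columns ` comp_fillings p N m = column_sets p 0 N m"
    using columns_in_column_sets columns_surj by blast
  then show ?thesis
    using card_column_sets[OF _ assms, of 0 N m] card_image[OF columns_inj, of p N m]
      finite_image_iff[OF columns_inj, of p N m] by simp
qed

section \<open>Composition tableaux by underlying partition\<close>

lemma mem_diagram_iff: "(i, k) \<in> diagram \<alpha> \<longleftrightarrow> k < rows \<alpha> i"
  unfolding cells_rows[symmetric] by (simp add: cells_def)

lemma is_partition_underlying: "is_composition \<alpha> \<Longrightarrow> is_partition (underlying \<alpha>)"
  by (simp add: is_partition_def is_composition_def underlying_def sorted_wrt_rev)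

lemma sum_list_underlying: "sum_list (underlying \<alpha>) = sum_list \<alpha>"
  unfolding underlying_def by (metis mset_rev mset_sort sum_mset_sum_list)

lemma mset_underlying: "mset (underlying \<alpha>) = mset \<alpha>"
  by (simp add: underlying_def)

lemma underlying_eq_iff: "underlying \<alpha> = underlying \<beta> \<longleftrightarrow> mset \<alpha> = mset \<beta>"
  by (metis mset_underlying underlying_def sorted_list_of_multiset_mset)

lemma underlying_partition:
  assumes "is_partition lam"
  shows "underlying lam = lam"
proof -
  have "sorted (rev lam)" using assms by (simp add: is_partition_def sorted_wrt_rev)
  then have "sort lam = rev lam" by (intro properties_for_sort) simp_all
  then show ?thesis by (simp add: underlying_def)
qed

lemma conjugate_rows: "conjugate (rows \<alpha>) k = length (filter (\<lambda>x. k < x) \<alpha>)"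
  unfolding conjugate_def length_filter_conv_card
  by (rule arg_cong[where f = card]) (auto simp: nth_default_def)

lemma conjugate_rows_underlying: "conjugate (rows (underlying \<alpha>)) = conjugate (rows \<alpha>)"
  by (rule ext) (metis conjugate_rows mset_filter mset_underlying size_mset)

lemma ssct_imp_comp_filling:
  assumes \<alpha>: "is_composition \<alpha>" and T: "ssct \<alpha> T" and w: "weight \<alpha> T = m"
    and N: "keys m \<subseteq> {..<N}"
  shows "T \<in> comp_fillings (rows (underlying \<alpha>)) N (lookup m)"
proof -
  have f: "filling \<alpha> T" using T by (simp add: ssct_def)
  have sup: "T c \<noteq> 0 \<longleftrightarrow> c \<in> diagram \<alpha>" for c by (rule filling_pos_iff[OF f])
  have dec: "T (i, Suc k) \<le> T (i, k)" for i k
    using T sup[of "(i, Suc k)"] unfolding ssct_def by (cases "(i, Suc k) \<in> diagram \<alpha>") auto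
  have d0: "(i, 0) \<in> diagram \<alpha> \<longleftrightarrow> i < length \<alpha>" for i
    using \<alpha> by (auto simp: diagram_def is_composition_def)
  show ?thesis
    unfolding comp_fillings_def mem_Collect_eq
  proof (intro conjI)
    show "\<exists>l. (\<forall>i. T (i, 0) \<noteq> 0 \<longleftrightarrow> i < l) \<and> (\<forall>i j. i < j \<and> j < l \<longrightarrow> T (i, 0) < T (j, 0))"
      using T d0 sup unfolding ssct_def by (intro exI[of _ "length \<alpha>"]) auto
    show "\<forall>k. col_step (\<lambda>i. T (i, k)) (\<lambda>i. T (i, Suc k))"
      unfolding col_step_def
    proof (intro allI conjI impI dec)
      fix k i j assume a: "i < j \<and> T (j, Suc k) \<noteq> 0 \<and> T (j, Suc k) \<le> T (i, k)"
      then have "T (j, Suc k) \<noteq> 0" "T (i, k) \<noteq> 0" by auto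
      then have "(j, Suc k) \<in> diagram \<alpha>" "(i, k) \<in> diagram \<alpha>" using sup by blast+
      then show "T (j, Suc k) < T (i, Suc k)" using T a unfolding ssct_def by auto
    qed
    show "\<forall>k. card (support (\<lambda>i. T (i, k))) = conjugate (rows (underlying \<alpha>)) k"
      unfolding conjugate_rows_underlying conjugate_def support_def sup mem_diagram_iff by blast
    show "\<forall>c. T c \<le> N" "\<forall>t<N. card {c. T c = Suc t} = lookup m t"
      using weight_eq_iff_bounded[OF f N] w by auto
  qed
qed

text \<open>
  Entries decrease weakly along rows, so the nonzero entries of a row form an initial segment; the lengths of
  these segments are the shape. It rearranges \<open>lam\<close> since both have the same conjugate.
\<close>

lemma comp_filling_imp_ssct:
  assumes lam: "is_partition lam" and T: "T \<in> comp_fillings (rows lam) N (lookup m)"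
    and N: "keys m \<subseteq> {..<N}"
  obtains \<alpha> where "is_composition \<alpha>" "underlying \<alpha> = lam" "ssct \<alpha> T" "weight \<alpha> T = m"
proof -
  note props = comp_fillings_columns_props[OF T]
  from props(1) obtain l where "\<forall>i. T (i, 0) \<noteq> 0 \<longleftrightarrow> i < l"
    and "\<forall>i j. i < j \<and> j < l \<longrightarrow> T (i, 0) < T (j, 0)"
    unfolding first_column_def by (elim exE conjE) (rule that)
  then have l: "T (i, 0) \<noteq> 0 \<longleftrightarrow> i < l" and mono: "i < j \<Longrightarrow> j < l \<Longrightarrow> T (i, 0) < T (j, 0)" for i j
    by blast+
  have dec: "T (i, Suc k) \<le> T (i, k)" for i k using props(2)[of k] by (simp add: col_step_def)
  have down: "T (i, Suc k) \<noteq> 0 \<Longrightarrow> T (i, k) \<noteq> 0" for i k using dec[of i k] by simp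
  have cs: "card (support (\<lambda>i. T (i, k))) = conjugate (rows lam) k" for k using T by (simp add: comp_fillings_def)
  have pf: "partfun (rows lam)" by (rule partfun_rows[OF lam])
  obtain K where K: "\<And>k. k \<ge> K \<Longrightarrow> conjugate (rows lam) k = 0" using partfun_conjugate[OF pf] partfun_def by auto
  have fin: "finite {k. T (i, k) \<noteq> 0}" for i
  proof (rule finite_subset)
    show "{k. T (i, k) \<noteq> 0} \<subseteq> {..<K}"
    proof
      fix k assume "k \<in> {k. T (i, k) \<noteq> 0}"
      then have "support (\<lambda>i. T (i, k)) \<noteq> {}" by (auto simp: support_def)
      then have "conjugate (rows lam) k \<noteq> 0" using props(4)[of k] cs[of k] by (metis card_0_eq)
      then show "k \<in> {..<K}" using K[of k] by (cases "k < K") auto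
    qed
  qed simp
  define r where "r i = card {k. T (i, k) \<noteq> 0}" for i
  have r: "k < r i \<longleftrightarrow> T (i, k) \<noteq> 0" for i k
    unfolding r_def by (rule initial_segment_iff[symmetric]) (use down fin in blast)+
  define \<alpha> where "\<alpha> = map r [0..<l]"
  have d: "(i, k) \<in> diagram \<alpha> \<longleftrightarrow> T (i, k) \<noteq> 0" for i k
  proof -
    have "T (i, k) \<noteq> 0 \<Longrightarrow> i < l"
      using l[of i] r[of 0 i] r[of k i] by simp
    then show ?thesis using r[of k i] by (auto simp: diagram_def \<alpha>_def)
  qed
  have comp: "is_composition \<alpha>" using r[of 0] l by (auto simp: is_composition_def \<alpha>_def)
  have f: "filling \<alpha> T" unfolding filling_iff using d by auto
  have "conjugate (rows \<alpha>) k = conjugate (rows lam) k" for k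
    unfolding cs[symmetric] unfolding conjugate_def support_def d[symmetric] mem_diagram_iff ..
  then have "conjugate (rows (underlying \<alpha>)) = conjugate (rows lam)"
    unfolding conjugate_rows_underlying by (rule ext)
  then have "rows (underlying \<alpha>) = rows lam"
    using conjugate_inject[OF partfun_rows[OF is_partition_underlying[OF comp]] pf] by blast
  then have und: "underlying \<alpha> = lam"
    using rows_inject is_partition_underlying[OF comp] lam by (simp add: is_partition_def)
  have s: "ssct \<alpha> T"
    unfolding ssct_def
  proof (intro conjI allI impI f)
    fix i k show "T (i, k + 1) \<le> T (i, k)" using dec by simp
  next
    fix i j assume "i < j \<and> (i, 0) \<in> diagram \<alpha> \<and> (j, 0) \<in> diagram \<alpha>"
    then show "T (i, 0) < T (j, 0)" using mono d l by simp
  next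
    fix i j k assume a: "i < j \<and> (i, k) \<in> diagram \<alpha> \<and> (j, k + 1) \<in> diagram \<alpha> \<and> T (j, k + 1) \<le> T (i, k)"
    then show "T (j, k + 1) < T (i, k + 1)"
      using props(2)[of k] d unfolding col_step_def by simp
    then show "(i, k + 1) \<in> diagram \<alpha>" using d by simp
  qed
  have "weight \<alpha> T = m"
    using weight_eq_iff_bounded[OF f N] props(6,7) by blast
  then show ?thesis using that comp und s by blast
qed

definition comps :: "nat \<Rightarrow> nat list set" where
  "comps n = {\<alpha>. is_composition \<alpha> \<and> sum_list \<alpha> = n}"

lemma finite_comps [simp]: "finite (comps n)"
proof (rule finite_subset)
  show "comps n \<subseteq> {xs. set xs \<subseteq> {..n} \<and> length xs \<le> n}"
  proof
    fix \<alpha> assume "\<alpha> \<in> comps n"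
    then have \<alpha>: "\<forall>a\<in>set \<alpha>. 0 < a" "sum_list \<alpha> = n" by (auto simp: comps_def is_composition_def)
    have "length xs \<le> sum_list xs" if "\<forall>a\<in>set xs. 0 < a" for xs :: "nat list"
      using that by (induction xs) auto
    then show "\<alpha> \<in> {xs. set xs \<subseteq> {..n} \<and> length xs \<le> n}"
      using \<alpha> member_le_sum_list by auto
  qed
qed (simp add: finite_lists_length_le)

definition rearrangements :: "nat list \<Rightarrow> nat list set" where
  "rearrangements lam = {\<alpha>. is_composition \<alpha> \<and> underlying \<alpha> = lam}"

lemma finite_rearrangements [simp]: "finite (rearrangements lam)"
  by (rule finite_subset[OF _ finite_comps[of "sum_list lam"]])
     (auto simp: rearrangements_def comps_def sum_list_underlying)

lemma ssct_shape_unique: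
  assumes "is_composition \<alpha>" "is_composition \<beta>" "ssct \<alpha> T" "ssct \<beta> T"
  shows "\<alpha> = \<beta>"
proof -
  have "diagram \<alpha> = diagram \<beta>"
    using filling_pos_iff[of \<alpha> T] filling_pos_iff[of \<beta> T] assms(3,4) by (auto simp: ssct_def)
  then have "rows \<alpha> = rows \<beta>" by (simp add: cells_rows[symmetric] cells_inject)
  then show ?thesis using rows_inject assms(1,2) by blast
qed

lemma finite_ssct:
  assumes \<alpha>: "is_composition \<alpha>"
  shows "finite (ssct_of \<alpha> m)"
proof -
  obtain N where N: "keys m \<subseteq> {..<N}" using keys_bounded by blast
  show ?thesis
    by (rule finite_subset[OF _ conjunct1[OF card_comp_fillings[OF partfun_rows[OF is_partition_underlying[OF \<alpha>]], of N "lookup m"]]])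
       (use ssct_imp_comp_filling[OF \<alpha> _ _ N] in auto)
qed

text \<open>
  Composition tableaux of all shapes rearranging \<open>lam\<close> are counted by their column sets, and these by chains
  of horizontal strips that start at \<open>lam\<close>.
\<close>

lemma sum_card_ssct:
  assumes lam: "is_partition lam"
  shows "(\<Sum>\<alpha>\<in>rearrangements lam. card (ssct_of \<alpha> m)) = kostka (rows lam) (exponents m)"
proof -
  obtain N where N: "keys m \<subseteq> {..<N}" using keys_bounded by blast
  have pf: "partfun (rows lam)" by (rule partfun_rows[OF lam])
  have "(\<Sum>\<alpha>\<in>rearrangements lam. card (ssct_of \<alpha> m))
      = card (\<Union>\<alpha>\<in>rearrangements lam. ssct_of \<alpha> m)"
  proof (rule card_UN_disjoint[symmetric])
    show "\<forall>\<alpha>\<in>rearrangements lam. finite (ssct_of \<alpha> m)"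
      using finite_ssct by (simp add: rearrangements_def)
    show "\<forall>\<alpha>\<in>rearrangements lam. \<forall>\<beta>\<in>rearrangements lam. \<alpha> \<noteq> \<beta> \<longrightarrow>
       ssct_of \<alpha> m \<inter> ssct_of \<beta> m = {}"
      using ssct_shape_unique by (auto simp: rearrangements_def)
  qed simp
  also have "(\<Union>\<alpha>\<in>rearrangements lam. ssct_of \<alpha> m) = comp_fillings (rows lam) N (lookup m)"
  proof (intro equalityI subsetI)
    fix T assume "T \<in> comp_fillings (rows lam) N (lookup m)"
    then obtain \<alpha> where "is_composition \<alpha>" "underlying \<alpha> = lam" "ssct \<alpha> T" "weight \<alpha> T = m"
      by (rule comp_filling_imp_ssct[OF lam _ N])
    then show "T \<in> (\<Union>\<alpha>\<in>rearrangements lam. ssct_of \<alpha> m)"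
      by (auto simp: rearrangements_def)
  qed (use ssct_imp_comp_filling[OF _ _ _ N] in \<open>auto simp: rearrangements_def\<close>)
  also have "card \<dots> = kostka (rows lam) (expvec m N)" using card_comp_fillings[OF pf] by blast
  also have "\<dots> = kostka (rows lam) (exponents m)" by (rule kostka_exponents[OF pf N])
  finally show ?thesis .
qed

section \<open>Unitriangular matrices and dual families\<close>

text \<open>
  Back substitution: the unknown whose index has the smallest rank occurs in its own equation only, so it
  can be determined last.
\<close>

lemma unitriangular_solve:
  fixes A :: "'i \<Rightarrow> 'i \<Rightarrow> 'a :: field" and r :: "'i \<Rightarrow> int"
  assumes "finite I" and diag: "\<And>i. i \<in> I \<Longrightarrow> A i i = 1"
    and tri: "\<And>i j. i \<in> I \<Longrightarrow> j \<in> I \<Longrightarrow> i \<noteq> j \<Longrightarrow> A i j \<noteq> 0 \<Longrightarrow> r i < r j"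
  shows "\<exists>x. \<forall>i\<in>I. (\<Sum>k\<in>I. A i k * x k) = b i"
  using assms
proof (induction I rule: finite_ranking_induct[where f = "\<lambda>i. - r i"])
  case (insert l S)
  show ?case
  proof (cases "l \<in> S")
    case True
    then show ?thesis using insert by (simp add: insert_absorb)
  next
    case False
    have "\<exists>x. \<forall>i\<in>S. (\<Sum>k\<in>S. A i k * x k) = b i"
      by (rule insert.IH) (use insert.prems in auto)
    then obtain x where x: "\<And>i. i \<in> S \<Longrightarrow> (\<Sum>k\<in>S. A i k * x k) = b i" by blast
    \<comment> \<open>The coefficients of the unknown \<open>l\<close> in the equations of \<open>S\<close> vanish, so its value can be chosen to suit its own.\<close>
    define y where "y = x(l := b l - (\<Sum>k\<in>S. A l k * x k))"
    have same: "(\<Sum>k\<in>S. A i k * y k) = (\<Sum>k\<in>S. A i k * x k)" for i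
      by (rule sum.cong) (use False in \<open>auto simp: y_def\<close>)
    have "(\<Sum>k\<in>insert l S. A i k * y k) = b i" if i: "i \<in> insert l S" for i
    proof (cases "i = l")
      case True
      then show ?thesis
        using insert.hyps(1) False insert.prems(1)[of l] by (simp add: same) (simp add: y_def)
    next
      case i': False
      then have "i \<in> S" using i by simp
      then have "A i l = 0" using insert.prems(2)[of i l] insert.hyps(2)[of i] i' by force
      then show ?thesis using insert.hyps(1) False x[OF \<open>i \<in> S\<close>] by (simp add: same)
    qed
    then show ?thesis by blast
  qed
qed simp

definition inverse_on :: "'i set \<Rightarrow> ('i \<Rightarrow> 'i \<Rightarrow> 'a :: field) \<Rightarrow> ('i \<Rightarrow> 'i \<Rightarrow> 'a) \<Rightarrow> bool" where
  "inverse_on I A B \<longleftrightarrow> (\<forall>i\<in>I. \<forall>j\<in>I.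
     (\<Sum>k\<in>I. A i k * B k j) = (if i = j then 1 else 0) \<and>
     (\<Sum>k\<in>I. B i k * A k j) = (if i = j then 1 else 0))"

lemma unitriangular_inverse:
  fixes A :: "'i \<Rightarrow> 'i \<Rightarrow> 'a :: field" and r :: "'i \<Rightarrow> int"
  assumes fin: "finite I" and diag: "\<And>i. i \<in> I \<Longrightarrow> A i i = 1"
    and tri: "\<And>i j. i \<in> I \<Longrightarrow> j \<in> I \<Longrightarrow> i \<noteq> j \<Longrightarrow> A i j \<noteq> 0 \<Longrightarrow> r i < r j"
  shows "\<exists>B. inverse_on I A B"
proof -
  have "\<forall>j. \<exists>x. \<forall>i\<in>I. (\<Sum>k\<in>I. A i k * x k) = (if i = j then 1 else 0)"
    by (intro allI unitriangular_solve[where r = r] assms)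
  then obtain X where X: "\<And>j i. i \<in> I \<Longrightarrow> (\<Sum>k\<in>I. A i k * X j k) = (if i = j then 1 else 0)" by metis
  have "\<forall>i. \<exists>y. \<forall>j\<in>I. (\<Sum>k\<in>I. A k j * y k) = (if j = i then 1 else 0)"
    by (intro allI unitriangular_solve[where r = "\<lambda>i. - r i"]) (use assms in force)+
  then obtain Y where Y: "\<And>i j. j \<in> I \<Longrightarrow> (\<Sum>k\<in>I. A k j * Y i k) = (if j = i then 1 else 0)" by metis
  have "Y i j = X j i" if i: "i \<in> I" and j: "j \<in> I" for i j
  proof -
    have "Y i j = (\<Sum>k\<in>I. Y i k * (if k = j then 1 else 0))"
      using fin j by (simp add: if_distrib[of "\<lambda>x. _ * x"] sum.delta cong: if_cong)
    also have "\<dots> = (\<Sum>k\<in>I. Y i k * (\<Sum>l\<in>I. A k l * X j l))" by (rule sum.cong) (simp_all add: X)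
    also have "\<dots> = (\<Sum>k\<in>I. \<Sum>l\<in>I. A k l * Y i k * X j l)" by (simp add: sum_distrib_left mult_ac)
    also have "\<dots> = (\<Sum>l\<in>I. \<Sum>k\<in>I. A k l * Y i k * X j l)" by (rule sum.swap)
    also have "\<dots> = (\<Sum>l\<in>I. (if l = i then 1 else 0) * X j l)"
      by (rule sum.cong) (simp_all add: Y sum_distrib_right[symmetric])
    also have "\<dots> = X j i"
      using fin i by (simp add: if_distrib[of "\<lambda>x. x * _"] sum.delta cong: if_cong)
    finally show ?thesis .
  qed
  then have "(\<Sum>k\<in>I. X k i * A k j) = (if i = j then 1 else 0)" if "i \<in> I" "j \<in> I" for i j
    using Y[OF that(2), of i] that by (simp add: mult.commute eq_commute cong: sum.cong)
  then have "inverse_on I A (\<lambda>k j. X j k)" unfolding inverse_on_def using X by blast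
  then show ?thesis by blast
qed

context vector_space
begin

lemma coordinate_sum:
  assumes add: "\<And>x y. f (x + y) = f x + f y" and scale: "\<And>c x. f (scale c x) = c * f x"
  shows "f (\<Sum>w\<in>A. scale (u w) (v w)) = (\<Sum>w\<in>A. u w * f (v w))"
proof -
  have "f 0 = 0" using scale[of 0 0] by simp
  then show ?thesis by (induction A rule: infinite_finite_induct) (simp_all add: add scale)
qed

text \<open>
  Linear functionals dual to a family yield its independence and read off the coordinates with respect to it.
\<close>

lemma coordinates:
  assumes add: "\<And>i x y. \<phi> i (x + y) = \<phi> i x + \<phi> i y"
    and scale: "\<And>i c x. \<phi> i (scale c x) = c * \<phi> i x"
    and dual: "\<And>i j. i \<in> I \<Longrightarrow> j \<in> I \<Longrightarrow> \<phi> i (b j) = (if i = j then 1 else 0)"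
  shows independent_coordinates: "independent (b ` I)"
    and representation_coordinates:
      "v \<in> span (b ` I) \<Longrightarrow> i \<in> I \<Longrightarrow> representation (b ` I) v (b i) = \<phi> i v"
proof -
  have pick: "(\<Sum>w\<in>A. u w * \<phi> i w) = (if b i \<in> A then u (b i) else 0)"
    if "i \<in> I" "A \<subseteq> b ` I" "finite A" for i A u
  proof -
    have "\<phi> i w = (if w = b i then 1 else 0)" if "w \<in> A" for w
      using dual \<open>i \<in> I\<close> \<open>A \<subseteq> b ` I\<close> that by (auto split: if_splits)
    then have "(\<Sum>w\<in>A. u w * \<phi> i w) = (\<Sum>w\<in>A. if w = b i then u w else 0)"
      by (intro sum.cong) auto
    then show ?thesis using that(3) by simp
  qed
  show ind: "independent (b ` I)"
    unfolding dependent_explicit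
  proof (rule notI, elim exE conjE bexE)
    fix t u w assume t0: "finite t" "t \<subseteq> b ` I" "(\<Sum>v\<in>t. scale (u v) v) = 0" "w \<in> t" "u w \<noteq> 0"
    then obtain i where "i \<in> I" "w = b i" by blast
    with t0 have t: "finite t" "t \<subseteq> b ` I" "(\<Sum>v\<in>t. scale (u v) v) = 0" "i \<in> I" "b i \<in> t" "u (b i) \<noteq> 0"
      by simp_all
    have "\<phi> i 0 = 0" using scale[of i 0 0] by simp
    then have "(\<Sum>w\<in>t. u w * \<phi> i w) = 0"
      using coordinate_sum[of "\<phi> i" u "\<lambda>w. w" t, OF add scale] t(3) by simp
    then show False using pick[OF t(4,2,1)] t by simp
  qed
  assume v: "v \<in> span (b ` I)" and i: "i \<in> I"
  let ?r = "representation (b ` I) v"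
  have "\<phi> i v = \<phi> i (\<Sum>w | ?r w \<noteq> 0. scale (?r w) w)"
    by (simp only: sum_nonzero_representation_eq[OF ind v])
  also have "\<dots> = (\<Sum>w | ?r w \<noteq> 0. ?r w * \<phi> i w)" by (rule coordinate_sum[OF add scale])
  also have "\<dots> = ?r (b i)"
  proof -
    have "{w. ?r w \<noteq> 0} \<subseteq> b ` I" using representation_ne_zero by blast
    from pick[OF i this finite_representation, of ?r] show ?thesis by simp
  qed
  finally show "?r (b i) = \<phi> i v" ..
qed

end

section \<open>Quasisymmetry and triangularity of the quasisymmetric Schur functions\<close>

lemma filling_relabel:
  "(\<And>c. f (T c) = 0 \<longleftrightarrow> T c = 0) \<Longrightarrow> filling \<alpha> (\<lambda>c. f (T c)) \<longleftrightarrow> filling \<alpha> T"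
  by (simp add: filling_iff)

lemma ssct_relabel:
  assumes f: "\<And>x y. x \<le> l \<Longrightarrow> y \<le> l \<Longrightarrow> f x < f y \<longleftrightarrow> x < y" and f0: "f 0 = 0" and T: "\<And>c. T c \<le> l"
  shows "ssct \<alpha> (\<lambda>c. f (T c)) \<longleftrightarrow> ssct \<alpha> T"
proof -
  have lt: "f (T c) < f (T d) \<longleftrightarrow> T c < T d" for c d by (rule f[OF T T])
  have le: "f (T c) \<le> f (T d) \<longleftrightarrow> T c \<le> T d" for c d using lt[of d c] by linarith
  have "0 < f (T c) \<longleftrightarrow> 0 < T c" for c using f[of 0 "T c"] T f0 by simp
  then have "filling \<alpha> (\<lambda>c. f (T c)) \<longleftrightarrow> filling \<alpha> T"
    by (intro filling_relabel) (metis not_gr_zero)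
  then show ?thesis unfolding ssct_def lt le by blast
qed

text \<open>
  The conditions on a composition tableau only compare entries, so they survive the increasing relabelling of
  \<open>1, 2, \<dots>\<close> by the variables that occur in \<open>m\<close>.
\<close>

lemma card_ssct_exponents:
  "card (ssct_of \<alpha> m) = card (ssct_of \<alpha> (monomial (exponents m)))"
proof -
  define ks where "ks = sorted_list_of_set (keys m)"
  define l where "l = length ks"
  \<comment> \<open>\<open>f\<close> sends entry \<open>i\<close> to the \<open>i\<close>-th variable occurring in \<open>m\<close>, and 0, the value off the diagram, to itself.\<close>
  define f where "f x = (case x of 0 \<Rightarrow> 0 | Suc i \<Rightarrow> Suc (ks ! i))" for x
  have f0: "f 0 = 0" and fS: "f (Suc i) = Suc (ks ! i)" for i by (simp_all add: f_def)
  have set: "set ks = keys m" by (simp add: ks_def)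
  have "sorted_wrt (<) ks" unfolding ks_def by (rule strict_sorted_list_of_set)
  then have ks: "ks ! i < ks ! j" if "i < j" "j < l" for i j
    using that sorted_wrt_nth_less unfolding l_def by blast
  have up: "f x < f y" if "x < y" "y \<le> l" for x y
    using that ks by (auto simp: f_def split: nat.split)
  have f: "f x < f y \<longleftrightarrow> x < y" if "x \<le> l" "y \<le> l" for x y
    using up[of x y] up[of y x] that by (cases x y rule: linorder_cases) auto
  have relabel: "ssct \<alpha> (\<lambda>c. f (T c)) \<longleftrightarrow> ssct \<alpha> T" if "\<And>c. T c \<le> l" for T
    by (rule ssct_relabel[where l = l]) (use f f0 that in auto)
  have finj: "inj_on f {..l}"
    by (rule linorder_inj_onI) (use up in \<open>auto simp: less_le\<close>)
  have fim: "f ` {..l} = insert 0 (Suc ` keys m)"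
  proof -
    have "{..l} = insert 0 (Suc ` {..<l})" using lessThan_Suc_eq_insert_0 lessThan_Suc_atMost by metis
    then have "f ` {..l} = insert 0 ((\<lambda>i. Suc (ks ! i)) ` {..<l})" by (simp add: image_image f0 fS)
    also have "(\<lambda>i. Suc (ks ! i)) ` {..<l} = Suc ` set ks"
      by (auto simp: l_def set_conv_nth)
    finally show ?thesis by (simp add: set)
  qed
  have exps: "exponents m = map (lookup m) ks" by (simp add: exponents_def ks_def)
  let ?e = "monomial (exponents m)"
  have le: "length (exponents m) = l" by (simp add: exps l_def)
  have ke: "keys ?e \<subseteq> {..<l}" using keys_nth[of "exponents m"] le by simp
  have lke: "lookup ?e i = lookup m (ks ! i)" if "i < l" for i
    using that by (simp add: nth.rep_eq nth_default_def exps l_def)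
  have w: "weight \<alpha> (\<lambda>c. f (T c)) = m \<longleftrightarrow> weight \<alpha> T = ?e"
    if T: "\<And>c. T c \<le> l" and s: "ssct \<alpha> T" for T
  proof -
    have fil: "filling \<alpha> T" using s by (simp add: ssct_def)
    have "ssct \<alpha> (\<lambda>c. f (T c))" using relabel[of T, OF T] s by blast
    then have fil': "filling \<alpha> (\<lambda>c. f (T c))" by (simp add: ssct_def)
    have same: "{c. f (T c) = Suc (ks ! i)} = {c. T c = Suc i}" if "i < l" for i
    proof -
      have "f (T c) = f (Suc i) \<longleftrightarrow> T c = Suc i" for c
        by (rule inj_on_eq_iff[OF finj]) (use T that in auto)
      then show ?thesis by (simp add: fS)
    qed
    have out: "{c. f (T c) = Suc t} = {}" if "t \<notin> keys m" for t
    proof -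
      have "f (T c) \<in> insert 0 (Suc ` keys m)" for c using fim T by blast
      moreover have "Suc t \<notin> insert 0 (Suc ` keys m)" using that by auto
      ultimately show ?thesis by (metis (mono_tags, lifting) Collect_empty_eq)
    qed
    have "weight \<alpha> (\<lambda>c. f (T c)) = m \<longleftrightarrow> (\<forall>t. card {c. f (T c) = Suc t} = lookup m t)"
      by (rule weight_eq_iff[OF fil'])
    also have "\<dots> \<longleftrightarrow> (\<forall>t\<in>set ks. card {c. f (T c) = Suc t} = lookup m t)"
    proof -
      have "card {c. f (T c) = Suc t} = lookup m t" if "t \<notin> set ks" for t
      proof -
        have "t \<notin> keys m" using that by (simp add: set)
        then have "{c. f (T c) = Suc t} = {}" "lookup m t = 0"
          using out by (blast, simp add: in_keys_iff)
        then show ?thesis by (simp only: card.empty)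
      qed
      then show ?thesis by blast
    qed
    also have "\<dots> \<longleftrightarrow> (\<forall>i<l. card {c. f (T c) = Suc (ks ! i)} = lookup m (ks ! i))"
      by (simp add: all_set_conv_all_nth l_def)
    also have "\<dots> \<longleftrightarrow> (\<forall>i<l. card {c. T c = Suc i} = lookup ?e i)"
      using same lke by auto
    also have "\<dots> \<longleftrightarrow> weight \<alpha> T = ?e"
      using weight_eq_iff_bounded[OF fil ke] T by blast
    finally show ?thesis .
  qed
  have bd: "T c \<le> l" if "ssct \<alpha> T" "weight \<alpha> T = ?e" for T c
  proof -
    have "filling \<alpha> T" using that(1) by (simp add: ssct_def)
    then show ?thesis using weight_eq_iff_bounded[OF _ ke, of \<alpha> T] that(2) by blast
  qed
  have "bij_betw (\<lambda>T c. f (T c)) (ssct_of \<alpha> ?e) (ssct_of \<alpha> m)"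
    unfolding bij_betw_def
  proof
    show "inj_on (\<lambda>T c. f (T c)) (ssct_of \<alpha> ?e)"
    proof (rule inj_onI)
      fix S T assume "S \<in> ssct_of \<alpha> ?e" "T \<in> ssct_of \<alpha> ?e"
        and eq: "(\<lambda>c. f (S c)) = (\<lambda>c. f (T c))"
      then have "S c \<le> l" "T c \<le> l" for c using bd by auto
      then have "S c = T c" for c using inj_onD[OF finj fun_cong[OF eq, of c]] by simp
      then show "S = T" by (rule ext)
    qed
    show "(\<lambda>T c. f (T c)) ` ssct_of \<alpha> ?e = ssct_of \<alpha> m"
    proof (intro equalityI subsetI)
      fix S assume "S \<in> (\<lambda>T c. f (T c)) ` ssct_of \<alpha> ?e"
      then obtain T where T: "ssct \<alpha> T" "weight \<alpha> T = ?e" "S = (\<lambda>c. f (T c))" by blast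
      have Tl: "T c \<le> l" for c by (rule bd[OF T(1,2)])
      show "S \<in> ssct_of \<alpha> m"
        using w[OF Tl T(1)] relabel[of T, OF Tl] T by simp
    next
      fix S assume "S \<in> ssct_of \<alpha> m"
      then have S: "ssct \<alpha> S" "weight \<alpha> S = m" by auto
      then have fS: "filling \<alpha> S" by (simp add: ssct_def)
      have "S c \<in> f ` {..l}" for c
      proof (cases "S c")
        case 0 then show ?thesis unfolding fim by simp
      next
        case (Suc t)
        have "finite {c. S c = Suc t}"
          by (rule finite_subset[of _ "diagram \<alpha>"]) (use filling_pos_iff[OF fS] in fastforce)+
        moreover have "{c. S c = Suc t} \<noteq> {}" using Suc by blast
        ultimately have "card {c. S c = Suc t} \<noteq> 0" by (metis card_0_eq)
        moreover have "card {c. S c = Suc t} = lookup m t"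
          using weight_eq_iff[OF fS, of m] S(2) by blast
        ultimately have "t \<in> keys m" by (simp only: in_keys_iff simp_thms)
        then show ?thesis unfolding fim using Suc by simp
      qed
      then have "\<forall>c. \<exists>x. x \<le> l \<and> f x = S c" by (metis atMost_iff imageE)
      then obtain T where T: "\<And>c. T c \<le> l" "\<And>c. f (T c) = S c" by metis
      then have ST: "S = (\<lambda>c. f (T c))" by auto
      have "ssct \<alpha> T" using relabel[of T, OF T(1)] S(1) ST by blast
      moreover have "weight \<alpha> T = ?e" using w[OF T(1) \<open>ssct \<alpha> T\<close>] S(2) ST by blast
      ultimately show "S \<in> (\<lambda>T c. f (T c)) ` ssct_of \<alpha> ?e" using ST by blast
    qed
  qed
  then show ?thesis by (rule bij_betw_same_card[symmetric])
qed

text \<open>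
  The coefficient of \<open>M\<^sub>\<beta>\<close> in \<open>S\<^sub>\<alpha>\<close>, the counterpart of the Kostka numbers for compositions.
\<close>

definition comp_kostka :: "nat list \<Rightarrow> nat list \<Rightarrow> nat" where
  "comp_kostka \<alpha> \<beta> = card (ssct_of \<alpha> (monomial \<beta>))"

lemma coeff_qschur: "coeff (qschur \<alpha>) m = of_nat (comp_kostka \<alpha> (exponents m))"
  unfolding qschur_def comp_kostka_def coeff_Mpser by (subst card_ssct_exponents) simp

lemma sum_comp_kostka:
  assumes "is_partition lam" "is_composition \<beta>"
  shows "(\<Sum>\<alpha>\<in>rearrangements lam. comp_kostka \<alpha> \<beta>) = kostka (rows lam) \<beta>"
  unfolding comp_kostka_def sum_card_ssct[OF assms(1)] exponents_nth[OF assms(2)] ..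

lemma kostka_underlying:
  "is_partition lam \<Longrightarrow> kostka (rows lam) (underlying \<beta>) = kostka (rows lam) \<beta>"
  by (intro kostka_mset_cong partfun_rows mset_underlying)

lemma comp_kostka_le_kostka:
  assumes "is_composition \<alpha>" "is_composition \<beta>"
  shows "comp_kostka \<alpha> \<beta> \<le> kostka (rows (underlying \<alpha>)) \<beta>"
  unfolding sum_comp_kostka[OF is_partition_underlying[OF assms(1)] assms(2), symmetric]
proof (rule member_le_sum)
  show "\<alpha> \<in> rearrangements (underlying \<alpha>)" using assms(1) by (simp add: rearrangements_def)
qed simp_all

lemma comp_kostka_nonzero_size:
  assumes "is_composition \<alpha>" "is_composition \<beta>" "comp_kostka \<alpha> \<beta> \<noteq> 0"
  shows "sum_list \<alpha> = sum_list \<beta>"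
proof -
  have "kostka (rows (underlying \<alpha>)) \<beta> \<noteq> 0" using comp_kostka_le_kostka[OF assms(1,2)] assms(3) by linarith
  then show ?thesis using kostka_nonzero_size by (metis psize_rows sum_list_underlying)
qed

lemma comp_kostka_diag_pos:
  assumes \<alpha>: "is_composition \<alpha>"
  shows "comp_kostka \<alpha> \<alpha> > 0"
proof -
  define T where "T = (\<lambda>(i, k). if (i, k) \<in> diagram \<alpha> then Suc i else 0)"
  have T: "ssct \<alpha> T"
    unfolding ssct_def by (auto simp: T_def filling_def diagram_def)
  have "card {c. T c = Suc t} = nth_default 0 \<alpha> t" for t
  proof -
    have "{c. T c = Suc t} = Pair t ` {..<nth_default 0 \<alpha> t}"
      by (auto simp: T_def diagram_def nth_default_def image_iff split: if_splits)
    then show ?thesis by (simp add: card_image inj_on_def)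
  qed
  then have "weight \<alpha> T = monomial \<alpha>"
    using weight_eq_iff[of \<alpha> T] T by (simp add: ssct_def nth.rep_eq)
  then have "ssct_of \<alpha> (monomial \<alpha>) \<noteq> {}" using T by blast
  then show ?thesis unfolding comp_kostka_def using finite_ssct[OF \<alpha>] by (simp add: card_gt_0_iff)
qed

text \<open>
  The shapes that rearrange \<open>\<beta>\<close> admit, all together, a single composition tableau of weight \<open>\<beta>\<close>, because the
  diagonal Kostka numbers are 1. The filling of shape \<open>\<beta>\<close> with constant rows is one.
\<close>

lemma comp_kostka_same_underlying:
  assumes \<alpha>: "is_composition \<alpha>" and \<beta>: "is_composition \<beta>" and eq: "underlying \<alpha> = underlying \<beta>"
  shows "comp_kostka \<alpha> \<beta> = (if \<alpha> = \<beta> then 1 else 0)"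
proof -
  let ?R = "rearrangements (underlying \<beta>)"
  have pt: "is_partition (underlying \<beta>)" by (rule is_partition_underlying[OF \<beta>])
  have "(\<Sum>\<gamma>\<in>?R. comp_kostka \<gamma> \<beta>) = 1"
    using kostka_underlying[OF pt] kostka_diag[OF pt] by (simp add: sum_comp_kostka[OF pt \<beta>])
  moreover have \<beta>R: "\<beta> \<in> ?R" using \<beta> by (simp add: rearrangements_def)
  moreover have "(\<Sum>\<gamma>\<in>?R. comp_kostka \<gamma> \<beta>) = comp_kostka \<beta> \<beta> + (\<Sum>\<gamma>\<in>?R - {\<beta>}. comp_kostka \<gamma> \<beta>)"
    by (rule sum.remove) (use \<beta>R in auto)
  ultimately have "comp_kostka \<beta> \<beta> = 1" "(\<Sum>\<gamma>\<in>?R - {\<beta>}. comp_kostka \<gamma> \<beta>) = 0"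
    using comp_kostka_diag_pos[OF \<beta>] by linarith+
  moreover have "\<alpha> \<in> ?R" using \<alpha> eq by (simp add: rearrangements_def)
  ultimately show ?thesis by auto
qed

lemma comp_kostka_triangular:
  assumes "is_composition \<alpha>" "is_composition \<beta>" "\<alpha> \<noteq> \<beta>" "comp_kostka \<alpha> \<beta> \<noteq> 0"
  shows "rank (underlying \<alpha>) < rank (underlying \<beta>)"
proof -
  have pt: "is_partition (underlying \<alpha>)" by (rule is_partition_underlying[OF assms(1)])
  have "kostka (rows (underlying \<alpha>)) (underlying \<beta>) \<noteq> 0"
    using comp_kostka_le_kostka[OF assms(1,2)] assms(4) kostka_underlying[OF pt, of \<beta>] by linarith
  moreover have "underlying \<alpha> \<noteq> underlying \<beta>"
    using comp_kostka_same_underlying[OF assms(1,2)] assms(3,4) by auto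
  ultimately show ?thesis
    using kostka_triangular[OF pt] is_partition_underlying[OF assms(2)] by (simp add: is_partition_def)
qed

definition comp_kostka_inv :: "nat \<Rightarrow> nat list \<Rightarrow> nat list \<Rightarrow> rat" where
  "comp_kostka_inv n = (SOME B. inverse_on (comps n) (\<lambda>\<alpha> \<beta>. of_nat (comp_kostka \<alpha> \<beta>)) B)"

definition kostka_inv :: "nat \<Rightarrow> nat list \<Rightarrow> nat list \<Rightarrow> rat" where
  "kostka_inv n = (SOME B. inverse_on (parts n) (\<lambda>l m. of_nat (kostka (rows l) m)) B)"

lemma inverse_comp_kostka: "inverse_on (comps n) (\<lambda>\<alpha> \<beta>. of_nat (comp_kostka \<alpha> \<beta>)) (comp_kostka_inv n)"
proof -
  have "\<exists>B. inverse_on (comps n) (\<lambda>\<alpha> \<beta>. rat_of_nat (comp_kostka \<alpha> \<beta>)) B"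
  proof (rule unitriangular_inverse[where r = "\<lambda>\<alpha>. int (rank (underlying \<alpha>))"])
    show "rat_of_nat (comp_kostka \<alpha> \<alpha>) = 1" if "\<alpha> \<in> comps n" for \<alpha>
      using that comp_kostka_same_underlying[of \<alpha> \<alpha>] by (simp add: comps_def)
    show "int (rank (underlying \<alpha>)) < int (rank (underlying \<beta>))"
      if "\<alpha> \<in> comps n" "\<beta> \<in> comps n" "\<alpha> \<noteq> \<beta>" "rat_of_nat (comp_kostka \<alpha> \<beta>) \<noteq> 0" for \<alpha> \<beta>
      using comp_kostka_triangular[of \<alpha> \<beta>] that by (simp add: comps_def)
  qed simp
  then show ?thesis unfolding comp_kostka_inv_def by (rule someI_ex)
qed

lemma inverse_kostka: "inverse_on (parts n) (\<lambda>l m. of_nat (kostka (rows l) m)) (kostka_inv n)"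
proof -
  have "\<exists>B. inverse_on (parts n) (\<lambda>l m. rat_of_nat (kostka (rows l) m)) B"
  proof (rule unitriangular_inverse[where r = "\<lambda>l. int (rank l)"])
    show "rat_of_nat (kostka (rows l) l) = 1" if "l \<in> parts n" for l
      using that kostka_diag by (simp add: parts_def)
    show "int (rank l) < int (rank m)"
      if "l \<in> parts n" "m \<in> parts n" "l \<noteq> m" "rat_of_nat (kostka (rows l) m) \<noteq> 0" for l m
      using kostka_triangular[of l m] that by (simp add: parts_def is_partition_def)
  qed simp
  then show ?thesis unfolding kostka_inv_def by (rule someI_ex)
qed

section \<open>Bases of symmetric and quasisymmetric functions\<close>

lemma coeff_mscale [simp]: "coeff (mscale c f) m = c * coeff f m"
  by (simp add: mscale.rep_eq)

lemma coeff_plus [simp]: "coeff (f + g) m = coeff f m + coeff g m"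
  by (simp add: plus_mpser.rep_eq)

lemma coeff_zero [simp]: "coeff 0 m = 0"
  by (simp add: zero_mpser.rep_eq)

lemma coeff_msym: "coeff (msym l) m = (if underlying (exponents m) = l then 1 else 0)"
  by (simp add: msym_def)

lemma coeff_mqsym: "coeff (mqsym \<alpha>) m = (if exponents m = \<alpha> then 1 else 0)"
  by (simp add: mqsym_def)

lemma bounded_degree_sum_eq:
  assumes "\<And>m. coeff f m \<noteq> 0 \<Longrightarrow> mdeg m = n"
  shows "bounded_degree f"
  unfolding bounded_degree_def using assms by (metis order_refl)

lemma bounded_degree_plus:
  assumes "bounded_degree f" "bounded_degree g"
  shows "bounded_degree (f + g)"
proof -
  obtain a b where a: "\<And>m. coeff f m \<noteq> 0 \<Longrightarrow> mdeg m \<le> a" and b: "\<And>m. coeff g m \<noteq> 0 \<Longrightarrow> mdeg m \<le> b"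
    using assms unfolding bounded_degree_def by metis
  have "mdeg m \<le> max a b" if "coeff (f + g) m \<noteq> 0" for m
  proof -
    have "coeff f m \<noteq> 0 \<or> coeff g m \<noteq> 0" using that by auto
    then show ?thesis using a[of m] b[of m] by (auto simp: max_def)
  qed
  then show ?thesis unfolding bounded_degree_def by blast
qed

lemma bounded_degree_mscale: "bounded_degree f \<Longrightarrow> bounded_degree (mscale c f)"
  unfolding bounded_degree_def by auto

lemma bounded_degree_0: "bounded_degree 0"
  unfolding bounded_degree_def by simp

lemma subspace_QSym: "ser.subspace QSym"
  unfolding ser.subspace_def
proof (intro conjI ballI allI)
  show "0 \<in> QSym" by (simp add: QSym_def bounded_degree_0)
  show "f + g \<in> QSym" if "f \<in> QSym" "g \<in> QSym" for f g
    using that unfolding QSym_def mem_Collect_eq coeff_plus by (metis bounded_degree_plus)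
  show "mscale c f \<in> QSym" if "f \<in> QSym" for c f
    using that unfolding QSym_def mem_Collect_eq coeff_mscale by (metis bounded_degree_mscale)
qed

lemma subspace_Sym: "ser.subspace Sym"
  unfolding ser.subspace_def
proof (intro conjI ballI allI)
  show "0 \<in> Sym" by (simp add: Sym_def bounded_degree_0)
  show "f + g \<in> Sym" if "f \<in> Sym" "g \<in> Sym" for f g
    using that unfolding Sym_def mem_Collect_eq coeff_plus by (simp add: bounded_degree_plus)
  show "mscale c f \<in> Sym" if "f \<in> Sym" for c f
    using that unfolding Sym_def mem_Collect_eq coeff_mscale by (simp add: bounded_degree_mscale)
qed

lemma mset_exponents: "mset (exponents m) = image_mset (lookup m) (mset_set (keys m))"
  by (simp add: exponents_def flip: sorted_list_of_mset_set)

lemma mset_exponents_map_key: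
  assumes "bij \<pi>"
  shows "mset (exponents (Poly_Mapping.map_key \<pi> m)) = mset (exponents m)"
proof -
  have inj: "inj \<pi>" and surj: "surj \<pi>" using assms by (auto simp: bij_def)
  let ?K = "keys m"
  have lk: "lookup (Poly_Mapping.map_key \<pi> m) = lookup m \<circ> \<pi>"
    using inj by (simp add: map_key.rep_eq)
  have "mset (exponents (Poly_Mapping.map_key \<pi> m))
      = image_mset (lookup m) (image_mset \<pi> (mset_set (\<pi> -` ?K)))"
    unfolding mset_exponents keys_map_key[OF inj] lk by (simp add: multiset.map_comp)
  also have "image_mset \<pi> (mset_set (\<pi> -` ?K)) = mset_set (\<pi> ` (\<pi> -` ?K))"
    by (rule image_mset_mset_set) (rule inj_on_subset[OF inj], simp)
  also have "\<pi> ` (\<pi> -` ?K) = ?K" using surj by (rule surj_image_vimage_eq)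
  finally show ?thesis by (simp add: mset_exponents)
qed

lemma mset_eq_filter_replicate:
  "mset l = mset (filter (\<lambda>x. x \<noteq> 0) l) + replicate_mset (length l - length (filter (\<lambda>x. x \<noteq> 0) l)) (0::nat)"
proof (induction l)
  case (Cons a l)
  have "length (filter (\<lambda>x. x \<noteq> 0) l) \<le> length l" by (rule length_filter_le)
  then show ?case using Cons by (auto simp: Suc_diff_le)
qed simp

lemma mset_eq_if_filter_nonzero_eq:
  fixes l l' :: "nat list"
  assumes "length l = length l'" "mset (filter (\<lambda>x. x \<noteq> 0) l) = mset (filter (\<lambda>x. x \<noteq> 0) l')"
  shows "mset l = mset l'"
  using mset_eq_filter_replicate[of l] mset_eq_filter_replicate[of l'] assms(1,2) mset_eq_length[OF assms(2)]
  by metis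

text \<open>
  Padded with zeros to a common length, the two exponent lists have the same multiset of entries, hence
  differ by a permutation of the variables.
\<close>

lemma Sym_coeff_eq:
  assumes f: "f \<in> Sym" and eq: "underlying (exponents m) = underlying (exponents m')"
  shows "coeff f m = coeff f m'"
proof -
  obtain N1 N2 where N1: "keys m \<subseteq> {..<N1}" and N2: "keys m' \<subseteq> {..<N2}"
    using keys_bounded[of m] keys_bounded[of m'] by auto
  define N where "N = max N1 N2"
  have N: "keys m \<subseteq> {..<N}" "keys m' \<subseteq> {..<N}"
    using N1 N2 by (auto simp: N_def)
  have me: "mset (exponents m) = mset (exponents m')" using eq by (simp add: underlying_eq_iff)
  have "mset (expvec m N) = mset (expvec m' N)"
  proof (rule mset_eq_if_filter_nonzero_eq)
    show "mset (filter (\<lambda>x. x \<noteq> 0) (expvec m N)) = mset (filter (\<lambda>x. x \<noteq> 0) (expvec m' N))"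
      using me unfolding exponents_eq_filter[OF N(1)] exponents_eq_filter[OF N(2)] .
  qed simp
  then obtain p where p: "p permutes {..<length (expvec m' N)}" "permute_list p (expvec m' N) = expvec m N"
    by (rule mset_eq_permutation)
  then have pN: "p permutes {..<N}" by simp
  have bij: "bij p" by (rule permutes_bij[OF p(1)])
  have "lookup m' (p i) = lookup m i" for i
  proof (cases "i < N")
    case True
    have "permute_list p (expvec m' N) ! i = expvec m' N ! p i"
      by (rule permute_list_nth[OF p(1)]) (use True in simp)
    moreover have "p i < N" using permutes_in_image[OF pN, of i] True by simp
    ultimately show ?thesis using True p(2) by simp
  next
    case False
    then have "p i = i" using permutes_not_in[OF pN, of i] by simp
    moreover have "lookup m i = 0" "lookup m' i = 0"
      using False N by (metis in_keys_iff lessThan_iff subsetD)+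
    ultimately show ?thesis by simp
  qed
  then have "Poly_Mapping.map_key p m' = m"
    using bij by (intro poly_mapping_eqI) (simp add: map_key.rep_eq bij_def)
  then show ?thesis using f bij unfolding Sym_def by blast
qed

lemma mdeg_underlying: "mdeg m = sum_list (underlying (exponents m))"
  by (simp add: mdeg_eq_exponents sum_list_underlying)

lemma msym_in_Sym: "msym l \<in> Sym"
  unfolding Sym_def
proof (intro CollectI conjI allI impI)
  show "bounded_degree (msym l)"
    by (rule bounded_degree_sum_eq[of _ "sum_list l"]) (auto simp: coeff_msym mdeg_underlying split: if_splits)
  fix \<pi> :: "nat \<Rightarrow> nat" and m assume "bij \<pi>"
  then have "underlying (exponents (Poly_Mapping.map_key \<pi> m)) = underlying (exponents m)"
    by (simp add: underlying_eq_iff mset_exponents_map_key)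
  then show "coeff (msym l) (Poly_Mapping.map_key \<pi> m) = coeff (msym l) m"
    by (simp add: coeff_msym)
qed

lemma mqsym_in_QSym: "mqsym \<alpha> \<in> QSym"
  unfolding QSym_def
  by (auto simp: coeff_mqsym mdeg_eq_exponents intro!: bounded_degree_sum_eq[of _ "sum_list \<alpha>"] split: if_splits)

lemma Sym_subset_QSym: "Sym \<subseteq> QSym"
proof
  fix f assume f: "f \<in> Sym"
  have "coeff f m = coeff f m'" if "exponents m = exponents m'" for m m'
    by (rule Sym_coeff_eq[OF f]) (simp only: that)
  moreover have "bounded_degree f" using f unfolding Sym_def by blast
  ultimately show "f \<in> QSym" unfolding QSym_def by blast
qed

lemma underlying_in_parts: "is_composition \<alpha> \<Longrightarrow> underlying \<alpha> \<in> parts (sum_list \<alpha>)"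
  by (simp add: parts_def is_partition_underlying sum_list_underlying)

lemma underlying_exponents_nth: "is_partition l \<Longrightarrow> underlying (exponents (monomial l)) = l"
  by (simp add: exponents_nth is_partition_def underlying_partition)

text \<open>
  Both monomial bases consist of the indicator series of the fibres of a map on monomials: of \<open>exponents\<close> for
  the quasisymmetric, and of the underlying partition of \<open>exponents\<close> for the symmetric functions.
\<close>

lemma expand_by_key:
  assumes fin: "finite P" and basis: "\<And>l m. coeff (b l) m = (if u m = l then 1 else 0)"
    and const: "\<And>m. u m \<in> P \<Longrightarrow> c (u m) = coeff f m" and supp: "\<And>m. coeff f m \<noteq> 0 \<Longrightarrow> u m \<in> P"
  shows "f = (\<Sum>l\<in>P. mscale (c l) (b l))"
proof (rule mpser_eqI)
  fix m
  have "coeff (\<Sum>l\<in>P. mscale (c l) (b l)) m = (\<Sum>l\<in>P. if l = u m then c l else 0)"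
    unfolding coeff_sum by (rule sum.cong) (auto simp: basis)
  also have "\<dots> = (if u m \<in> P then c (u m) else 0)" using fin by simp
  also have "\<dots> = coeff f m" using const supp by auto
  finally show "coeff f m = coeff (\<Sum>l\<in>P. mscale (c l) (b l)) m" ..
qed

lemma underlying_exponents_in_parts: "underlying (exponents m) \<in> parts (mdeg m)"
  using underlying_in_parts[OF is_composition_exponents, of m] by (simp add: mdeg_eq_exponents)

lemma exponents_in_comps: "exponents m \<in> comps (mdeg m)"
  by (simp add: comps_def mdeg_eq_exponents is_composition_exponents)

lemma Sym_expand:
  assumes f: "f \<in> Sym" and n: "\<And>m. coeff f m \<noteq> 0 \<Longrightarrow> mdeg m \<le> n"
  shows "f = (\<Sum>l\<in>(\<Union>k\<le>n. parts k). mscale (coeff f (monomial l)) (msym l))"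
proof (rule expand_by_key[OF _ coeff_msym])
  fix m
  have "is_partition (underlying (exponents m))"
    using underlying_exponents_in_parts[of m] by (simp add: parts_def)
  then show "coeff f (monomial (underlying (exponents m))) = coeff f m"
    by (intro Sym_coeff_eq[OF f] underlying_exponents_nth)
  show "underlying (exponents m) \<in> (\<Union>k\<le>n. parts k)" if "coeff f m \<noteq> 0"
    using n[OF that] underlying_exponents_in_parts[of m] by blast
qed simp

lemma QSym_expand:
  assumes f: "f \<in> QSym" and n: "\<And>m. coeff f m \<noteq> 0 \<Longrightarrow> mdeg m \<le> n"
  shows "f = (\<Sum>\<alpha>\<in>(\<Union>k\<le>n. comps k). mscale (coeff f (monomial \<alpha>)) (mqsym \<alpha>))"
proof (rule expand_by_key[OF _ coeff_mqsym])
  fix m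
  show "coeff f (monomial (exponents m)) = coeff f m"
    using f exponents_nth[OF is_composition_exponents, of m] unfolding QSym_def by blast
  show "exponents m \<in> (\<Union>k\<le>n. comps k)" if "coeff f m \<noteq> 0"
    using n[OF that] exponents_in_comps[of m] by blast
qed simp

lemma Sym_degree: "f \<in> Sym \<Longrightarrow> \<exists>n. \<forall>m. coeff f m \<noteq> 0 \<longrightarrow> mdeg m \<le> n"
  unfolding Sym_def bounded_degree_def by blast

lemma QSym_degree: "f \<in> QSym \<Longrightarrow> \<exists>n. \<forall>m. coeff f m \<noteq> 0 \<longrightarrow> mdeg m \<le> n"
  unfolding QSym_def bounded_degree_def by blast

lemma Sym_subset_span_msym: "Sym \<subseteq> ser.span (msym ` Collect is_partition)"
proof
  fix f assume f: "f \<in> Sym"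
  obtain n where "\<forall>m. coeff f m \<noteq> 0 \<longrightarrow> mdeg m \<le> n" using Sym_degree[OF f] ..
  then have "f = (\<Sum>l\<in>(\<Union>k\<le>n. parts k). mscale (coeff f (monomial l)) (msym l))"
    using Sym_expand[OF f] by blast
  moreover have "\<dots> \<in> ser.span (msym ` Collect is_partition)"
    by (intro ser.span_sum ser.span_scale ser.span_base) (auto simp: parts_def)
  ultimately show "f \<in> ser.span (msym ` Collect is_partition)" by metis
qed

lemma QSym_subset_span_mqsym: "QSym \<subseteq> ser.span (mqsym ` Collect is_composition)"
proof
  fix f assume f: "f \<in> QSym"
  obtain n where "\<forall>m. coeff f m \<noteq> 0 \<longrightarrow> mdeg m \<le> n" using QSym_degree[OF f] ..
  then have "f = (\<Sum>l\<in>(\<Union>k\<le>n. comps k). mscale (coeff f (monomial l)) (mqsym l))"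
    using QSym_expand[OF f] by blast
  moreover have "\<dots> \<in> ser.span (mqsym ` Collect is_composition)"
    by (intro ser.span_sum ser.span_scale ser.span_base) (auto simp: comps_def)
  ultimately show "f \<in> ser.span (mqsym ` Collect is_composition)" by metis
qed

lemma (in vector_space) inverse_on_expand:
  assumes inv: "inverse_on I A B" and fin: "finite I" and v: "\<And>i. i \<in> I \<Longrightarrow> v i = (\<Sum>j\<in>I. scale (A i j) (u j))"
    and i: "i \<in> I"
  shows "u i = (\<Sum>j\<in>I. scale (B i j) (v j))"
proof -
  have "(\<Sum>j\<in>I. scale (B i j) (v j)) = (\<Sum>j\<in>I. \<Sum>k\<in>I. scale (B i j * A j k) (u k))"
    by (rule sum.cong) (simp_all add: v scale_sum_right)
  also have "\<dots> = (\<Sum>k\<in>I. \<Sum>j\<in>I. scale (B i j * A j k) (u k))" by (rule sum.swap)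
  also have "\<dots> = (\<Sum>k\<in>I. scale (\<Sum>j\<in>I. B i j * A j k) (u k))" by (simp add: scale_sum_left)
  also have "\<dots> = (\<Sum>k\<in>I. if k = i then u k else 0)"
    using inv i unfolding inverse_on_def by (intro sum.cong) auto
  also have "\<dots> = u i" using fin i by simp
  finally show ?thesis ..
qed

text \<open>
  Needed because the Kostka matrix expands \<open>s\<close> in \<open>m\<close>, but its transpose expands \<open>h\<close> in \<open>s\<close>.
\<close>

lemma inverse_on_transpose:
  "inverse_on I A B \<Longrightarrow> inverse_on I (\<lambda>i j. A j i) (\<lambda>i j. B j i)"
  unfolding inverse_on_def by (auto simp: mult.commute)

lemma kostka_parts_zero:
  "kostka (rows l) bs = 0" if "sum_list l \<noteq> sum_list bs"
  using kostka_nonzero_size[of "rows l" bs] that by (auto simp: psize_rows)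

lemma coeff_schur: "is_partition l \<Longrightarrow> coeff (schur l) m = of_nat (kostka (rows l) (exponents m))"
  by (simp add: schur_eq_kostka_series coeff_kostka_series)

lemma schur_eq_sum_msym:
  assumes l: "l \<in> parts n"
  shows "schur l = (\<Sum>\<mu>\<in>parts n. mscale (of_nat (kostka (rows l) \<mu>)) (msym \<mu>))"
proof (rule expand_by_key[OF finite_parts coeff_msym])
  fix m
  have pl: "is_partition l" "sum_list l = n" using l by (auto simp: parts_def)
  show "of_nat (kostka (rows l) (underlying (exponents m))) = coeff (schur l) m"
    by (simp add: coeff_schur pl kostka_underlying)
  show "underlying (exponents m) \<in> parts n" if "coeff (schur l) m \<noteq> 0"
  proof -
    have "kostka (rows l) (exponents m) \<noteq> 0" using that by (simp add: coeff_schur pl)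
    then have "mdeg m = n" using kostka_parts_zero[of l "exponents m"] pl(2) mdeg_eq_exponents[of m] by metis
    then show ?thesis using underlying_exponents_in_parts[of m] by simp
  qed
qed

lemma hsym_eq_sum_schur:
  "hsym as = (\<Sum>l\<in>parts (sum_list as). mscale (of_nat (kostka (rows l) as)) (schur l))"
proof -
  have "hsym as = (\<Sum>l\<in>parts (sum_list as). mscale (of_nat (kostka (rows l) as)) (kostka_series (rows l)))"
    unfolding hsym_eq_sum_kostka_series by (rule sum.reindex_bij_betw[OF bij_betw_rows, symmetric])
  also have "\<dots> = (\<Sum>l\<in>parts (sum_list as). mscale (of_nat (kostka (rows l) as)) (schur l))"
    by (rule sum.cong) (auto simp: parts_def schur_eq_kostka_series)
  finally show ?thesis .
qed

lemma hsym_eq_sum_schur_parts: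
  "\<mu> \<in> parts n \<Longrightarrow> hsym \<mu> = (\<Sum>l\<in>parts n. mscale (of_nat (kostka (rows l) \<mu>)) (schur l))"
  using hsym_eq_sum_schur[of \<mu>] by (simp add: parts_def)

lemma msym_eq_sum_schur:
  "\<mu> \<in> parts n \<Longrightarrow> msym \<mu> = (\<Sum>l\<in>parts n. mscale (kostka_inv n \<mu> l) (schur l))"
  by (rule ser.inverse_on_expand[OF inverse_kostka finite_parts schur_eq_sum_msym])

lemma schur_eq_sum_hsym:
  "l \<in> parts n \<Longrightarrow> schur l = (\<Sum>\<mu>\<in>parts n. mscale (kostka_inv n \<mu> l) (hsym \<mu>))"
  by (rule ser.inverse_on_expand[OF inverse_on_transpose[OF inverse_kostka] finite_parts hsym_eq_sum_schur_parts])

lemma schur_in_Sym: "is_partition l \<Longrightarrow> schur l \<in> Sym"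
  by (subst schur_eq_sum_msym[of l "sum_list l"])
     (auto simp: parts_def intro!: ser.subspace_sum[OF subspace_Sym] ser.subspace_scale[OF subspace_Sym] msym_in_Sym)

lemma hsym_in_Sym: "hsym as \<in> Sym"
  by (subst hsym_eq_sum_schur)
     (auto simp: parts_def intro!: ser.subspace_sum[OF subspace_Sym] ser.subspace_scale[OF subspace_Sym] schur_in_Sym)

lemma Sym_subset_span_schur: "Sym \<subseteq> ser.span (schur ` Collect is_partition)"
proof -
  have "msym \<mu> \<in> ser.span (schur ` Collect is_partition)" if "is_partition \<mu>" for \<mu>
  proof (subst msym_eq_sum_schur[of \<mu> "sum_list \<mu>"])
    show "\<mu> \<in> parts (sum_list \<mu>)" using that by (simp add: parts_def)
    show "(\<Sum>l\<in>parts (sum_list \<mu>). mscale (kostka_inv (sum_list \<mu>) \<mu> l) (schur l))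
        \<in> ser.span (schur ` Collect is_partition)"
      by (intro ser.span_sum ser.span_scale ser.span_base) (auto simp: parts_def)
  qed
  then have "ser.span (msym ` Collect is_partition) \<subseteq> ser.span (schur ` Collect is_partition)"
    by (intro ser.span_minimal ser.subspace_span) auto
  then show ?thesis using Sym_subset_span_msym by blast
qed

lemma Sym_subset_span_hsym: "Sym \<subseteq> ser.span (hsym ` Collect is_partition)"
proof -
  have "schur l \<in> ser.span (hsym ` Collect is_partition)" if "is_partition l" for l
  proof (subst schur_eq_sum_hsym[of l "sum_list l"])
    show "l \<in> parts (sum_list l)" using that by (simp add: parts_def)
    show "(\<Sum>\<mu>\<in>parts (sum_list l). mscale (kostka_inv (sum_list l) \<mu> l) (hsym \<mu>))
        \<in> ser.span (hsym ` Collect is_partition)"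
      by (intro ser.span_sum ser.span_scale ser.span_base) (auto simp: parts_def)
  qed
  then have "ser.span (schur ` Collect is_partition) \<subseteq> ser.span (hsym ` Collect is_partition)"
    by (intro ser.span_minimal ser.subspace_span) auto
  then show ?thesis using Sym_subset_span_schur by blast
qed

text \<open>
  The coordinate functionals of the bases \<open>s\<close> and \<open>h\<close>, obtained from those of \<open>m\<close> by inverting \<open>s = K m\<close> and
  \<open>h = K\<^sup>T s\<close>.
\<close>

definition schur_coord :: "nat list \<Rightarrow> mpser \<Rightarrow> rat" where
  "schur_coord l v = (\<Sum>\<mu>\<in>parts (sum_list l). coeff v (monomial \<mu>) * kostka_inv (sum_list l) \<mu> l)"

definition hsym_coord :: "nat list \<Rightarrow> mpser \<Rightarrow> rat" where
  "hsym_coord \<mu> v = (\<Sum>l\<in>parts (sum_list \<mu>). kostka_inv (sum_list \<mu>) \<mu> l * schur_coord l v)"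

lemma schur_coord_add: "schur_coord l (v + w) = schur_coord l v + schur_coord l w"
  and schur_coord_scale: "schur_coord l (mscale c v) = c * schur_coord l v"
  by (simp_all add: schur_coord_def distrib_right sum.distrib sum_distrib_left mult.assoc)

lemma hsym_coord_add: "hsym_coord l (v + w) = hsym_coord l v + hsym_coord l w"
  and hsym_coord_scale: "hsym_coord l (mscale c v) = c * hsym_coord l v"
  by (simp_all add: hsym_coord_def schur_coord_add schur_coord_scale distrib_left sum.distrib sum_distrib_left mult_ac)

lemma schur_coord_schur:
  assumes "is_partition l" "is_partition l'"
  shows "schur_coord l (schur l') = (if l = l' then 1 else 0)"
proof -
  let ?n = "sum_list l"
  have c: "coeff (schur l') (monomial \<mu>) = of_nat (kostka (rows l') \<mu>)" if "\<mu> \<in> parts ?n" for \<mu>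
    using that assms(2) by (simp add: coeff_schur exponents_nth parts_def is_partition_def)
  then have s: "schur_coord l (schur l') = (\<Sum>\<mu>\<in>parts ?n. of_nat (kostka (rows l') \<mu>) * kostka_inv ?n \<mu> l)"
    by (simp add: schur_coord_def)
  show ?thesis
  proof (cases "sum_list l' = ?n")
    case True
    then have "l \<in> parts ?n" "l' \<in> parts ?n" using assms by (auto simp: parts_def)
    then show ?thesis using inverse_kostka[of ?n] unfolding s inverse_on_def by auto
  next
    case False
    then have "of_nat (kostka (rows l') \<mu>) = (0::rat)" if "\<mu> \<in> parts ?n" for \<mu>
      using kostka_parts_zero[of l' \<mu>] that by (simp add: parts_def)
    then show ?thesis using False unfolding s by auto
  qed
qed

lemma hsym_coord_hsym:
  assumes "is_partition \<mu>" "is_partition \<mu>'"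
  shows "hsym_coord \<mu> (hsym \<mu>') = (if \<mu> = \<mu>' then 1 else 0)"
proof -
  let ?n = "sum_list \<mu>"
  have c: "schur_coord l (hsym \<mu>') = of_nat (kostka (rows l) \<mu>')" if "l \<in> parts ?n" for l
  proof -
    have "schur_coord l (hsym \<mu>') = (\<Sum>l'\<in>parts (sum_list \<mu>'). of_nat (kostka (rows l') \<mu>') * schur_coord l (schur l'))"
      unfolding hsym_eq_sum_schur by (rule ser.coordinate_sum[OF schur_coord_add schur_coord_scale])
    also have "\<dots> = (\<Sum>l'\<in>parts (sum_list \<mu>'). if l' = l then of_nat (kostka (rows l') \<mu>') else 0)"
      by (rule sum.cong) (use that in \<open>auto simp: schur_coord_schur parts_def\<close>)
    also have "\<dots> = (if l \<in> parts (sum_list \<mu>') then of_nat (kostka (rows l) \<mu>') else 0)" by simp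
    also have "\<dots> = of_nat (kostka (rows l) \<mu>')"
      using that kostka_parts_zero[of l \<mu>'] by (auto simp: parts_def)
    finally show ?thesis .
  qed
  then have s: "hsym_coord \<mu> (hsym \<mu>') = (\<Sum>l\<in>parts ?n. kostka_inv ?n \<mu> l * of_nat (kostka (rows l) \<mu>'))"
    by (simp add: hsym_coord_def)
  show ?thesis
  proof (cases "sum_list \<mu>' = ?n")
    case True
    then have "\<mu> \<in> parts ?n" "\<mu>' \<in> parts ?n" using assms by (auto simp: parts_def)
    then show ?thesis using inverse_kostka[of ?n] unfolding s inverse_on_def by auto
  next
    case False
    then have "of_nat (kostka (rows l) \<mu>') = (0::rat)" if "l \<in> parts ?n" for l
      using kostka_parts_zero[of l \<mu>'] that by (simp add: parts_def)
    then show ?thesis using False unfolding s by auto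
  qed
qed

lemma representation_schur:
  "v \<in> Sym \<Longrightarrow> is_partition l \<Longrightarrow>
     ser.representation (schur ` Collect is_partition) v (schur l) = schur_coord l v"
  using Sym_subset_span_schur
  by (intro ser.representation_coordinates schur_coord_add schur_coord_scale)
     (auto simp: schur_coord_schur)

lemma representation_hsym:
  "v \<in> Sym \<Longrightarrow> is_partition l \<Longrightarrow>
     ser.representation (hsym ` Collect is_partition) v (hsym l) = hsym_coord l v"
  using Sym_subset_span_hsym
  by (intro ser.representation_coordinates hsym_coord_add hsym_coord_scale)
     (auto simp: hsym_coord_hsym)

lemma representation_msym:
  "v \<in> Sym \<Longrightarrow> is_partition l \<Longrightarrow>
     ser.representation (msym ` Collect is_partition) v (msym l) = coeff v (monomial l)"
  using Sym_subset_span_msym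
  by (intro ser.representation_coordinates[where \<phi> = "\<lambda>l v. coeff v (monomial l)"])
     (auto simp: coeff_msym underlying_exponents_nth)

lemma representation_mqsym:
  "v \<in> QSym \<Longrightarrow> is_composition \<alpha> \<Longrightarrow>
     ser.representation (mqsym ` Collect is_composition) v (mqsym \<alpha>) = coeff v (monomial \<alpha>)"
  using QSym_subset_span_mqsym
  by (intro ser.representation_coordinates[where \<phi> = "\<lambda>l v. coeff v (monomial l)"])
     (auto simp: coeff_mqsym exponents_nth)

lemma Sym_eqI_hsym_coord:
  assumes "v \<in> Sym" "w \<in> Sym" "\<And>l. is_partition l \<Longrightarrow> hsym_coord l v = hsym_coord l w"
  shows "v = w"
proof -
  let ?B = "hsym ` Collect is_partition"
  have ind: "ser.independent ?B"
    by (rule ser.independent_coordinates[where \<phi> = hsym_coord])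
       (auto simp: hsym_coord_hsym hsym_coord_add hsym_coord_scale)
  have sp: "v \<in> ser.span ?B" "w \<in> ser.span ?B" using assms Sym_subset_span_hsym by auto
  have "ser.representation ?B v b = ser.representation ?B w b" for b
  proof (cases "b \<in> ?B")
    case True
    then show ?thesis using representation_hsym assms by auto
  next
    case False
    then show ?thesis using ser.representation_ne_zero by metis
  qed
  then have eq: "ser.representation ?B v = ser.representation ?B w" by (rule ext)
  have "v = (\<Sum>b | ser.representation ?B v b \<noteq> 0. mscale (ser.representation ?B v b) b)"
    by (rule ser.sum_nonzero_representation_eq[OF ind sp(1), symmetric])
  also have "\<dots> = w" unfolding eq by (rule ser.sum_nonzero_representation_eq[OF ind sp(2)])
  finally show ?thesis .
qed

lemma qschur_eq_sum_mqsym: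
  assumes \<alpha>: "\<alpha> \<in> comps n"
  shows "qschur \<alpha> = (\<Sum>\<beta>\<in>comps n. mscale (of_nat (comp_kostka \<alpha> \<beta>)) (mqsym \<beta>))"
proof (rule expand_by_key[OF finite_comps coeff_mqsym])
  fix m
  show "of_nat (comp_kostka \<alpha> (exponents m)) = coeff (qschur \<alpha>) m" by (simp add: coeff_qschur)
  show "exponents m \<in> comps n" if "coeff (qschur \<alpha>) m \<noteq> 0"
    using that comp_kostka_nonzero_size[of \<alpha> "exponents m"] \<alpha> is_composition_exponents[of m]
    by (simp add: coeff_qschur comps_def)
qed

lemma mqsym_eq_sum_qschur:
  "\<beta> \<in> comps n \<Longrightarrow> mqsym \<beta> = (\<Sum>\<alpha>\<in>comps n. mscale (comp_kostka_inv n \<beta> \<alpha>) (qschur \<alpha>))"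
  by (rule ser.inverse_on_expand[OF inverse_comp_kostka finite_comps qschur_eq_sum_mqsym])

lemma qschur_in_QSym: "is_composition \<alpha> \<Longrightarrow> qschur \<alpha> \<in> QSym"
  by (subst qschur_eq_sum_mqsym[of \<alpha> "sum_list \<alpha>"])
     (auto simp: comps_def intro!: ser.subspace_sum[OF subspace_QSym] ser.subspace_scale[OF subspace_QSym] mqsym_in_QSym)

lemma schur_eq_sum_qschur:
  assumes "is_partition l"
  shows "schur l = (\<Sum>\<alpha>\<in>rearrangements l. qschur \<alpha>)"
proof (rule mpser_eqI)
  fix m
  have "(\<Sum>\<alpha>\<in>rearrangements l. comp_kostka \<alpha> (exponents m)) = kostka (rows l) (exponents m)"
    by (rule sum_comp_kostka[OF assms is_composition_exponents])
  then show "coeff (schur l) m = coeff (\<Sum>\<alpha>\<in>rearrangements l. qschur \<alpha>) m"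
    using assms by (simp add: coeff_schur coeff_sum coeff_qschur flip: of_nat_sum)
qed

lemma msym_eq_sum_mqsym:
  "msym l = (\<Sum>\<alpha>\<in>rearrangements l. mqsym \<alpha>)"
proof (rule mpser_eqI)
  fix m
  have "coeff (\<Sum>\<alpha>\<in>rearrangements l. mqsym \<alpha>) m = (\<Sum>\<alpha>\<in>rearrangements l. if \<alpha> = exponents m then 1 else 0)"
    unfolding coeff_sum by (rule sum.cong) (auto simp: coeff_mqsym)
  also have "\<dots> = (if exponents m \<in> rearrangements l then 1 else 0)" by simp
  also have "\<dots> = coeff (msym l) m"
    by (simp add: coeff_msym rearrangements_def is_composition_exponents)
  finally show "coeff (msym l) m = coeff (\<Sum>\<alpha>\<in>rearrangements l. mqsym \<alpha>) m" ..
qed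

section \<open>Functionals on quasisymmetric functions\<close>

definition qlinear :: "(mpser \<Rightarrow> rat) \<Rightarrow> bool" where
  "qlinear f \<longleftrightarrow> (\<forall>p\<in>QSym. \<forall>q\<in>QSym. f (p + q) = f p + f q) \<and> (\<forall>c. \<forall>q\<in>QSym. f (mscale c q) = c * f q)"

lemma NSym_qlinear: "f \<in> NSym \<Longrightarrow> qlinear f"
  by (simp add: NSym_def qlinear_def)

lemma qlinear_sum:
  assumes f: "qlinear f" and v: "\<And>i. i \<in> A \<Longrightarrow> v i \<in> QSym"
  shows "f (\<Sum>i\<in>A. mscale (c i) (v i)) = (\<Sum>i\<in>A. c i * f (v i))"
proof -
  have scale: "f (mscale d q) = d * f q" if "q \<in> QSym" for d q using f that by (simp add: qlinear_def)
  have z: "(0::mpser) \<in> QSym" using subspace_QSym by (rule ser.subspace_0)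
  have f0: "f 0 = 0" using scale[OF z, of 0] by simp
  show ?thesis using v
  proof (induction A rule: infinite_finite_induct)
    case (insert x A)
    have "mscale (c x) (v x) \<in> QSym" using insert.prems by (intro ser.subspace_scale[OF subspace_QSym]) simp
    moreover have "(\<Sum>i\<in>A. mscale (c i) (v i)) \<in> QSym"
      using insert.prems by (intro ser.subspace_sum[OF subspace_QSym] ser.subspace_scale[OF subspace_QSym]) simp
    ultimately show ?case using f scale insert by (simp add: qlinear_def)
  qed (simp_all add: f0)
qed

lemma NSym_eqI:
  assumes f: "f \<in> NSym" and g: "g \<in> NSym" and eq: "\<And>\<gamma>. is_composition \<gamma> \<Longrightarrow> f (qschur \<gamma>) = g (qschur \<gamma>)"
  shows "f = g"
proof
  fix q
  have M: "f (mqsym \<beta>) = g (mqsym \<beta>)" if "is_composition \<beta>" for \<beta>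
  proof -
    have b: "\<beta> \<in> comps (sum_list \<beta>)" using that by (simp add: comps_def)
    have "h (mqsym \<beta>) = (\<Sum>\<alpha>\<in>comps (sum_list \<beta>). comp_kostka_inv (sum_list \<beta>) \<beta> \<alpha> * h (qschur \<alpha>))" if "h \<in> NSym" for h
      unfolding mqsym_eq_sum_qschur[OF b]
      by (rule qlinear_sum[OF NSym_qlinear[OF that]]) (simp add: comps_def qschur_in_QSym)
    from this[OF f] this[OF g] show ?thesis
      by (simp only:) (rule sum.cong, auto simp: comps_def eq)
  qed
  show "f q = g q"
  proof (cases "q \<in> QSym")
    case True
    obtain n where n: "\<forall>m. coeff q m \<noteq> 0 \<longrightarrow> mdeg m \<le> n" using QSym_degree[OF True] ..
    have "h q = (\<Sum>\<alpha>\<in>(\<Union>k\<le>n. comps k). coeff q (monomial \<alpha>) * h (mqsym \<alpha>))" if "h \<in> NSym" for h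
      by (subst QSym_expand[OF True, of n])
         (use n in \<open>auto intro!: qlinear_sum[OF NSym_qlinear[OF that]] mqsym_in_QSym\<close>)
    from this[OF f] this[OF g] show ?thesis
      by (simp only:) (rule sum.cong, auto simp: comps_def M)
  next
    case False
    then show ?thesis using f g by (simp add: NSym_def)
  qed
qed

text \<open>
  The functional of degree \<open>n\<close> with the value \<open>d \<alpha>\<close> at \<open>M\<^sub>\<alpha>\<close>.
\<close>

definition functional :: "nat \<Rightarrow> (nat list \<Rightarrow> rat) \<Rightarrow> mpser \<Rightarrow> rat" where
  "functional n d = (\<lambda>q. if q \<in> QSym then \<Sum>\<alpha>\<in>comps n. coeff q (monomial \<alpha>) * d \<alpha> else 0)"

lemma functional_NSym: "functional n d \<in> NSym"
proof -
  have z: "p + q \<in> QSym" "mscale c p \<in> QSym" if "p \<in> QSym" "q \<in> QSym" for p q c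
    using that ser.subspace_add[OF subspace_QSym] ser.subspace_scale[OF subspace_QSym] by auto
  have "functional n d q = 0" if "q \<in> QSym" "\<forall>m. coeff q m \<noteq> 0 \<longrightarrow> n < mdeg m" for q
  proof -
    have "coeff q (monomial \<alpha>) = 0" if "\<alpha> \<in> comps n" for \<alpha>
    proof (rule ccontr)
      assume "coeff q (monomial \<alpha>) \<noteq> 0"
      then have "n < mdeg (monomial \<alpha>)" using \<open>\<forall>m. _ m\<close> by blast
      then show False using that by (simp add: mdeg_eq_exponents exponents_nth comps_def)
    qed
    then show ?thesis by (simp add: functional_def)
  qed
  then have "\<exists>n'. \<forall>q\<in>QSym. (\<forall>m. coeff q m \<noteq> 0 \<longrightarrow> n' < mdeg m) \<longrightarrow> functional n d q = 0" by blast
  then show ?thesis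
    unfolding NSym_def
    by (simp add: z functional_def distrib_right sum.distrib sum_distrib_left mult.assoc)
qed

lemma functional_mqsym:
  assumes "is_composition \<alpha>"
  shows "functional n d (mqsym \<alpha>) = (if \<alpha> \<in> comps n then d \<alpha> else 0)"
proof -
  have "functional n d (mqsym \<alpha>) = (\<Sum>\<beta>\<in>comps n. if \<beta> = \<alpha> then d \<beta> else 0)"
    unfolding functional_def using mqsym_in_QSym
    by (auto simp: coeff_mqsym exponents_nth comps_def intro!: sum.cong)
  then show ?thesis by simp
qed

lemma functional_homogeneous:
  assumes "q \<in> QSym" "\<And>m. mdeg m = n \<Longrightarrow> coeff q m = 0"
  shows "functional n d q = 0"
  using assms by (auto simp: functional_def comps_def mdeg_eq_exponents exponents_nth)

lemma coeff_qschur_degree: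
  assumes "is_composition \<gamma>" "mdeg m \<noteq> sum_list \<gamma>"
  shows "coeff (qschur \<gamma>) m = 0"
  using comp_kostka_nonzero_size[OF assms(1) is_composition_exponents, of m] assms(2)
  by (auto simp: coeff_qschur mdeg_eq_exponents)

lemma functional_qschur:
  assumes \<gamma>: "is_composition \<gamma>"
  shows "functional n d (qschur \<gamma>) = (if \<gamma> \<in> comps n then \<Sum>\<beta>\<in>comps n. of_nat (comp_kostka \<gamma> \<beta>) * d \<beta> else 0)"
proof (cases "\<gamma> \<in> comps n")
  case True
  then show ?thesis
    by (auto simp: functional_def qschur_in_QSym \<gamma> coeff_qschur exponents_nth comps_def intro!: sum.cong)
next
  case False
  then show ?thesis
    using functional_homogeneous[OF qschur_in_QSym[OF \<gamma>], of n d] coeff_qschur_degree[OF \<gamma>] \<gamma>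
    by (auto simp: comps_def)
qed

text \<open>
  The value of \<open>S\<^sup>*\<^sub>\<alpha>\<close> at \<open>M\<^sub>\<beta>\<close> is the coefficient of \<open>S\<^sub>\<alpha>\<close> in \<open>M\<^sub>\<beta>\<close>, an entry of the inverse matrix.
\<close>

lemma ncschur_eq_functional:
  assumes \<alpha>: "is_composition \<alpha>"
  shows "ncschur \<alpha> = functional (sum_list \<alpha>) (\<lambda>\<beta>. comp_kostka_inv (sum_list \<alpha>) \<beta> \<alpha>)"
    and "ncschur \<alpha> \<in> NSym"
    and "is_composition \<beta> \<Longrightarrow> ncschur \<alpha> (qschur \<beta>) = (if \<alpha> = \<beta> then 1 else 0)"
proof -
  let ?n = "sum_list \<alpha>"
  let ?f = "functional ?n (\<lambda>\<beta>. comp_kostka_inv ?n \<beta> \<alpha>)"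
  have dual: "?f (qschur \<beta>) = (if \<alpha> = \<beta> then 1 else 0)" if "is_composition \<beta>" for \<beta>
  proof (cases "\<beta> \<in> comps ?n")
    case True
    have "\<alpha> \<in> comps ?n" using \<alpha> by (simp add: comps_def)
    with True have "(\<Sum>k\<in>comps ?n. of_nat (comp_kostka \<beta> k) * comp_kostka_inv ?n k \<alpha>) = (if \<beta> = \<alpha> then 1 else 0)"
      using inverse_comp_kostka[of ?n] unfolding inverse_on_def by blast
    then show ?thesis using True by (simp add: functional_qschur[OF that] eq_commute)
  next
    case False
    then have "\<alpha> \<noteq> \<beta>" using \<alpha> by (auto simp: comps_def)
    then show ?thesis using False by (simp add: functional_qschur[OF that])
  qed
  have ex: "?f \<in> NSym \<and> (\<forall>\<beta>. is_composition \<beta> \<longrightarrow> ?f (qschur \<beta>) = (if \<alpha> = \<beta> then 1 else 0))"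
    using functional_NSym dual by blast
  show eq: "ncschur \<alpha> = ?f"
    unfolding ncschur_def
  proof (rule the_equality)
    show "?f \<in> NSym \<and> (\<forall>\<beta>. is_composition \<beta> \<longrightarrow> ?f (qschur \<beta>) = (if \<alpha> = \<beta> then 1 else 0))" by (rule ex)
  next
    fix g assume g: "g \<in> NSym \<and> (\<forall>\<beta>. is_composition \<beta> \<longrightarrow> g (qschur \<beta>) = (if \<alpha> = \<beta> then 1 else 0))"
    show "g = ?f" by (rule NSym_eqI) (use g ex in simp_all)
  qed
  show "ncschur \<alpha> \<in> NSym" "is_composition \<beta> \<Longrightarrow> ncschur \<alpha> (qschur \<beta>) = (if \<alpha> = \<beta> then 1 else 0)"
    unfolding eq using ex by auto
qed

section \<open>The product of functionals\<close>

lemma tensor_apply_superset: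
  assumes "finite S" "keys t \<subseteq> S"
  shows "tensor_apply f g t = (\<Sum>(\<beta>, \<gamma>)\<in>S. lookup t (\<beta>, \<gamma>) * (f (mqsym \<beta>) * g (mqsym \<gamma>)))"
  unfolding tensor_apply_def
  by (rule sum.mono_neutral_left) (use assms in \<open>auto simp: in_keys_iff\<close>)

lemma tensor_apply_add: "tensor_apply f g (s + t) = tensor_apply f g s + tensor_apply f g t"
proof -
  let ?S = "keys s \<union> keys t"
  have k: "keys (s + t) \<subseteq> ?S" by (rule Poly_Mapping.keys_add)
  have "tensor_apply f g u = (\<Sum>(\<beta>, \<gamma>)\<in>?S. lookup u (\<beta>, \<gamma>) * (f (mqsym \<beta>) * g (mqsym \<gamma>)))"
    if "keys u \<subseteq> ?S" for u by (rule tensor_apply_superset) (use that in auto)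
  from this[OF k] this[of s] this[of t] show ?thesis
    by (simp add: lookup_add distrib_right sum.distrib case_prod_unfold)
qed

lemma tensor_apply_single:
  "tensor_apply f g (Poly_Mapping.single x c) = c * (f (mqsym (fst x)) * g (mqsym (snd x)))"
  by (simp add: tensor_apply_def case_prod_unfold)

lemma tensor_apply_sum: "tensor_apply f g (\<Sum>x\<in>A. t x) = (\<Sum>x\<in>A. tensor_apply f g (t x))"
  by (induction A rule: infinite_finite_induct) (simp_all add: tensor_apply_add, simp_all add: tensor_apply_def)

definition deconc :: "nat list \<Rightarrow> (nat list \<times> nat list) set" where
  "deconc \<alpha> = {(\<beta>, \<gamma>). \<beta> @ \<gamma> = \<alpha>}"

lemma finite_deconc [simp]: "finite (deconc \<alpha>)"
proof -
  have "deconc \<alpha> \<subseteq> (\<lambda>i. (take i \<alpha>, drop i \<alpha>)) ` {..length \<alpha>}"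
  proof clarify
    fix \<beta> \<gamma> assume "(\<beta>, \<gamma>) \<in> deconc \<alpha>"
    then have "\<alpha> = \<beta> @ \<gamma>" by (simp add: deconc_def)
    then show "(\<beta>, \<gamma>) \<in> (\<lambda>i. (take i \<alpha>, drop i \<alpha>)) ` {..length \<alpha>}"
      by (intro image_eqI[of _ _ "length \<beta>"]) auto
  qed
  then show ?thesis by (rule finite_subset) simp
qed

definition prod_coeff :: "(mpser \<Rightarrow> rat) \<Rightarrow> (mpser \<Rightarrow> rat) \<Rightarrow> nat list \<Rightarrow> rat" where
  "prod_coeff f g \<alpha> = (\<Sum>(\<beta>, \<gamma>)\<in>deconc \<alpha>. f (mqsym \<beta>) * g (mqsym \<gamma>))"

definition homogeneous :: "nat \<Rightarrow> (mpser \<Rightarrow> rat) \<Rightarrow> bool" where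
  "homogeneous n f \<longleftrightarrow> (\<forall>\<gamma>. is_composition \<gamma> \<and> sum_list \<gamma> \<noteq> n \<longrightarrow> f (mqsym \<gamma>) = 0)"

lemma homogeneous_functional: "homogeneous n (functional n d)"
  by (simp add: homogeneous_def functional_mqsym comps_def)

lemma prod_coeff_degree:
  assumes f: "homogeneous n f" and g: "homogeneous k g" and \<alpha>: "is_composition \<alpha>" "sum_list \<alpha> \<noteq> n + k"
  shows "prod_coeff f g \<alpha> = 0"
  unfolding prod_coeff_def
proof (rule sum.neutral, clarify)
  fix \<beta> \<gamma> assume "(\<beta>, \<gamma>) \<in> deconc \<alpha>"
  then have c: "is_composition \<beta>" "is_composition \<gamma>" "sum_list \<beta> + sum_list \<gamma> \<noteq> n + k"
    using \<alpha> by (auto simp: deconc_def is_composition_def)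
  then have "sum_list \<beta> \<noteq> n \<or> sum_list \<gamma> \<noteq> k" by auto
  then show "f (mqsym \<beta>) * g (mqsym \<gamma>) = 0"
    using f g c(1,2) unfolding homogeneous_def by auto
qed

lemma nsym_mult_eq_functional:
  assumes f: "homogeneous n f" and g: "homogeneous k g"
  shows "f *\<^sub>N g = functional (n + k) (prod_coeff f g)"
proof
  fix q
  show "(f *\<^sub>N g) q = functional (n + k) (prod_coeff f g) q"
  proof (cases "q \<in> QSym")
    case True
    let ?c = "\<lambda>\<alpha>. coeff q (monomial \<alpha>)"
    let ?S = "{\<alpha>. is_composition \<alpha> \<and> ?c \<alpha> \<noteq> 0}"
    have S: "{\<alpha>. is_composition \<alpha> \<and> ser.representation (mqsym ` Collect is_composition) q (mqsym \<alpha>) \<noteq> 0} = ?S"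
      using representation_mqsym[OF True] by auto
    have finS: "finite ?S"
    proof -
      obtain N where N: "\<forall>m. coeff q m \<noteq> 0 \<longrightarrow> mdeg m \<le> N" using QSym_degree[OF True] ..
      have "?S \<subseteq> (\<Union>k\<le>N. comps k)"
      proof clarify
        fix \<alpha> assume "is_composition \<alpha>" "?c \<alpha> \<noteq> 0"
        moreover have "mdeg (monomial \<alpha>) \<le> N" using N \<open>?c \<alpha> \<noteq> 0\<close> by blast
        ultimately show "\<alpha> \<in> (\<Union>k\<le>N. comps k)" by (simp add: comps_def mdeg_eq_exponents exponents_nth)
      qed
      then show ?thesis by (rule finite_subset) simp
    qed
    have "(f *\<^sub>N g) q = tensor_apply f g (coproduct q)" using True by (simp add: nsym_mult_def)
    also have "coproduct q = (\<Sum>\<alpha>\<in>?S. \<Sum>(\<beta>, \<gamma>)\<in>deconc \<alpha>. Poly_Mapping.single (\<beta>, \<gamma>) (?c \<alpha>))"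
      unfolding coproduct_def Let_def S deconc_def
      by (rule sum.cong) (auto simp: representation_mqsym[OF True])
    also have "tensor_apply f g \<dots> = (\<Sum>\<alpha>\<in>?S. ?c \<alpha> * prod_coeff f g \<alpha>)"
      by (simp add: tensor_apply_sum tensor_apply_single case_prod_unfold prod_coeff_def sum_distrib_left)
    also have "\<dots> = (\<Sum>\<alpha>\<in>comps (n + k). ?c \<alpha> * prod_coeff f g \<alpha>)"
    proof (rule sum.mono_neutral_cong)
      show "?c \<alpha> * prod_coeff f g \<alpha> = 0" if "\<alpha> \<in> ?S - comps (n + k)" for \<alpha>
        using that prod_coeff_degree[OF f g, of \<alpha>] by (simp add: comps_def)
      show "?c \<alpha> * prod_coeff f g \<alpha> = 0" if "\<alpha> \<in> comps (n + k) - ?S" for \<alpha>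
        using that by (auto simp: comps_def)
    qed (use finS in auto)
    finally show ?thesis using True by (simp add: functional_def)
  qed (simp add: nsym_mult_def functional_def)
qed

section \<open>The forgetful map\<close>

text \<open>
  For a functional of degree \<open>n\<close> this is its image under the forgetful map (\<open>forget_functional\<close>).
\<close>

definition hseries :: "nat \<Rightarrow> (mpser \<Rightarrow> rat) \<Rightarrow> mpser" where
  "hseries n f = (\<Sum>\<alpha>\<in>comps n. mscale (f (mqsym \<alpha>)) (hsym \<alpha>))"

lemma hsym_append: "hsym (\<beta> @ \<gamma>) = hsym \<beta> * hsym \<gamma>"
  by (simp add: hsym_def)

text \<open>
  The ways to deconcatenate \<open>\<alpha>\<close> into \<open>\<beta>\<close> and \<open>\<gamma>\<close> are the ways to factor \<open>h\<^sub>\<alpha>\<close> as \<open>h\<^sub>\<beta> h\<^sub>\<gamma>\<close>; homogeneity of \<open>f\<close> and \<open>g\<close>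
  leaves only the factors of degrees \<open>n\<close> and \<open>k\<close>.
\<close>

lemma hseries_mult:
  assumes f: "homogeneous n f" and g: "homogeneous k g"
  shows "hseries (n + k) (f *\<^sub>N g) = hseries n f * hseries k g"
proof -
  let ?t = "\<lambda>(\<beta>, \<gamma>). mscale (f (mqsym \<beta>) * g (mqsym \<gamma>)) (hsym (\<beta> @ \<gamma>))"
  have "hseries (n + k) (f *\<^sub>N g) = (\<Sum>\<alpha>\<in>comps (n + k). mscale (prod_coeff f g \<alpha>) (hsym \<alpha>))"
    unfolding hseries_def nsym_mult_eq_functional[OF f g]
    by (rule sum.cong) (auto simp: functional_mqsym comps_def)
  also have "\<dots> = (\<Sum>\<alpha>\<in>comps (n + k). \<Sum>x\<in>deconc \<alpha>. ?t x)"
    unfolding prod_coeff_def ser.scale_sum_left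
    by (intro sum.cong refl) (auto simp: deconc_def)
  also have "\<dots> = (\<Sum>(\<alpha>, x)\<in>(SIGMA \<alpha>:comps (n + k). deconc \<alpha>). ?t x)"
    by (rule sum.Sigma) auto
  also have "\<dots> = (\<Sum>x\<in>{(\<beta>, \<gamma>). \<beta> @ \<gamma> \<in> comps (n + k)}. ?t x)"
    by (rule sum.reindex_bij_witness[where i = "\<lambda>(\<beta>, \<gamma>). (\<beta> @ \<gamma>, \<beta>, \<gamma>)" and j = snd])
       (auto simp: deconc_def)
  also have "\<dots> = (\<Sum>x\<in>comps n \<times> comps k. ?t x)"
  proof (rule sum.mono_neutral_right)
    have "{(\<beta>, \<gamma>). \<beta> @ \<gamma> \<in> comps (n + k)} = (\<Union>\<alpha>\<in>comps (n + k). deconc \<alpha>)"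
      by (auto simp: deconc_def)
    then show "finite {(\<beta>, \<gamma>). \<beta> @ \<gamma> \<in> comps (n + k)}" by simp
    show "comps n \<times> comps k \<subseteq> {(\<beta>, \<gamma>). \<beta> @ \<gamma> \<in> comps (n + k)}"
      by (auto simp: comps_def is_composition_def)
    show "\<forall>x\<in>{(\<beta>, \<gamma>). \<beta> @ \<gamma> \<in> comps (n + k)} - comps n \<times> comps k. ?t x = 0"
    proof
      fix x assume x: "x \<in> {(\<beta>, \<gamma>). \<beta> @ \<gamma> \<in> comps (n + k)} - comps n \<times> comps k"
      obtain \<beta> \<gamma> where xe: "x = (\<beta>, \<gamma>)" by (cases x)
      from x have a: "\<beta> @ \<gamma> \<in> comps (n + k)" "(\<beta>, \<gamma>) \<notin> comps n \<times> comps k" by (simp_all add: xe)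
      then have c: "is_composition \<beta>" "is_composition \<gamma>" by (auto simp: comps_def is_composition_def)
      then have "sum_list \<beta> \<noteq> n \<or> sum_list \<gamma> \<noteq> k" using a by (auto simp: comps_def)
      then have "f (mqsym \<beta>) * g (mqsym \<gamma>) = 0" using f g c unfolding homogeneous_def by auto
      then show "?t x = 0" unfolding xe prod.case by simp
    qed
  qed
  also have "\<dots> = hseries n f * hseries k g"
    unfolding hseries_def sum_product sum.cartesian_product
    by (rule sum.cong) (auto simp: mscale_mult hsym_append ser.scale_scale)
  finally show ?thesis .
qed

lemma hsym_underlying: "hsym \<alpha> = hsym (underlying \<alpha>)"
proof -
  have "hsym \<beta> = prod_mset (image_mset hcomplete (mset \<beta>))" for \<beta>
    by (simp add: hsym_def prod_mset_prod_list flip: mset_map)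
  then show ?thesis by (simp add: mset_underlying)
qed

lemma hseries_eq_sum_parts:
  assumes f: "qlinear f"
  shows "hseries n f = (\<Sum>l\<in>parts n. mscale (f (msym l)) (hsym l))"
proof -
  have "hseries n f = (\<Sum>l\<in>parts n. \<Sum>\<alpha>\<in>{\<alpha>\<in>comps n. underlying \<alpha> = l}. mscale (f (mqsym \<alpha>)) (hsym \<alpha>))"
    unfolding hseries_def
  proof (rule sum.group[symmetric])
    show "underlying ` comps n \<subseteq> parts n" using underlying_in_parts by (fastforce simp: comps_def)
  qed simp_all
  also have "\<dots> = (\<Sum>l\<in>parts n. mscale (f (msym l)) (hsym l))"
  proof (rule sum.cong[OF refl])
    fix l assume l: "l \<in> parts n"
    have R: "{\<alpha>\<in>comps n. underlying \<alpha> = l} = rearrangements l"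
      using l by (auto simp: comps_def rearrangements_def parts_def sum_list_underlying)
    have "f (msym l) = (\<Sum>\<alpha>\<in>rearrangements l. f (mqsym \<alpha>))"
      using qlinear_sum[OF f, of "rearrangements l" mqsym "\<lambda>_. 1"] mqsym_in_QSym l
      by (simp add: msym_eq_sum_mqsym parts_def)
    then have "mscale (f (msym l)) (hsym l) = (\<Sum>\<alpha>\<in>rearrangements l. mscale (f (mqsym \<alpha>)) (hsym l))"
      by (simp add: ser.scale_sum_left)
    also have "\<dots> = (\<Sum>\<alpha>\<in>rearrangements l. mscale (f (mqsym \<alpha>)) (hsym \<alpha>))"
    proof (rule sum.cong[OF refl])
      fix \<alpha> assume "\<alpha> \<in> rearrangements l"
      then show "mscale (f (mqsym \<alpha>)) (hsym l) = mscale (f (mqsym \<alpha>)) (hsym \<alpha>)"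
        using hsym_underlying[of \<alpha>] by (simp add: rearrangements_def)
    qed
    finally show "(\<Sum>\<alpha>\<in>{\<alpha>\<in>comps n. underlying \<alpha> = l}. mscale (f (mqsym \<alpha>)) (hsym \<alpha>)) = mscale (f (msym l)) (hsym l)"
      unfolding R ..
  qed
  finally show ?thesis .
qed

text \<open>
  Replacing \<open>h\<close> by \<open>K\<^sup>T s\<close> puts the factor \<open>K\<close> on the values at \<open>m\<close>, where \<open>K m = s\<close>.
\<close>

lemma hseries_eq_sum_schur:
  assumes f: "qlinear f"
  shows "hseries n f = (\<Sum>l\<in>parts n. mscale (f (schur l)) (schur l))"
proof -
  have "hseries n f = (\<Sum>\<mu>\<in>parts n. \<Sum>l\<in>parts n. mscale (f (msym \<mu>) * of_nat (kostka (rows l) \<mu>)) (schur l))"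
    unfolding hseries_eq_sum_parts[OF f]
    by (rule sum.cong[OF refl]) (simp add: hsym_eq_sum_schur_parts ser.scale_sum_right)
  also have "\<dots> = (\<Sum>l\<in>parts n. \<Sum>\<mu>\<in>parts n. mscale (f (msym \<mu>) * of_nat (kostka (rows l) \<mu>)) (schur l))"
    by (rule sum.swap)
  also have "\<dots> = (\<Sum>l\<in>parts n. mscale (f (schur l)) (schur l))"
  proof (rule sum.cong[OF refl])
    fix l assume l: "l \<in> parts n"
    have "f (schur l) = (\<Sum>\<mu>\<in>parts n. of_nat (kostka (rows l) \<mu>) * f (msym \<mu>))"
      unfolding schur_eq_sum_msym[OF l]
      by (rule qlinear_sum[OF f]) (use msym_in_Sym Sym_subset_QSym in blast)
    then show "(\<Sum>\<mu>\<in>parts n. mscale (f (msym \<mu>) * of_nat (kostka (rows l) \<mu>)) (schur l)) = mscale (f (schur l)) (schur l)"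
      by (simp add: ser.scale_sum_left mult.commute)
  qed
  finally show ?thesis .
qed

lemma qlinear_schur:
  assumes "qlinear f" "is_partition l"
  shows "f (schur l) = (\<Sum>\<alpha>\<in>rearrangements l. f (qschur \<alpha>))"
  using qlinear_sum[OF assms(1), of "rearrangements l" qschur "\<lambda>_. 1"] assms(2)
  by (simp add: schur_eq_sum_qschur rearrangements_def qschur_in_QSym)

lemma hseries_ncschur:
  assumes \<alpha>: "is_composition \<alpha>"
  shows "hseries (sum_list \<alpha>) (ncschur \<alpha>) = schur (underlying \<alpha>)"
proof -
  have ql: "qlinear (ncschur \<alpha>)" by (rule NSym_qlinear[OF ncschur_eq_functional(2)[OF \<alpha>]])
  have v: "ncschur \<alpha> (schur l) = (if l = underlying \<alpha> then 1 else 0)" if "l \<in> parts n" for l n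
  proof -
    have "ncschur \<alpha> (schur l) = (\<Sum>\<beta>\<in>rearrangements l. if \<alpha> = \<beta> then 1 else 0)"
      using that by (subst qlinear_schur[OF ql])
        (auto simp: parts_def rearrangements_def ncschur_eq_functional(3)[OF \<alpha>] intro!: sum.cong)
    also have "\<dots> = (if \<alpha> \<in> rearrangements l then 1 else 0)" by simp
    finally show ?thesis using \<alpha> by (auto simp: rearrangements_def)
  qed
  have "hseries (sum_list \<alpha>) (ncschur \<alpha>) = (\<Sum>l\<in>parts (sum_list \<alpha>). if l = underlying \<alpha> then schur l else 0)"
    unfolding hseries_eq_sum_schur[OF ql] by (rule sum.cong[OF refl]) (simp add: v)
  also have "\<dots> = schur (underlying \<alpha>)" using underlying_in_parts[OF \<alpha>] by simp
  finally show ?thesis .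
qed

lemma hall_eq:
  assumes "g \<in> Sym" "p \<in> Sym"
  shows "hall g p = (\<Sum>l | is_partition l \<and> hsym_coord l g * coeff p (monomial l) \<noteq> 0.
    hsym_coord l g * coeff p (monomial l))"
  unfolding hall_def Let_def
  by (rule sum.cong) (auto simp: representation_hsym[OF assms(1)] representation_msym[OF assms(2)])

lemma hall_msym:
  assumes "g \<in> Sym" "is_partition l"
  shows "hall g (msym l) = hsym_coord l g"
proof -
  have "{l'. is_partition l' \<and> hsym_coord l' g * coeff (msym l) (monomial l') \<noteq> 0} \<subseteq> {l}"
    by (auto simp: coeff_msym underlying_exponents_nth)
  then have "hall g (msym l) = (\<Sum>l'\<in>{l}. hsym_coord l' g * coeff (msym l) (monomial l'))"
    unfolding hall_eq[OF assms(1) msym_in_Sym]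
    by (intro sum.mono_neutral_left) (use assms(2) in auto)
  then show ?thesis using assms(2) by (simp add: coeff_msym underlying_exponents_nth)
qed

text \<open>
  As \<open>h\<close> and \<open>m\<close> are dual, the Hall inner product with \<open>m\<^sub>l\<close> is the coordinate at \<open>h\<^sub>l\<close>, and these coordinates
  determine a symmetric function.
\<close>

lemma forget_eqI:
  assumes f: "qlinear f" and g: "g \<in> Sym" and eq: "\<And>l. is_partition l \<Longrightarrow> hsym_coord l g = f (msym l)"
  shows "forget f = g"
  unfolding forget_def
proof (rule the_equality)
  have "hall g p = f p" if p: "p \<in> Sym" for p
  proof -
    obtain n where n: "\<forall>m. coeff p m \<noteq> 0 \<longrightarrow> mdeg m \<le> n" using Sym_degree[OF p] ..
    let ?P = "\<Union>k\<le>n. parts k"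
    have sub: "{l. is_partition l \<and> hsym_coord l g * coeff p (monomial l) \<noteq> 0} \<subseteq> ?P"
    proof clarify
      fix l assume "is_partition l" "hsym_coord l g * coeff p (monomial l) \<noteq> 0"
      moreover from this have "mdeg (monomial l) \<le> n" using n by auto
      ultimately show "l \<in> ?P" by (simp add: mdeg_underlying underlying_exponents_nth parts_def)
    qed
    have "hall g p = (\<Sum>l\<in>?P. hsym_coord l g * coeff p (monomial l))"
      unfolding hall_eq[OF g p]
    proof (rule sum.mono_neutral_left[OF _ sub])
      show "\<forall>l\<in>?P - {l. is_partition l \<and> hsym_coord l g * coeff p (monomial l) \<noteq> 0}.
          hsym_coord l g * coeff p (monomial l) = 0"
        by (auto simp: parts_def)
    qed simp
    also have "\<dots> = (\<Sum>l\<in>?P. coeff p (monomial l) * f (msym l))"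
      by (rule sum.cong) (auto simp: parts_def eq)
    also have "\<dots> = f (\<Sum>l\<in>?P. mscale (coeff p (monomial l)) (msym l))"
      by (rule qlinear_sum[OF f, symmetric]) (use msym_in_Sym Sym_subset_QSym in blast)
    also have "(\<Sum>l\<in>?P. mscale (coeff p (monomial l)) (msym l)) = p"
      by (rule Sym_expand[OF p, symmetric]) (use n in blast)
    finally show ?thesis .
  qed
  then show "g \<in> Sym \<and> (\<forall>p\<in>Sym. hall g p = f p)" using g by blast
next
  fix h assume h: "h \<in> Sym \<and> (\<forall>p\<in>Sym. hall h p = f p)"
  show "h = g"
  proof (rule Sym_eqI_hsym_coord)
    fix l assume l: "is_partition l"
    have "hsym_coord l h = hall h (msym l)" using hall_msym[of h l] h l by simp
    also have "\<dots> = f (msym l)" using h msym_in_Sym by blast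
    also have "\<dots> = hsym_coord l g" by (rule eq[OF l, symmetric])
    finally show "hsym_coord l h = hsym_coord l g" .
  qed (use h g in auto)
qed

lemma forget_functional:
  "forget (functional n d) = hseries n (functional n d)"
proof (rule forget_eqI)
  let ?f = "functional n d"
  have f: "qlinear ?f" by (rule NSym_qlinear[OF functional_NSym])
  then show "qlinear ?f" .
  note hs = hseries_eq_sum_parts[OF f, of n]
  show "hseries n ?f \<in> Sym"
    unfolding hs by (intro ser.subspace_sum[OF subspace_Sym] ser.subspace_scale[OF subspace_Sym] hsym_in_Sym)
  fix l assume l: "is_partition l"
  have "hsym_coord l (hseries n ?f) = (\<Sum>\<mu>\<in>parts n. ?f (msym \<mu>) * hsym_coord l (hsym \<mu>))"
    unfolding hs by (rule ser.coordinate_sum[OF hsym_coord_add hsym_coord_scale])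
  also have "\<dots> = (\<Sum>\<mu>\<in>parts n. if \<mu> = l then ?f (msym \<mu>) else 0)"
    by (rule sum.cong) (auto simp: parts_def hsym_coord_hsym l)
  also have "\<dots> = (if l \<in> parts n then ?f (msym l) else 0)" by simp
  also have "\<dots> = ?f (msym l)"
  proof (cases "l \<in> parts n")
    case False
    then have "?f (msym l) = 0"
      using l by (intro functional_homogeneous)
        (use msym_in_Sym Sym_subset_QSym in \<open>auto simp: coeff_msym mdeg_underlying parts_def\<close>)
    then show ?thesis by simp
  qed simp
  finally show "hsym_coord l (hseries n ?f) = ?f (msym l)" .
qed

lemma functional_expand:
  "functional n d = (\<Sum>\<gamma>\<in>comps n. fscale (functional n d (qschur \<gamma>)) (ncschur \<gamma>))"
proof -
  have sub: "fnl.subspace NSym"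
    unfolding fnl.subspace_def
  proof (intro conjI ballI allI)
    show "0 \<in> NSym" by (simp add: NSym_def)
  next
    fix f g assume f: "f \<in> NSym" and g: "g \<in> NSym"
    obtain a where a: "\<forall>q\<in>QSym. (\<forall>m. coeff q m \<noteq> 0 \<longrightarrow> a < mdeg m) \<longrightarrow> f q = 0"
      using f by (auto simp: NSym_def)
    obtain b where b: "\<forall>q\<in>QSym. (\<forall>m. coeff q m \<noteq> 0 \<longrightarrow> b < mdeg m) \<longrightarrow> g q = 0"
      using g by (auto simp: NSym_def)
    have "\<forall>q\<in>QSym. (\<forall>m. coeff q m \<noteq> 0 \<longrightarrow> max a b < mdeg m) \<longrightarrow> (f + g) q = 0"
      using a b by simp
    then have "\<exists>n. \<forall>q\<in>QSym. (\<forall>m. coeff q m \<noteq> 0 \<longrightarrow> n < mdeg m) \<longrightarrow> (f + g) q = 0" by blast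
    then show "f + g \<in> NSym" using f g unfolding NSym_def mem_Collect_eq
      by (simp add: algebra_simps)
  next
    fix c f assume f: "f \<in> NSym"
    then obtain a where "\<forall>q\<in>QSym. (\<forall>m. coeff q m \<noteq> 0 \<longrightarrow> a < mdeg m) \<longrightarrow> f q = 0"
      by (auto simp: NSym_def)
    then have "\<exists>n. \<forall>q\<in>QSym. (\<forall>m. coeff q m \<noteq> 0 \<longrightarrow> n < mdeg m) \<longrightarrow> fscale c f q = 0"
      by (intro exI[of _ a]) (simp add: fscale_def)
    then show "fscale c f \<in> NSym" using f unfolding NSym_def mem_Collect_eq
      by (simp add: fscale_def algebra_simps)
  qed
  have rhs: "(\<Sum>\<gamma>\<in>comps n. fscale (functional n d (qschur \<gamma>)) (ncschur \<gamma>)) \<in> NSym"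
    by (intro fnl.subspace_sum[OF sub] fnl.subspace_scale[OF sub] ncschur_eq_functional(2)) (simp add: comps_def)
  have app: "(\<Sum>x\<in>A. h x) q = (\<Sum>x\<in>A. h x q)" for A and h :: "nat list \<Rightarrow> mpser \<Rightarrow> rat" and q
    by (induction A rule: infinite_finite_induct) auto
  show ?thesis
  proof (rule NSym_eqI[OF functional_NSym rhs])
    fix \<delta> assume \<delta>: "is_composition \<delta>"
    have "(\<Sum>\<gamma>\<in>comps n. fscale (functional n d (qschur \<gamma>)) (ncschur \<gamma>)) (qschur \<delta>)
        = (\<Sum>\<gamma>\<in>comps n. if \<gamma> = \<delta> then functional n d (qschur \<gamma>) else 0)"
      unfolding app fscale_def
      by (rule sum.cong) (auto simp: comps_def ncschur_eq_functional(3) \<delta>)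
    also have "\<dots> = functional n d (qschur \<delta>)" using functional_qschur[OF \<delta>, of n d] by simp
    finally show "functional n d (qschur \<delta>) = (\<Sum>\<gamma>\<in>comps n. fscale (functional n d (qschur \<gamma>)) (ncschur \<gamma>)) (qschur \<delta>)" ..
  qed
qed

lemma representation_functional:
  assumes "is_composition \<gamma>"
  shows "fnl.representation (ncschur ` Collect is_composition) (functional n d) (ncschur \<gamma>) = functional n d (qschur \<gamma>)"
proof (rule fnl.representation_coordinates[where \<phi> = "\<lambda>\<gamma> f. f (qschur \<gamma>)"])
  show "functional n d \<in> fnl.span (ncschur ` Collect is_composition)"
    by (subst functional_expand, intro fnl.span_sum fnl.span_scale fnl.span_base) (auto simp: comps_def)
qed (use assms in \<open>auto simp: fscale_def ncschur_eq_functional(3)\<close>)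

theorem corollary3p7:
  fixes \<alpha> \<beta> lam \<mu> \<nu> :: "nat list"
  assumes "is_composition \<alpha>" and "is_composition \<beta>"
    and "lam = underlying \<alpha>" and "\<mu> = underlying \<beta>"
    and "is_partition \<nu>"
  shows "forget (ncschur \<alpha> *\<^sub>N ncschur \<beta>) = schur lam * schur \<mu> \<and>
    lr_coeff lam \<mu> \<nu> = (\<Sum>\<gamma> | is_composition \<gamma> \<and> underlying \<gamma> = \<nu>. nc_lr_coeff \<alpha> \<beta> \<gamma>)"
proof -
  let ?n = "sum_list \<alpha>" and ?k = "sum_list \<beta>"
  let ?F = "ncschur \<alpha> *\<^sub>N ncschur \<beta>"
  have hom: "homogeneous ?n (ncschur \<alpha>)" "homogeneous ?k (ncschur \<beta>)"
    using homogeneous_functional assms(1,2) by (simp_all add: ncschur_eq_functional(1))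
  obtain d where F: "?F = functional (?n + ?k) d"
    using nsym_mult_eq_functional[OF hom] by blast
  have ql: "qlinear ?F" unfolding F by (rule NSym_qlinear[OF functional_NSym])
  have prod: "hseries (?n + ?k) ?F = schur lam * schur \<mu>"
    unfolding hseries_mult[OF hom] assms(3,4) by (simp add: hseries_ncschur assms(1,2))
  have 1: "forget ?F = schur lam * schur \<mu>"
    using forget_functional[of "?n + ?k" d] prod unfolding F by simp
  have schur_prod: "schur lam * schur \<mu> = (\<Sum>l\<in>parts (?n + ?k). mscale (?F (schur l)) (schur l))"
    unfolding prod[symmetric] by (rule hseries_eq_sum_schur[OF ql])
  have "schur lam * schur \<mu> \<in> Sym"
    unfolding schur_prod
    by (intro ser.subspace_sum[OF subspace_Sym] ser.subspace_scale[OF subspace_Sym] schur_in_Sym) (simp add: parts_def)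
  then have "lr_coeff lam \<mu> \<nu> = schur_coord \<nu> (schur lam * schur \<mu>)"
    unfolding lr_coeff_def by (rule representation_schur[OF _ assms(5)])
  also have "\<dots> = (\<Sum>l\<in>parts (?n + ?k). ?F (schur l) * schur_coord \<nu> (schur l))"
    unfolding schur_prod by (rule ser.coordinate_sum[OF schur_coord_add schur_coord_scale])
  also have "\<dots> = (\<Sum>l\<in>parts (?n + ?k). if l = \<nu> then ?F (schur l) else 0)"
    by (rule sum.cong) (auto simp: parts_def schur_coord_schur assms(5))
  also have "\<dots> = (if \<nu> \<in> parts (?n + ?k) then ?F (schur \<nu>) else 0)" by simp
  also have "\<dots> = ?F (schur \<nu>)"
  proof (cases "\<nu> \<in> parts (?n + ?k)")
    case False
    have "coeff (schur \<nu>) m = 0" if "mdeg m = ?n + ?k" for m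
      using kostka_parts_zero[of \<nu> "exponents m"] False that assms(5)
      by (simp add: coeff_schur parts_def mdeg_eq_exponents)
    then have "?F (schur \<nu>) = 0"
      unfolding F using schur_in_Sym[OF assms(5)] Sym_subset_QSym by (intro functional_homogeneous) auto
    then show ?thesis by simp
  qed simp
  also have "\<dots> = (\<Sum>\<gamma>\<in>rearrangements \<nu>. ?F (qschur \<gamma>))"
    by (rule qlinear_schur[OF ql assms(5)])
  also have "\<dots> = (\<Sum>\<gamma>\<in>rearrangements \<nu>. nc_lr_coeff \<alpha> \<beta> \<gamma>)"
    by (rule sum.cong) (auto simp: rearrangements_def nc_lr_coeff_def F representation_functional)
  finally have 2: "lr_coeff lam \<mu> \<nu> = (\<Sum>\<gamma> | is_composition \<gamma> \<and> underlying \<gamma> = \<nu>. nc_lr_coeff \<alpha> \<beta> \<gamma>)"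
    by (simp add: rearrangements_def)
  from 1 2 show ?thesis ..
qed

end
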